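(* Let $K$ be a finite-dimensional Hilbert space and $H$ a separable Hilbert space, and let $\mathcal{B}=\{X\in L(K,H):\|X\|<1\}$ be the open unit ball of the Banach space $L(K,H)$ of bounded linear operators from $K$ to $H$. For a group $G$ of biholomorphic automorphisms of $\mathcal{B}$, the following statements are equivalent: (i) $G$ is elliptic on $\mathcal{B}$, i.e. for every $X\in\mathcal{B}$ the orbit $\{g(X):g\in G\}$ is separated from the boundary; (ii) at least one orbit $\{g(X_0):g\in G\}$ of $G$ is separated from the boundary; (iii) $G$ is equicontinuous, i.e. for each $\varepsilon>0$ there is $\delta>0$ such that for all $A,B\in\mathcal{B}$ with $\|A-B\|<\delta$ one has $\|g(A)-g(B)\|<\varepsilon$ for all $g\in G$; (iv) $G$ has a common fixed point in $\mathcal{B}$.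
   Context: A subset $M\subset\mathcal{B}$ is called separated from the boundary if $M\subset r\mathcal{B}=\{X:\|X\|<r\}$ for some $r\in[0,1)$. A biholomorphic automorphism of $\mathcal{B}$ is an invertible holomorphic map from $\mathcal{B}$ onto $\mathcal{B}$ (holomorphic in the sense of maps between open subsets of complex Banach spaces). Norms are operator norms. *)

theory Defs
  imports "HOL-Analysis.Analysis"
begin

text \<open>HOL-Analysis has no complex vector spaces / complex inner product spaces.
  We introduce them as a type class on top of real normed vector spaces: a complex
  scalar multiplication compatible with the real one, and a complex inner product
  (linear in the first argument, conjugate symmetric, positive definite) that
  induces the norm. A complex Hilbert space is a type of this class that is
  moreover a complete space.\<close>

class cinner_space = real_normed_vector +
  fixes cscale :: "complex \<Rightarrow> 'a \<Rightarrow> 'a"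
    and cinner :: "'a \<Rightarrow> 'a \<Rightarrow> complex"
  assumes cscale_add_right: "cscale a (x + y) = cscale a x + cscale a y"
    and cscale_add_left: "cscale (a + b) x = cscale a x + cscale b x"
    and cscale_cscale: "cscale a (cscale b x) = cscale (a * b) x"
    and cscale_one: "cscale 1 x = x"
    and scaleR_cscale: "scaleR r x = cscale (complex_of_real r) x"
    and cinner_cnj: "cinner x y = cnj (cinner y x)"
    and cinner_add_left: "cinner (x + y) z = cinner x z + cinner y z"
    and cinner_cscale_left: "cinner (cscale a x) y = a * cinner x y"
    and cinner_self_real: "Im (cinner x x) = 0"
    and cinner_self_nonneg: "0 \<le> Re (cinner x x)"
    and cinner_self_eq_0: "cinner x x = 0 \<longleftrightarrow> x = 0"
    and norm_cinner: "norm x = sqrt (Re (cinner x x))"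

definition cfinite_dim :: "'a::cinner_space itself \<Rightarrow> bool" where
  "cfinite_dim _ \<longleftrightarrow>
     (\<exists>S::'a set. finite S \<and> (\<forall>x. \<exists>c. x = (\<Sum>s\<in>S. cscale (c s) s)))"

definition separable_space :: "'a::metric_space itself \<Rightarrow> bool" where
  "separable_space _ \<longleftrightarrow> (\<exists>D::'a set. countable D \<and> closure D = UNIV)"

definition Lc :: "('k::cinner_space \<Rightarrow>\<^sub>L 'h::cinner_space) set" where
  "Lc = {X. \<forall>c x. blinfun_apply X (cscale c x) = cscale c (blinfun_apply X x)}"

definition opscale :: "complex \<Rightarrow> ('k::cinner_space \<Rightarrow>\<^sub>L 'h::cinner_space) \<Rightarrow> ('k \<Rightarrow>\<^sub>L 'h)" where
  "opscale c Y = Blinfun (\<lambda>x. cscale c (blinfun_apply Y x))"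

definition Bop :: "('k::cinner_space \<Rightarrow>\<^sub>L 'h::cinner_space) set" where
  "Bop = {X \<in> Lc. norm X < 1}"

text \<open>Holomorphy on a subset U (open in L(K,H)) of the complex Banach space L(K,H):
  Frechet differentiable at every point (relative to the space L(K,H)) with a
  complex-linear bounded derivative L(K,H) \<rightarrow> L(K,H).\<close>
definition holo_on ::
  "(('k::cinner_space \<Rightarrow>\<^sub>L 'h::cinner_space) \<Rightarrow> ('k \<Rightarrow>\<^sub>L 'h)) \<Rightarrow> ('k \<Rightarrow>\<^sub>L 'h) set \<Rightarrow> bool" where
  "holo_on g U \<longleftrightarrow>
     (\<forall>X\<in>U. \<exists>D. (g has_derivative D) (at X within Lc) \<and>
                (\<forall>Y\<in>Lc. D Y \<in> Lc) \<and>
                (\<forall>c. \<forall>Y\<in>Lc. D (opscale c Y) = opscale c (D Y)))"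

definition is_aut :: "(('k::cinner_space \<Rightarrow>\<^sub>L 'h::cinner_space) \<Rightarrow> ('k \<Rightarrow>\<^sub>L 'h)) \<Rightarrow> bool" where
  "is_aut g \<longleftrightarrow> bij_betw g Bop Bop \<and> holo_on g Bop \<and> holo_on (inv_into Bop g) Bop"

text \<open>A group of automorphisms of \<open>\<B>\<close> (maps are only relevant on \<open>\<B>\<close>):
  nonempty, closed under composition and inverses.\<close>
definition aut_group :: "((('k::cinner_space \<Rightarrow>\<^sub>L 'h::cinner_space) \<Rightarrow> ('k \<Rightarrow>\<^sub>L 'h)) set) \<Rightarrow> bool" where
  "aut_group G \<longleftrightarrow> G \<noteq> {} \<and> (\<forall>g\<in>G. is_aut g) \<and>
     (\<forall>g\<in>G. \<forall>h\<in>G. \<exists>k\<in>G. \<forall>X\<in>Bop. k X = g (h X)) \<and>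
     (\<forall>g\<in>G. \<exists>k\<in>G. \<forall>X\<in>Bop. k (g X) = X)"

definition separated :: "('k::cinner_space \<Rightarrow>\<^sub>L 'h::cinner_space) set \<Rightarrow> bool" where
  "separated M \<longleftrightarrow> M \<subseteq> Bop \<and> (\<exists>r. 0 \<le> r \<and> r < 1 \<and> M \<subseteq> {X. norm X < r})"

end

theory Submission
  imports Defs "HOL-Complex_Analysis.Conformal_Mappings"
begin

text \<open>For \<open>Y\<close> in the ball, the Moebius transformation centred at \<open>Y\<close>, taken in the unnormalised form
  \<open>X \<mapsto> (X - Y)(1 - Y\<^sup>*X)\<^sup>-\<^sup>1\<close>, maps the ball onto the unit ball of an equivalent norm, and the norm
  of the image of \<open>X\<close> is the pseudo-hyperbolic distance of \<open>X\<close> and \<open>Y\<close>. By the Schwarz lemma every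
  holomorphic self-map of the ball contracts this distance, so the group acts by isometries; its
  balls are convex in the linear sense.

  If one orbit is separated from the boundary, all are, by the triangle-type estimate for the
  distance, and a fixed point is obtained from uniform normal structure: as the domain of the
  operators is finite-dimensional, every midpoint-convex set in a smaller ball contains a point that
  is non-diametral by a uniform factor, so that repeatedly passing to the set of non-diametral points
  yields invariant closed sets that shrink to a point. In the coordinates centred at a fixed point the
  group is linear by Cartan's uniqueness theorem and hence equicontinuous. Conversely, if an element
  of an equicontinuous group moved 0 close to the boundary, its inverse would map a norm ball of fixed
  size that reaches the boundary into the ball of radius 1/2 about 0, against the isometry property.\<close>

section \<open>Complex inner product spaces\<close>

text \<open>The target space may be infinite-dimensional, so bounded sequences of operators need not
  have convergent subsequences and fixed point theorems of Brouwer type do not apply. Estimates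
  therefore have to be uniform, and limits are obtained from Cauchy sequences only. Finiteness of
  the domain supplies adjoints and inverses, turns pointwise into norm convergence, and drives the
  pigeonhole argument behind the fixed point.

  The invariant distance never appears as a number: \<open>rel \<rho> X Y\<close> expresses that it
  is at most \<rho>, through quadratic inequalities indexed by the vectors of the domain. In this
  form contraction is a statement about scalar holomorphic functions, convexity is that of squared
  norms, and closedness follows from continuity. The price of the unnormalised transformation is a
  changed norm on its image, which is carried by the weight \<open>wt\<close>.\<close>

lemma cscale_zero_left [simp]: "cscale 0 x = 0"
  using cscale_add_left[of 0 0 x] by simp

lemma cscale_zero_right [simp]: "cscale a (0::'a::cinner_space) = 0"
  using cscale_add_right[of a 0 "0::'a"] by simp

lemma cscale_minus_right: "cscale a (- x) = - cscale a x"
  using cscale_add_right[of a x "-x"] by (simp add: eq_neg_iff_add_eq_0 add.commute)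

lemma cscale_diff_right: "cscale a (x - y) = cscale a x - cscale a y"
  using cscale_add_right[of a x "-y"] by (simp add: cscale_minus_right)

lemma cinner_zero_left [simp]: "cinner 0 y = 0"
  using cinner_add_left[of 0 0 y] by simp

lemma cinner_zero_right [simp]: "cinner x 0 = 0"
  using cinner_cnj[of x 0] by simp

lemma cinner_minus_left: "cinner (- x) y = - cinner x y"
  using cinner_add_left[of x "-x" y] by (simp add: eq_neg_iff_add_eq_0 add.commute)

lemma cinner_diff_left: "cinner (x - y) z = cinner x z - cinner y z"
  using cinner_add_left[of x "-y" z] by (simp add: cinner_minus_left)

lemma cinner_add_right: "cinner x (y + z) = cinner x y + cinner x z"
  by (metis cinner_add_left cinner_cnj complex_cnj_add)

lemma cinner_diff_right: "cinner x (y - z) = cinner x y - cinner x z"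
  by (metis cinner_diff_left cinner_cnj complex_cnj_diff)

lemma cinner_cscale_right: "cinner x (cscale a y) = cnj a * cinner x y"
  by (metis cinner_cscale_left cinner_cnj complex_cnj_mult)

lemma cinner_sum_left: "cinner (\<Sum>i\<in>A. f i) y = (\<Sum>i\<in>A. cinner (f i) y)"
  by (induction A rule: infinite_finite_induct) (auto simp: cinner_add_left)

lemma cinner_sum_right: "cinner x (\<Sum>i\<in>A. f i) = (\<Sum>i\<in>A. cinner x (f i))"
  by (induction A rule: infinite_finite_induct) (auto simp: cinner_add_right)

lemma cscale_sum: "cscale c (\<Sum>i\<in>A. f i) = (\<Sum>i\<in>A. cscale c (f i))"
  by (induction A rule: infinite_finite_induct) (auto simp: cscale_add_right)

lemma Re_cinner_self: "Re (cinner x x) = (norm x)\<^sup>2"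
  by (simp add: norm_cinner cinner_self_nonneg)

lemma cinner_self: "cinner x x = of_real ((norm x)\<^sup>2)"
  by (simp add: complex_eq_iff Re_cinner_self cinner_self_real)

lemma norm_cscale: "norm (cscale a x) = cmod a * norm x"
proof -
  have "cinner (cscale a x) (cscale a x) = of_real ((cmod a)\<^sup>2 * (norm x)\<^sup>2)"
    unfolding of_real_mult complex_norm_square
    by (simp only: cinner_cscale_left cinner_cscale_right cinner_self [of x] mult_ac)
  then have "(norm (cscale a x))\<^sup>2 = (cmod a * norm x)\<^sup>2"
    by (metis Re_cinner_self Re_complex_of_real power_mult_distrib)
  then show ?thesis
    by (simp add: power2_eq_iff_nonneg)
qed

lemma Re_cinner_commute: "Re (cinner x y) = Re (cinner y x)"
  using cinner_cnj[of x y] by simp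

lemma norm_add_sq: "(norm (x + y))\<^sup>2 = (norm x)\<^sup>2 + 2 * Re (cinner x y) + (norm (y::'a::cinner_space))\<^sup>2"
  by (simp add: Re_cinner_self [symmetric] cinner_add_left cinner_add_right Re_cinner_commute[of y x])

lemma norm_diff_sq: "(norm (x - y))\<^sup>2 = (norm x)\<^sup>2 - 2 * Re (cinner x y) + (norm (y::'a::cinner_space))\<^sup>2"
  by (simp add: Re_cinner_self [symmetric] cinner_diff_left cinner_diff_right Re_cinner_commute[of y x])

lemma semi_inner_Cauchy_Schwarz:
  fixes f :: "'a::cinner_space \<Rightarrow> 'a \<Rightarrow> complex"
  assumes add: "\<And>x y z. f (x + y) z = f x z + f y z"
    and scale: "\<And>c x y. f (cscale c x) y = c * f x y"
    and herm: "\<And>x y. f x y = cnj (f y x)"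
    and pos: "\<And>x. 0 \<le> Re (f x x)"
  shows "(cmod (f x y))\<^sup>2 \<le> Re (f x x) * Re (f y y)"
proof -
  have addr: "f x (y + z) = f x y + f x z" for x y z
    by (metis add herm complex_cnj_add)
  have scaler: "f x (cscale c y) = cnj c * f x y" for x c y
    by (metis scale herm complex_cnj_mult)
  have comm: "Re (f y x * c) = Re (f x y * cnj c)" for c
    by (subst herm) (simp add: algebra_simps)
  have q: "0 \<le> Re (f x x) - 2 * t * (cmod (f x y))\<^sup>2 + t\<^sup>2 * (cmod (f x y))\<^sup>2 * Re (f y y)"
    for t :: real
  proof -
    \<comment> \<open>Putting the phase of \<open>f x y\<close> into \<open>c\<close> gives both
      cross terms the same real part, so that a quadratic polynomial in the real parameter
      \<open>t\<close> remains.\<close>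
    define c where "c = - of_real t * f x y"
    have "f (x + cscale c y) (x + cscale c y)
        = f x x + cnj c * f x y + c * f y x + c * cnj c * f y y"
      by (simp add: add addr scale scaler algebra_simps)
    moreover have "Re (c * f y x) = Re (cnj c * f x y)"
      using comm[of c] by (simp add: mult.commute)
    moreover have "cnj c * f x y = - of_real (t * (cmod (f x y))\<^sup>2)"
      by (simp add: c_def complex_norm_square mult.commute mult.left_commute del: of_real_power)
    moreover have "c * cnj c = of_real (t\<^sup>2 * (cmod (f x y))\<^sup>2)"
      unfolding complex_norm_square [symmetric] by (simp add: c_def norm_mult power_mult_distrib)
    ultimately show ?thesis
      using pos[of "x + cscale c y"] by simp
  qed
  show ?thesis
  proof (cases "Re (f y y) = 0")
    case True
    have "(cmod (f x y))\<^sup>2 = 0"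
    proof (rule ccontr)
      assume "(cmod (f x y))\<^sup>2 \<noteq> 0"
      then have "0 < (cmod (f x y))\<^sup>2" by simp
      \<comment> \<open>For this \<open>t\<close> the estimate \<open>q\<close> becomes 0 <= - Re (f
        x x) - 2.\<close>
      moreover define t where "t = (Re (f x x) + 1) / (cmod (f x y))\<^sup>2"
      ultimately have "t * (cmod (f x y))\<^sup>2 = Re (f x x) + 1" by simp
      then show False
        using q[of t, unfolded True mult_zero_right add_0_right] pos[of x] by linarith
    qed
    then show ?thesis using True by simp
  next
    case False
    then have p: "0 < Re (f y y)" using pos[of y] by simp
    have "0 \<le> Re (f x x) - (cmod (f x y))\<^sup>2 / Re (f y y)"
      using q[of "1 / Re (f y y)"] p by (simp add: field_simps power2_eq_square)
    then show ?thesis using p by (simp add: field_simps)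
  qed
qed

lemma cinner_Cauchy_Schwarz: "cmod (cinner x y) \<le> norm x * norm y"
proof -
  have "(cmod (cinner x y))\<^sup>2 \<le> Re (cinner x x) * Re (cinner y y)"
    by (rule semi_inner_Cauchy_Schwarz)
       (auto simp: cinner_add_left cinner_cscale_left cinner_self_nonneg intro: cinner_cnj)
  then have "(cmod (cinner x y))\<^sup>2 \<le> (norm x * norm y)\<^sup>2"
    by (simp add: Re_cinner_self power_mult_distrib)
  then show ?thesis
    by (rule power2_le_imp_le) simp
qed


lemma cinner_ext:
  assumes "\<And>y. cinner x y = cinner x' y" shows "x = x'"
proof -
  have "cinner (x - x') (x - x') = 0"
    using assms by (simp add: cinner_diff_left)
  then show ?thesis by (simp add: cinner_self_eq_0)
qed

lemma bounded_linear_cscale: "bounded_linear (cscale c)"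
  by (rule bounded_linear_intro[of _ "cmod c"])
     (auto simp: cscale_add_right norm_cscale scaleR_cscale cscale_cscale mult.commute)

lemma bounded_linear_cscale_left: "bounded_linear (\<lambda>c. cscale c x)"
  by (rule bounded_linear_intro[of _ "norm x"])
     (auto simp: cscale_add_left norm_cscale scaleR_cscale cscale_cscale scaleR_conv_of_real)

lemma bounded_linear_cinner_left: "bounded_linear (\<lambda>x. cinner x y)"
  by (rule bounded_linear_intro[of _ "norm y"])
     (auto simp: cinner_add_left scaleR_cscale cinner_cscale_left scaleR_conv_of_real cinner_Cauchy_Schwarz)

section \<open>Complex linear operators\<close>

lemma opscale_apply [simp]: "blinfun_apply (opscale c Y) x = cscale c (blinfun_apply Y x)"
  unfolding opscale_def
  by (subst bounded_linear_Blinfun_apply)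
     (auto intro: bounded_linear_compose[OF bounded_linear_cscale] blinfun.bounded_linear_right)

lemma LcI: "(\<And>c x. blinfun_apply X (cscale c x) = cscale c (blinfun_apply X x)) \<Longrightarrow> X \<in> Lc"
  by (auto simp: Lc_def)

lemma LcD: "X \<in> Lc \<Longrightarrow> blinfun_apply X (cscale c x) = cscale c (blinfun_apply X x)"
  by (auto simp: Lc_def)

lemma Lc_0 [simp]: "0 \<in> Lc" by (simp add: Lc_def)

lemma Lc_id [simp]: "id_blinfun \<in> Lc" by (simp add: Lc_def)

lemma Lc_add [intro]: "X \<in> Lc \<Longrightarrow> Y \<in> Lc \<Longrightarrow> X + Y \<in> Lc"
  by (simp add: Lc_def blinfun.add_left cscale_add_right)

lemma Lc_minus [intro]: "X \<in> Lc \<Longrightarrow> - X \<in> Lc"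
  by (simp add: Lc_def blinfun.minus_left cscale_minus_right)

lemma Lc_diff [intro]: "X \<in> Lc \<Longrightarrow> Y \<in> Lc \<Longrightarrow> X - Y \<in> Lc"
  by (simp add: Lc_def blinfun.diff_left cscale_diff_right)

lemma Lc_scaleR [intro]: "X \<in> Lc \<Longrightarrow> r *\<^sub>R X \<in> Lc"
  by (simp add: Lc_def blinfun.scaleR_left scaleR_cscale cscale_cscale mult.commute)

lemma Lc_opscale [intro]: "X \<in> Lc \<Longrightarrow> opscale c X \<in> Lc"
  by (simp add: Lc_def cscale_cscale mult.commute)

lemma Lc_compose [intro]: "X \<in> Lc \<Longrightarrow> Y \<in> Lc \<Longrightarrow> X o\<^sub>L Y \<in> Lc"
  by (simp add: Lc_def)

lemma opscale_0 [simp]: "opscale 0 X = 0" by (rule blinfun_eqI) simp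
lemma opscale_0_right [simp]: "opscale c 0 = 0" by (rule blinfun_eqI) simp
lemma opscale_1 [simp]: "opscale 1 X = X" by (rule blinfun_eqI) (simp add: cscale_one)
lemma opscale_opscale: "opscale a (opscale b X) = opscale (a * b) X"
  by (rule blinfun_eqI) (simp add: cscale_cscale)
lemma norm_opscale: "norm (opscale c X) = cmod c * norm X"
proof -
  have le: "norm (opscale c X) \<le> cmod c * norm X" for c and X :: "'a \<Rightarrow>\<^sub>L 'b"
    by (rule norm_blinfun_bound)
       (auto simp: norm_cscale mult.assoc intro!: mult_left_mono norm_blinfun)
  show ?thesis
  proof (cases "c = 0")
    case False
    have "norm X \<le> cmod (inverse c) * norm (opscale c X)"
      using le[of "inverse c" "opscale c X"] False by (simp add: opscale_opscale)
    then have "cmod c * norm X \<le> norm (opscale c X)"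
      using False by (simp add: norm_inverse norm_divide field_simps)
    then show ?thesis using le[of c X] by simp
  qed simp
qed

lemma bounded_linear_opscale_left: "bounded_linear (\<lambda>c. opscale c X)"
proof (rule bounded_linear_intro[of _ "norm X"])
  show "opscale (a + b) X = opscale a X + opscale b X" for a b
    by (rule blinfun_eqI) (simp add: cscale_add_left blinfun.add_left)
  show "opscale (r *\<^sub>R c) X = r *\<^sub>R opscale c X" for r c
    by (rule blinfun_eqI)
       (simp add: blinfun.scaleR_left scaleR_cscale cscale_cscale scaleR_conv_of_real)
qed (simp add: norm_opscale)

section \<open>Holomorphic maps and curves\<close>

text \<open>In contrast to \<open>holo_on\<close>, the derivative is taken relative to
  \<open>U\<close> itself. Composition then needs nothing but an inclusion of images, and the notion
  applies verbatim to the image ball of a Moebius transformation.\<close>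

definition hol :: "(('k::cinner_space \<Rightarrow>\<^sub>L 'h::cinner_space) \<Rightarrow> ('k \<Rightarrow>\<^sub>L 'h)) \<Rightarrow> ('k \<Rightarrow>\<^sub>L 'h) set \<Rightarrow> bool" where
  "hol g U \<longleftrightarrow> (\<forall>X\<in>U. \<exists>D. (g has_derivative D) (at X within U) \<and>
     (\<forall>Y\<in>Lc. D Y \<in> Lc) \<and> (\<forall>c. \<forall>Y\<in>Lc. D (opscale c Y) = opscale c (D Y)))"

text \<open>Holomorphic curves are the test objects for \<open>hol\<close>: along them every matrix
  coefficient is a scalar holomorphic function, so that one-variable theorems apply.\<close>

definition ccurve :: "(complex \<Rightarrow> ('k::cinner_space \<Rightarrow>\<^sub>L 'h::cinner_space)) \<Rightarrow> complex set \<Rightarrow> bool" where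
  "ccurve u S \<longleftrightarrow> (\<forall>z\<in>S. \<exists>V\<in>Lc. (u has_derivative (\<lambda>c. opscale c V)) (at z within S))"

lemma holo_on_imp_hol: "holo_on g U \<Longrightarrow> U \<subseteq> Lc \<Longrightarrow> hol g U"
  unfolding holo_on_def hol_def by (meson has_derivative_subset)

lemma has_derivative_compose_within:
  assumes "(f has_derivative f') (at x within s)" "(g has_derivative g') (at (f x) within t)" "f ` s \<subseteq> t"
  shows "((\<lambda>x. g (f x)) has_derivative (\<lambda>h. g' (f' h))) (at x within s)"
  using diff_chain_within[OF assms(1) has_derivative_subset[OF assms(2,3)]] by (simp add: o_def)

lemma hol_compose:
  assumes f: "hol f U" and g: "hol g W" and sub: "f ` U \<subseteq> W"
  shows "hol (\<lambda>X. g (f X)) U"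
  unfolding hol_def
proof
  fix X assume X: "X \<in> U"
  obtain D where D: "(f has_derivative D) (at X within U)" "\<forall>Y\<in>Lc. D Y \<in> Lc"
      "\<forall>c. \<forall>Y\<in>Lc. D (opscale c Y) = opscale c (D Y)"
    using f X unfolding hol_def by blast
  obtain D' where D': "(g has_derivative D') (at (f X) within W)" "\<forall>Y\<in>Lc. D' Y \<in> Lc"
      "\<forall>c. \<forall>Y\<in>Lc. D' (opscale c Y) = opscale c (D' Y)"
    using g X sub unfolding hol_def by blast
  show "\<exists>D. ((\<lambda>X. g (f X)) has_derivative D) (at X within U) \<and> (\<forall>Y\<in>Lc. D Y \<in> Lc) \<and>
      (\<forall>c. \<forall>Y\<in>Lc. D (opscale c Y) = opscale c (D Y))"
    using has_derivative_compose_within[OF D(1) D'(1) sub] D(2,3) D'(2,3)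
    by (intro exI[of _ "\<lambda>h. D' (D h)"]) auto
qed

lemma hol_ccurve:
  assumes u: "ccurve u S" and g: "hol g W" and sub: "u ` S \<subseteq> W"
  shows "ccurve (\<lambda>z. g (u z)) S"
  unfolding ccurve_def
proof
  fix z assume z: "z \<in> S"
  obtain V where V: "V \<in> Lc" "(u has_derivative (\<lambda>c. opscale c V)) (at z within S)"
    using u z unfolding ccurve_def by blast
  obtain D' where D': "(g has_derivative D') (at (u z) within W)" "\<forall>Y\<in>Lc. D' Y \<in> Lc"
      "\<forall>c. \<forall>Y\<in>Lc. D' (opscale c Y) = opscale c (D' Y)"
    using g z sub unfolding hol_def by blast
  have "((\<lambda>z. g (u z)) has_derivative (\<lambda>c. D' (opscale c V))) (at z within S)"
    by (rule has_derivative_compose_within[OF V(2) D'(1) sub])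
  then show "\<exists>V\<in>Lc. ((\<lambda>z. g (u z)) has_derivative (\<lambda>c. opscale c V)) (at z within S)"
    using D' V(1) by (intro bexI[of _ "D' V"]) auto
qed

lemma ccurve_affine:
  assumes "Z \<in> Lc" shows "ccurve (\<lambda>z. X + opscale z Z) S"
  unfolding ccurve_def
  by (intro ballI bexI[of _ Z])
     (auto intro!: derivative_eq_intros bounded_linear_imp_has_derivative bounded_linear_opscale_left assms)

lemma ccurve_linear:
  assumes "Z \<in> Lc" shows "ccurve (\<lambda>z. opscale z Z) S"
  using ccurve_affine[OF assms, of 0 S] by simp

section \<open>Matrix coefficients along curves and the scalar Schwarz lemma\<close>

lemma has_field_derivative_cinner_curve:
  assumes "(u has_derivative (\<lambda>c. opscale c V)) (at z within S)"
  shows "((\<lambda>z. cinner (blinfun_apply (u z) a) b) has_field_derivative cinner (blinfun_apply V a) b) (at z within S)"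
proof -
  have 1: "((\<lambda>z. blinfun_apply (u z) a) has_derivative (\<lambda>c. blinfun_apply (opscale c V) a)) (at z within S)"
    using bounded_linear.has_derivative[OF blinfun.bounded_linear_left assms] .
  have "((\<lambda>z. cinner (blinfun_apply (u z) a) b) has_derivative (\<lambda>c. cinner (blinfun_apply (opscale c V) a) b)) (at z within S)"
    using bounded_linear.has_derivative[OF bounded_linear_cinner_left 1] .
  then show ?thesis
    by (simp add: has_field_derivative_def cinner_cscale_left mult.commute[of _ "cinner (blinfun_apply V a) b"])
qed

lemma holomorphic_cinner_curve:
  assumes "ccurve u S" "open S"
  shows "(\<lambda>z. cinner (blinfun_apply (u z) a) b) holomorphic_on S"
  unfolding holomorphic_on_def field_differentiable_def
  using assms(1) has_field_derivative_cinner_curve unfolding ccurve_def by blast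

text \<open>The normalised Schwarz lemma requires values strictly inside the unit disc, while the
  bound here is weak and \<open>M\<close> may be 0. Hence the claim is first proved for every
  \<open>M' > M\<close> and then \<open>M'\<close> tends to \<open>M\<close>.\<close>

lemma Schwarz_scaled:
  fixes f :: "complex \<Rightarrow> complex"
  assumes hol: "f holomorphic_on ball 0 R" and f0: "f 0 = 0"
    and bound: "\<And>z. cmod z < R \<Longrightarrow> cmod (f z) \<le> M" and R: "0 < R"
  shows "cmod z < R \<Longrightarrow> cmod (f z) \<le> M * (cmod z / R)" and "cmod (deriv f 0) \<le> M / R"
proof -
  have M0: "0 \<le> M" using bound[of 0] R f0 by simp
  have key: "(cmod z < R \<longrightarrow> cmod (f z) \<le> M' * (cmod z / R)) \<and> cmod (deriv f 0) \<le> M' / R"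
    if M': "M < M'" for M' z
  proof -
    have Mp: "M' > 0" using M0 M' by simp
    define F where "F w = f (of_real R * w) / of_real M'" for w
    have sub: "(\<lambda>w. of_real R * w) ` ball 0 1 \<subseteq> ball (0::complex) R"
      using R by (auto simp: norm_mult)
    have "(f \<circ> (\<lambda>w. of_real R * w)) holomorphic_on ball 0 1"
      by (intro holomorphic_on_compose_gen[OF _ hol] sub holomorphic_intros)
    then have FH: "F holomorphic_on ball 0 1"
      unfolding F_def o_def using Mp by (intro holomorphic_intros) auto
    have F1: "cmod (F w) < 1" if "cmod w < 1" for w
    proof -
      have "cmod (f (of_real R * w)) \<le> M"
        using that R by (intro bound) (simp add: norm_mult)
      then show ?thesis using M' Mp by (simp add: F_def norm_divide)
    qed
    have F0: "F 0 = 0" by (simp add: F_def f0)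
    have 1: "cmod (F w) \<le> cmod w" if "cmod w < 1" for w
      using Schwarz_Lemma(1)[OF FH F0 F1 that] .
    have 2: "cmod (deriv F 0) \<le> 1"
      using Schwarz_Lemma(2)[OF FH F0 F1, of 0] by simp
    have "(f has_field_derivative deriv f 0) (at (of_real R * 0))"
      using hol R by (simp add: holomorphic_derivI)
    then have "(F has_field_derivative deriv f 0 * of_real R / of_real M') (at 0)"
      unfolding F_def using Mp by (auto intro!: derivative_eq_intros DERIV_chain2[of f])
    then have "deriv F 0 = deriv f 0 * of_real R / of_real M'"
      by (rule DERIV_imp_deriv)
    then have b: "cmod (deriv f 0) \<le> M' / R"
      using 2 R Mp by (simp add: norm_mult norm_divide pos_le_divide_eq pos_divide_le_eq)
    have "cmod (f z) \<le> M' * (cmod z / R)" if "cmod z < R"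
    proof -
      have "cmod (F (z / of_real R)) \<le> cmod z / R"
        using 1[of "z / of_real R"] that R by (simp add: norm_divide)
      moreover have "F (z / of_real R) = f z / of_real M'"
        using R by (simp add: F_def)
      ultimately show ?thesis using Mp by (simp add: norm_divide field_simps)
    qed
    then show ?thesis using b by blast
  qed
  show "cmod (f z) \<le> M * (cmod z / R)" if z: "cmod z < R" for z
  proof (rule field_le_epsilon)
    fix e :: real assume e: "0 < e"
    have "cmod (f z) \<le> (M + e) * (cmod z / R)"
      using key[of "M + e" z] e z by simp
    also have "\<dots> \<le> M * (cmod z / R) + e"
      using z R e by (simp add: distrib_right mult_le_cancel_left1 field_simps)
    finally show "cmod (f z) \<le> M * (cmod z / R) + e" .
  qed
  show "cmod (deriv f 0) \<le> M / R"
  proof (rule field_le_epsilon)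
    fix e :: real assume e: "0 < e"
    show "cmod (deriv f 0) \<le> M / R + e"
      using key[of "M + e * R"] e R by (simp add: field_simps)
  qed
qed

section \<open>Finite-dimensional spaces\<close>

text \<open>The reproducing formula of an orthonormal basis; coordinates, adjoints and norm bounds
  are all read off from it.\<close>

definition frame :: "'k::cinner_space set \<Rightarrow> bool" where
  "frame E \<longleftrightarrow> finite E \<and> (\<forall>x. x = (\<Sum>e\<in>E. cscale (cinner x e) e))"

text \<open>A vector whose residual \<open>p\<close> vanishes adds nothing to \<open>E\<close>, so
  the spanning set need not be independent to start with.\<close>

lemma Gram_Schmidt:
  fixes S :: "'k::cinner_space set"
  assumes "finite S"
  shows "\<exists>E. finite E \<and> (\<forall>e\<in>E. \<forall>f\<in>E. cinner e f = (if e = f then 1 else 0)) \<and>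
    (\<forall>s\<in>S. s = (\<Sum>e\<in>E. cscale (cinner s e) e))"
  using assms
proof induction
  case empty
  show ?case by (intro exI[of _ "{}"]) auto
next
  case (insert s S)
  then obtain E where E: "finite E" "\<And>e f. e \<in> E \<Longrightarrow> f \<in> E \<Longrightarrow> cinner e f = (if e = f then 1 else 0)"
    "\<And>s. s \<in> S \<Longrightarrow> s = (\<Sum>e\<in>E. cscale (cinner s e) e)" by blast
  define p where "p = s - (\<Sum>e\<in>E. cscale (cinner s e) e)"
  have pe: "cinner p f = 0" if "f \<in> E" for f
  proof -
    have "(\<Sum>e\<in>E. cinner s e * cinner e f) = (\<Sum>e\<in>E. if e = f then cinner s e else 0)"
      using E(2) that by (intro sum.cong) auto
    then show ?thesis
      using that E(1) by (simp add: p_def cinner_diff_left cinner_sum_left cinner_cscale_left)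
  qed
  show ?case
  proof (cases "p = 0")
    case True
    then show ?thesis using E by (intro exI[of _ E]) (auto simp: p_def)
  next
    case False
    define e0 where "e0 = cscale (1 / of_real (norm p)) p"
    have e0e: "cinner e0 f = 0" "cinner f e0 = 0" if "f \<in> E" for f
      using pe[OF that] cinner_cnj[of f p]
      by (auto simp: e0_def cinner_cscale_left cinner_cscale_right)
    have e00: "cinner e0 e0 = 1"
      using False by (simp add: e0_def cinner_self norm_cscale norm_divide)
    have e0E: "e0 \<notin> E" using e0e e00 by force
    have pe0: "p = cscale (cinner s e0) e0"
    proof -
      have "cinner s e0 = cinner p e0"
        using e0e(1) by (simp add: p_def cinner_diff_left cinner_sum_left cinner_cscale_left e0e(2))
      also have "\<dots> = norm p"
        using False by (simp add: e0_def cinner_cscale_right cinner_self power2_eq_square)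
      finally show ?thesis using False by (simp add: e0_def cscale_cscale cscale_one)
    qed
    have "t = (\<Sum>e\<in>insert e0 E. cscale (cinner t e) e)" if "t \<in> insert s S" for t
    proof (cases "t = s")
      case True
      have "s = p + (\<Sum>e\<in>E. cscale (cinner s e) e)" by (simp add: p_def)
      also have "\<dots> = (\<Sum>e\<in>insert e0 E. cscale (cinner s e) e)"
        using pe0 E(1) e0E by simp
      finally show ?thesis using True by simp
    next
      case False
      then have t: "t = (\<Sum>e\<in>E. cscale (cinner t e) e)" using that E(3) by blast
      have "cinner t e0 = 0"
        by (subst t) (simp add: cinner_sum_left cinner_cscale_left e0e(2))
      then show ?thesis using t E(1) e0E by simp
    qed
    then show ?thesis
      using E(1,2) e0e e00 e0E by (intro exI[of _ "insert e0 E"]) auto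
  qed
qed

lemma frame_exists:
  assumes "cfinite_dim TYPE('k::cinner_space)"
  shows "\<exists>E::'k set. frame E"
proof -
  obtain S :: "'k set" where S: "finite S" "\<And>x. \<exists>c. x = (\<Sum>s\<in>S. cscale (c s) s)"
    using assms unfolding cfinite_dim_def by blast
  obtain E where E: "finite E" "\<And>s. s \<in> S \<Longrightarrow> s = (\<Sum>e\<in>E. cscale (cinner s e) e)"
    using Gram_Schmidt[OF S(1)] by blast
  have "x = (\<Sum>e\<in>E. cscale (cinner x e) e)" for x
  proof -
    obtain c where c: "x = (\<Sum>s\<in>S. cscale (c s) s)" using S(2) by blast
    have "(\<Sum>e\<in>E. cscale (cinner x e) e) = (\<Sum>e\<in>E. \<Sum>s\<in>S. cscale (c s) (cscale (cinner s e) e))"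
    proof (intro sum.cong refl)
      fix e assume "e \<in> E"
      have "cscale (\<Sum>s\<in>A. c s * cinner s e) e = (\<Sum>s\<in>A. cscale (c s * cinner s e) e)" for A
        by (induction A rule: infinite_finite_induct) (auto simp: cscale_add_left)
      then show "cscale (cinner x e) e = (\<Sum>s\<in>S. cscale (c s) (cscale (cinner s e) e))"
        by (simp add: c cinner_sum_left cinner_cscale_left cscale_cscale)
    qed
    also have "\<dots> = (\<Sum>s\<in>S. cscale (c s) (\<Sum>e\<in>E. cscale (cinner s e) e))"
      by (subst sum.swap) (simp add: cscale_sum)
    also have "\<dots> = x" using E(2) c by simp
    finally show ?thesis by simp
  qed
  then show ?thesis using E(1) unfolding frame_def by blast
qed

text \<open>Dimension count: the injective image of a basis \<open>B\<close> is independent with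
  \<open>card B\<close> elements, and a vector outside its span would give an independent set with
  one element more than \<open>B\<close>.\<close>

lemma linear_inj_imp_surj_finite_span:
  fixes f :: "'a::real_vector \<Rightarrow> 'a"
  assumes f: "linear f" and inj: "inj f" and T: "finite T" "span T = (UNIV :: 'a set)"
  shows "surj f"
proof -
  obtain B where B: "B \<subseteq> T" "independent B" "T \<subseteq> span B"
    using maximal_independent_subset[of T] by blast
  have finB: "finite B" using B(1) T(1) finite_subset by blast
  have spanB: "span B = UNIV"
    using T(2) B(3) span_mono[of T "span B"] by (simp add: span_span top.extremum_unique)
  have ind: "independent (f ` B)"
    by (rule linear_independent_injective_image[OF f B(2) inj_on_subset[OF inj]]) simp
  have card: "card (f ` B) = card B"
    by (intro card_image inj_on_subset[OF inj]) simp
  have "v \<in> span (f ` B)" for v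
  proof (rule ccontr)
    assume v: "v \<notin> span (f ` B)"
    then have "independent (insert v (f ` B))" using ind by (rule independent_insertI)
    then have "card (insert v (f ` B)) \<le> card B"
      using independent_span_bound[OF finB] spanB by blast
    moreover have "v \<notin> f ` B" using v span_base[of v "f ` B"] by (rule contrapos_nn)
    ultimately show False using finB card by simp
  qed
  then have "span (f ` B) = UNIV" by blast
  then show ?thesis using linear_span_image[OF f, of B] spanB by simp
qed

locale fin_dim =
  fixes E :: "'k::cinner_space set"
  assumes frame: "frame E"
begin

lemma finE: "finite E" and expand: "x = (\<Sum>e\<in>E. cscale (cinner x e) e)"
  using frame unfolding frame_def by auto

section \<open>Linear maps, adjoints and inverses on a finite-dimensional domain\<close>

lemma clinear_expand:
  fixes f :: "'k \<Rightarrow> 'v::cinner_space"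
  assumes "\<And>x y. f (x + y) = f x + f y" "\<And>c x. f (cscale c x) = cscale c (f x)"
  shows "f x = (\<Sum>e\<in>E. cscale (cinner x e) (f e))"
proof -
  have f0: "f 0 = 0" using assms(1)[of 0 0] by simp
  have "f (\<Sum>e\<in>A. cscale (cinner x e) e) = (\<Sum>e\<in>A. cscale (cinner x e) (f e))" for A
    by (induction A rule: infinite_finite_induct) (auto simp: f0 assms)
  from this[of E] show ?thesis using expand[of x] by simp
qed

lemma clinear_bounded:
  fixes f :: "'k \<Rightarrow> 'v::cinner_space"
  assumes "\<And>x y. f (x + y) = f x + f y" "\<And>c x. f (cscale c x) = cscale c (f x)"
  shows "bounded_linear f"
proof -
  have "f = (\<lambda>x. \<Sum>e\<in>E. cscale (cinner x e) (f e))"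
    using clinear_expand[OF assms] by blast
  moreover have "bounded_linear (\<lambda>x. \<Sum>e\<in>E. cscale (cinner x e) (f e))"
    by (intro bounded_linear_sum bounded_linear_compose[OF bounded_linear_cscale_left]
        bounded_linear_cinner_left)
  ultimately show ?thesis by simp
qed

lemma clinear_blinfun:
  fixes f :: "'k \<Rightarrow> 'v::cinner_space"
  assumes "\<And>x y. f (x + y) = f x + f y" "\<And>c x. f (cscale c x) = cscale c (f x)"
  obtains F where "F \<in> Lc" "\<And>x. blinfun_apply F x = f x"
proof
  show "\<And>x. blinfun_apply (Blinfun f) x = f x"
    by (simp add: bounded_linear_Blinfun_apply clinear_bounded[OF assms])
  then show "Blinfun f \<in> Lc" by (intro LcI) (simp add: assms)
qed

text \<open>The frame formula replaces the Riesz representation theorem, so the adjoint exists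
  without completeness of the target. It has the adjoint property for complex linear
  \<open>Y\<close>, see \<open>adj_left\<close>.\<close>

definition adj :: "('k \<Rightarrow>\<^sub>L 'h::cinner_space) \<Rightarrow> ('h \<Rightarrow>\<^sub>L 'k)" where
  "adj Y = Blinfun (\<lambda>h. \<Sum>e\<in>E. cscale (cinner h (blinfun_apply Y e)) e)"

lemma adj_apply: "blinfun_apply (adj Y) h = (\<Sum>e\<in>E. cscale (cinner h (blinfun_apply Y e)) e)"
  unfolding adj_def
  by (subst bounded_linear_Blinfun_apply)
     (intro bounded_linear_sum bounded_linear_compose[OF bounded_linear_cscale_left]
        bounded_linear_cinner_left refl)+

lemma adj_left:
  assumes "Y \<in> Lc"
  shows "cinner (blinfun_apply (adj Y) h) k = cinner h (blinfun_apply Y k)"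
proof -
  have "cinner h (blinfun_apply Y k) = cinner h (\<Sum>e\<in>E. cscale (cinner k e) (blinfun_apply Y e))"
    using clinear_expand[of "blinfun_apply Y" k] assms by (simp add: blinfun.add_right LcD)
  also have "\<dots> = (\<Sum>e\<in>E. cinner h (blinfun_apply Y e) * cinner e k)"
    by (simp add: cinner_sum_right cinner_cscale_right cinner_cnj[of k, symmetric] mult.commute)
       (metis cinner_cnj)
  finally show ?thesis by (simp add: adj_apply cinner_sum_left cinner_cscale_left)
qed

lemma adj_right:
  assumes "Y \<in> Lc"
  shows "cinner k (blinfun_apply (adj Y) h) = cinner (blinfun_apply Y k) h"
  by (metis adj_left[OF assms] cinner_cnj)

lemma adj_Lc [intro, simp]: "Y \<in> Lc \<Longrightarrow> adj Y \<in> Lc"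
  by (intro LcI cinner_ext) (simp add: adj_left cinner_cscale_left)

lemma norm_adj_apply:
  assumes "Y \<in> Lc"
  shows "norm (blinfun_apply (adj Y) h) \<le> norm Y * norm h"
proof -
  let ?a = "blinfun_apply (adj Y) h"
  have "norm ?a * norm ?a = Re (cinner h (blinfun_apply Y ?a))"
    using adj_left[OF assms, of h ?a] by (simp add: cinner_self power2_eq_square)
      (metis Re_complex_of_real of_real_mult)
  also have "\<dots> \<le> norm h * norm (blinfun_apply Y ?a)"
    using cinner_Cauchy_Schwarz complex_Re_le_cmod order_trans by blast
  also have "\<dots> \<le> norm h * (norm Y * norm ?a)"
    by (intro mult_left_mono norm_blinfun) simp
  finally have "norm ?a * norm ?a \<le> (norm Y * norm h) * norm ?a" by (simp add: mult_ac)
  then show ?thesis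
    by (cases "norm ?a = 0") (auto simp: mult_le_cancel_right)
qed

text \<open>A choice that is meaningful only when a two-sided inverse in \<open>Lc\<close> exists.
  By finiteness of the dimension, injectivity of a complex linear \<open>A\<close> is
  enough.\<close>

definition binv :: "('k \<Rightarrow>\<^sub>L 'k) \<Rightarrow> ('k \<Rightarrow>\<^sub>L 'k)" where
  "binv A = (SOME V. V \<in> Lc \<and> A o\<^sub>L V = id_blinfun \<and> V o\<^sub>L A = id_blinfun)"

lemma finite_real_span: "\<exists>T. finite T \<and> span T = (UNIV :: 'k set)"
proof (intro exI conjI)
  let ?T = "E \<union> cscale \<i> ` E"
  show "finite ?T" using finE by simp
  have "x \<in> span ?T" for x
  proof -
    have "cscale (cinner x e) e \<in> span ?T" if "e \<in> E" for e
    proof -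
      have "cscale c e = Re c *\<^sub>R e + Im c *\<^sub>R cscale \<i> e" for c
        by (subst complex_eq[of c])
           (simp add: cscale_add_left scaleR_cscale cscale_cscale mult.commute)
      moreover have "e \<in> span ?T" "cscale \<i> e \<in> span ?T"
        using that by (auto intro: span_base)
      ultimately show ?thesis by (metis span_add span_mul)
    qed
    then have "(\<Sum>e\<in>E. cscale (cinner x e) e) \<in> span ?T" by (intro span_sum)
    then show ?thesis using expand[of x] by simp
  qed
  then show "span ?T = UNIV" by blast
qed

lemma
  assumes A: "A \<in> Lc" and inj: "\<And>x. blinfun_apply A x = 0 \<Longrightarrow> x = 0"
  shows binv_Lc: "binv A \<in> Lc"
    and binv_right: "blinfun_apply A (blinfun_apply (binv A) x) = x"
    and binv_left: "blinfun_apply (binv A) (blinfun_apply A x) = x"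
    and binv_comp_right: "A o\<^sub>L binv A = id_blinfun"
    and binv_comp_left: "binv A o\<^sub>L A = id_blinfun"
proof -
  have lin: "linear (blinfun_apply A)" by (simp add: blinfun.bounded_linear_right bounded_linear.linear)
  have i: "inj (blinfun_apply A)"
    using linear_injective_0[OF lin] inj by blast
  obtain T :: "'k set" where "finite T" "span T = UNIV" using finite_real_span by blast
  then have s: "surj (blinfun_apply A)"
    using linear_inj_imp_surj_finite_span[OF lin i] by blast
  define f where "f = inv (blinfun_apply A)"
  have Af: "blinfun_apply A (f x) = x" for x using s by (simp add: f_def surj_f_inv_f)
  have fA: "f (blinfun_apply A x) = x" for x using i by (simp add: f_def)
  obtain V where V: "V \<in> Lc" "\<And>x. blinfun_apply V x = f x"
  proof (rule clinear_blinfun[of f])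
    show "f (x + y) = f x + f y" for x y
      by (metis Af fA blinfun.add_right)
    show "f (cscale c x) = cscale c (f x)" for c x
      by (metis Af fA LcD[OF A])
  qed blast
  have "V \<in> Lc \<and> A o\<^sub>L V = id_blinfun \<and> V o\<^sub>L A = id_blinfun"
    using V Af fA by (auto intro!: blinfun_eqI)
  then have *: "binv A \<in> Lc \<and> A o\<^sub>L binv A = id_blinfun \<and> binv A o\<^sub>L A = id_blinfun"
    unfolding binv_def by (rule someI)
  then show "binv A \<in> Lc" "A o\<^sub>L binv A = id_blinfun" "binv A o\<^sub>L A = id_blinfun" by auto
  show "blinfun_apply A (blinfun_apply (binv A) x) = x"
    "blinfun_apply (binv A) (blinfun_apply A x) = x"
    using * by (metis blinfun_apply_blinfun_compose blinfun_apply_id_blinfun)+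
qed

text \<open>Induction on \<open>A\<close>: adding one vector forms the Minkowski sum with the
  compact image of a closed disc.\<close>

lemma compact_coefficients:
  assumes "finite A"
  shows "compact {\<Sum>e\<in>A. cscale (c e) e | c. \<forall>e\<in>A. cmod (c e) \<le> M e}"
  using assms
proof induction
  case empty
  then show ?case by simp
next
  case (insert a A)
  let ?S = "\<lambda>A. {\<Sum>e\<in>A. cscale (c e) e | c. \<forall>e\<in>A. cmod (c e) \<le> M e}"
  have "compact ((\<lambda>c. cscale c a) ` cball 0 (M a))"
    by (intro compact_continuous_image linear_continuous_on bounded_linear_cscale_left) simp
  then have c: "compact {x + y | x y. x \<in> (\<lambda>c. cscale c a) ` cball 0 (M a) \<and> y \<in> ?S A}"
    using insert.IH compact_sums by blast
  have "{x + y | x y. x \<in> (\<lambda>c. cscale c a) ` cball 0 (M a) \<and> y \<in> ?S A} = ?S (insert a A)" (is "?L = ?R")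
  proof (intro equalityI subsetI)
    fix z assume "z \<in> ?L"
    then obtain c0 c where c: "z = cscale c0 a + (\<Sum>e\<in>A. cscale (c e) e)" "cmod c0 \<le> M a"
      "\<forall>e\<in>A. cmod (c e) \<le> M e" by auto
    have "(\<Sum>e\<in>A. cscale ((c(a := c0)) e) e) = (\<Sum>e\<in>A. cscale (c e) e)"
      using insert.hyps by (intro sum.cong) auto
    then have "z = (\<Sum>e\<in>insert a A. cscale ((c(a := c0)) e) e)"
      using c insert.hyps by simp
    moreover have "\<forall>e\<in>insert a A. cmod ((c(a := c0)) e) \<le> M e" using c by auto
    ultimately show "z \<in> ?R" by blast
  next
    fix z assume "z \<in> ?R"
    then obtain c where c: "z = (\<Sum>e\<in>insert a A. cscale (c e) e)"
      "\<forall>e\<in>insert a A. cmod (c e) \<le> M e" by auto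
    then have "z = cscale (c a) a + (\<Sum>e\<in>A. cscale (c e) e)" using insert.hyps by simp
    moreover have "cscale (c a) a \<in> (\<lambda>c. cscale c a) ` cball 0 (M a)" using c by auto
    moreover have "(\<Sum>e\<in>A. cscale (c e) e) \<in> ?S A" using c by auto
    ultimately show "z \<in> ?L" by blast
  qed
  with c show ?case by simp
qed

text \<open>Compactness of the unit ball in pigeonhole form. \<open>N\<close> depends on
  \<open>s\<close> alone; this is what later makes the factor of non-diametrality independent of the
  convex set.\<close>

lemma packing:
  assumes s: "0 < s"
  shows "\<exists>N::nat. \<forall>k::nat \<Rightarrow> 'k. (\<forall>i. norm (k i) \<le> 1) \<longrightarrow> (\<exists>m n. m < n \<and> n \<le> N \<and> norm (k m - k n) < s)"
proof -
  define C where "C = {\<Sum>e\<in>E. cscale (c e) e | c. \<forall>e\<in>E. cmod (c e) \<le> norm e}"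
  have C: "compact C" unfolding C_def by (rule compact_coefficients[OF finE])
  have ballC: "x \<in> C" if "norm x \<le> 1" for x
  proof -
    have "cmod (cinner x e) \<le> norm e" for e
      using cinner_Cauchy_Schwarz[of x e] mult_right_mono[OF that, of "norm e"] by simp
    then show ?thesis unfolding C_def using expand[of x] by blast
  qed
  obtain T where T: "finite T" "C \<subseteq> (\<Union>t\<in>T. ball t (s / 2))"
    using C s unfolding compact_eq_totally_bounded by (meson half_gt_zero)
  have "\<exists>m n. m < n \<and> n \<le> card T \<and> norm (k m - k n) < s" if k: "\<forall>i. norm (k i) \<le> 1" for k :: "nat \<Rightarrow> 'k"
  proof -
    have "\<exists>t\<in>T. dist t (k i) < s / 2" for i
      using subsetD[OF T(2) ballC[of "k i"]] k by auto
    then obtain t where t: "\<And>i. t i \<in> T" "\<And>i. dist (t i) (k i) < s / 2" by metis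
    \<comment> \<open>There are \<open>card T + 1\<close> indices but only \<open>card T\<close>
      centres.\<close>
    have "\<not> inj_on t {..card T}"
    proof
      assume "inj_on t {..card T}"
      then have "card {..card T} \<le> card T"
        using t(1) T(1) by (intro card_inj_on_le) auto
      then show False by simp
    qed
    then obtain i j where ij: "i \<le> card T" "j \<le> card T" "i \<noteq> j" "t i = t j"
      unfolding inj_on_def by auto
    have "dist (k i) (k j) < s"
      using t(2)[of i] t(2)[of j] ij(4) by (metis dist_commute dist_triangle_half_l)
    then have "norm (k i - k j) < s" "norm (k j - k i) < s" by (simp_all add: dist_norm norm_minus_commute)
    then show ?thesis using ij by (cases "i < j") (auto simp: not_less order.order_iff_strict)
  qed
  then show ?thesis by blast
qed

text \<open>Reduces convergence in operator norm to convergence on the finitely many vectors of the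
  frame.\<close>

lemma norm_le_sum_frame:
  assumes "X \<in> Lc"
  shows "norm X \<le> (\<Sum>e\<in>E. norm e * norm (blinfun_apply X e))"
proof (rule norm_blinfun_bound)
  fix x
  have "blinfun_apply X x = (\<Sum>e\<in>E. cscale (cinner x e) (blinfun_apply X e))"
    using clinear_expand[of "blinfun_apply X" x] assms by (simp add: blinfun.add_right LcD)
  then have "norm (blinfun_apply X x) \<le> (\<Sum>e\<in>E. cmod (cinner x e) * norm (blinfun_apply X e))"
    by (simp add: sum_norm_le norm_cscale)
  also have "\<dots> \<le> (\<Sum>e\<in>E. norm x * norm e * norm (blinfun_apply X e))"
    by (intro sum_mono mult_right_mono cinner_Cauchy_Schwarz) simp
  finally show "norm (blinfun_apply X x) \<le> (\<Sum>e\<in>E. norm e * norm (blinfun_apply X e)) * norm x"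
    by (simp add: sum_distrib_right sum_distrib_left mult_ac)
qed (auto intro: sum_nonneg)

lemma Lc_complete:
  fixes X :: "nat \<Rightarrow> 'k \<Rightarrow>\<^sub>L 'h::{cinner_space,complete_space}"
  assumes X: "\<And>n. X n \<in> Lc" and C: "Cauchy X"
  shows "\<exists>L\<in>Lc. X \<longlonglongrightarrow> L"
proof -
  have "Cauchy (\<lambda>n. blinfun_apply (X n) x)" for x
    using bounded_linear.Cauchy[OF blinfun.bounded_linear_left C] .
  then have "\<exists>l. (\<lambda>n. blinfun_apply (X n) x) \<longlonglongrightarrow> l" for x
    using Cauchy_convergent convergent_def by blast
  then obtain f where f: "\<And>x. (\<lambda>n. blinfun_apply (X n) x) \<longlonglongrightarrow> f x" by metis
  obtain L where L: "L \<in> Lc" "\<And>x. blinfun_apply L x = f x"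
  proof (rule clinear_blinfun[of f])
    show "f (x + y) = f x + f y" for x y
      using tendsto_add[OF f[of x] f[of y]] f[of "x + y"]
      by (simp add: blinfun.add_right LIMSEQ_unique)
    show "f (cscale c x) = cscale c (f x)" for c x
      using bounded_linear.tendsto[OF bounded_linear_cscale f[of x], of c] f[of "cscale c x"]
      by (simp add: LcD[OF X] LIMSEQ_unique)
  qed blast
  have "(\<lambda>n. \<Sum>e\<in>E. norm e * norm (blinfun_apply (X n) e - f e)) \<longlonglongrightarrow> (\<Sum>e\<in>E. norm e * norm (f e - f e))"
    by (intro tendsto_intros f)
  then have "(\<lambda>n. \<Sum>e\<in>E. norm e * norm (blinfun_apply (X n) e - f e)) \<longlonglongrightarrow> 0" by simp
  moreover have "norm (X n - L) \<le> (\<Sum>e\<in>E. norm e * norm (blinfun_apply (X n) e - f e))" for n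
    using norm_le_sum_frame[OF Lc_diff[OF X L(1)]] by (simp add: blinfun.diff_left L(2))
  ultimately have "(\<lambda>n. X n - L) \<longlonglongrightarrow> 0"
    by (rule Lim_null_comparison[OF always_eventually[OF allI], rotated])
  then show ?thesis using L(1) LIM_zero_iff by blast
qed

end

section \<open>Differentiating operator inverses\<close>

text \<open>Invertibility is given on all of \<open>S\<close>, so no Neumann series is involved.
  Everything rests on the identity V y - V x = V y (A x - A y) V x, which yields first local
  boundedness of \<open>V\<close>, then continuity, then the derivative.\<close>

lemma has_derivative_operator_inverse:
  fixes A :: "'a::real_normed_vector \<Rightarrow> ('k::real_normed_vector \<Rightarrow>\<^sub>L 'k)"
  assumes A: "(A has_derivative A') (at x within S)" and x: "x \<in> S"
    and VA: "\<And>y. y \<in> S \<Longrightarrow> V y o\<^sub>L A y = id_blinfun"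
    and AV: "\<And>y. y \<in> S \<Longrightarrow> A y o\<^sub>L V y = id_blinfun"
  shows "(V has_derivative (\<lambda>h. - (V x o\<^sub>L A' h o\<^sub>L V x))) (at x within S)"
proof -
  have bl: "bounded_linear A'" using A by (rule has_derivative_bounded_linear)
  obtain K where K: "\<And>h. norm (A' h) \<le> norm h * K" using bounded_linear.bounded[OF bl] by blast
  have VAa: "blinfun_apply (V y) (blinfun_apply (A y) u) = u" if "y \<in> S" for y u
    using VA[OF that] by (metis blinfun_apply_blinfun_compose blinfun_apply_id_blinfun)
  have AVa: "blinfun_apply (A y) (blinfun_apply (V y) u) = u" if "y \<in> S" for y u
    using AV[OF that] by (metis blinfun_apply_blinfun_compose blinfun_apply_id_blinfun)
  have diff: "V y - V x = V y o\<^sub>L (A x - A y) o\<^sub>L V x" if "y \<in> S" for y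
    by (rule blinfun_eqI) (simp add: blinfun.diff_left blinfun.diff_right VAa that AVa x)
  have comp: "norm (P o\<^sub>L Q o\<^sub>L R) \<le> norm P * norm Q * norm R" for P Q R :: "'k \<Rightarrow>\<^sub>L 'k"
    by (meson norm_blinfun_compose order_trans mult_right_mono norm_ge_zero)
  have nd: "norm (V y - V x) \<le> norm (V y) * norm (A y - A x) * norm (V x)" if "y \<in> S" for y
    using comp[of "V y" "A x - A y" "V x"] diff[OF that] by (simp add: norm_minus_commute)
  have cont: "((\<lambda>y. A y - A x) \<longlongrightarrow> 0) (at x within S)"
    using has_derivative_continuous[OF A] by (simp add: continuous_within LIM_zero)
  \<comment> \<open>Once norm (A y - A x) times norm (V x) is below 1/2, the identity
    \<open>diff\<close> absorbs half of norm (V y), leaving norm (V y) <= 2 norm (V x).\<close>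
  have ev: "\<forall>\<^sub>F y in at x within S. norm (V y - V x) \<le> 2 * norm (V x) * norm (A y - A x) * norm (V x)"
  proof -
    have "((\<lambda>y. norm (A y - A x) * norm (V x)) \<longlongrightarrow> 0) (at x within S)"
      using cont by (intro tendsto_mult_left_zero tendsto_norm_zero)
    then have "\<forall>\<^sub>F y in at x within S. norm (A y - A x) * norm (V x) < 1/2"
      by (rule order_tendstoD) simp
    moreover have "\<forall>\<^sub>F y in at x within S. y \<in> S" by (simp add: eventually_at_filter)
    ultimately show ?thesis
    proof eventually_elim
      case (elim y)
      have "norm (V y) \<le> norm (V x) + norm (V y - V x)"
        by (metis add.commute diff_add_cancel norm_triangle_ineq)
      also have "norm (V y - V x) \<le> norm (V y) * (norm (A y - A x) * norm (V x))"
        using nd[OF elim(2)] by (simp add: mult.assoc)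
      also have "\<dots> \<le> norm (V y) * (1/2)"
        using elim(1) by (intro mult_left_mono) auto
      finally have "norm (V y) \<le> 2 * norm (V x)" by simp
      then show ?case
        using nd[OF elim(2)] by (meson order_trans mult_right_mono norm_ge_zero)
    qed
  qed
  have Vlim: "((\<lambda>y. V y - V x) \<longlongrightarrow> 0) (at x within S)"
    by (rule Lim_null_comparison[OF ev])
       (intro tendsto_mult_left_zero tendsto_mult_right_zero tendsto_norm_zero cont)
  define r where "r y = norm (A y - A x - A' (y - x)) / norm (y - x)" for y
  have r: "(r \<longlongrightarrow> 0) (at x within S)"
    using A unfolding has_derivative_iff_norm r_def by simp
  show ?thesis
  proof (rule has_derivativeI_sandwich[of 1])
    show "bounded_linear (\<lambda>h. - (V x o\<^sub>L A' h o\<^sub>L V x))"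
      using bl by (intro bounded_linear_minus bounded_linear_compose[OF bounded_bilinear.bounded_linear_left[OF bounded_bilinear_blinfun_compose]]
        bounded_linear_compose[OF bounded_bilinear.bounded_linear_right[OF bounded_bilinear_blinfun_compose]])
    show "((\<lambda>y. norm (V y - V x) * (K + r y) * norm (V x) + norm (V x) * r y * norm (V x)) \<longlongrightarrow> 0) (at x within S)"
    proof -
      have "((\<lambda>y. norm (V y - V x) * (K + r y) * norm (V x) + norm (V x) * r y * norm (V x)) \<longlongrightarrow>
          0 * (K + 0) * norm (V x) + norm (V x) * 0 * norm (V x)) (at x within S)"
        by (intro tendsto_intros r tendsto_norm_zero Vlim)
      then show ?thesis by simp
    qed
    fix y assume y: "y \<in> S" "y \<noteq> x"
    \<comment> \<open>The error splits into a product of two small differences and the remainder of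
      \<open>A\<close> enclosed between two copies of \<open>V x\<close>; both are o(norm (y -
      x)).\<close>
    have "V y - V x - - (V x o\<^sub>L A' (y - x) o\<^sub>L V x)
       = ((V y - V x) o\<^sub>L (A x - A y) o\<^sub>L V x) - (V x o\<^sub>L (A y - A x - A' (y - x)) o\<^sub>L V x)"
      by (rule blinfun_eqI) (simp add: blinfun.diff_left blinfun.diff_right blinfun.add_left blinfun.minus_left VAa[OF y(1)] VAa[OF x] AVa[OF y(1)] AVa[OF x])
    then have "norm (V y - V x - - (V x o\<^sub>L A' (y - x) o\<^sub>L V x))
       \<le> norm ((V y - V x) o\<^sub>L (A x - A y) o\<^sub>L V x) + norm (V x o\<^sub>L (A y - A x - A' (y - x)) o\<^sub>L V x)"
      using norm_triangle_ineq4 by simp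
    also have "\<dots> \<le> norm (V y - V x) * norm (A x - A y) * norm (V x)
        + norm (V x) * norm (A y - A x - A' (y - x)) * norm (V x)"
      by (intro add_mono comp)
    also have "\<dots> \<le> norm (V y - V x) * (norm (y - x) * (K + r y)) * norm (V x)
        + norm (V x) * (norm (y - x) * r y) * norm (V x)"
    proof -
      have rr: "norm (A y - A x - A' (y - x)) = norm (y - x) * r y" using y by (simp add: r_def)
      have "norm (A x - A y) \<le> norm (A' (y - x)) + norm (A y - A x - A' (y - x))"
        by (metis add.commute diff_add_cancel norm_minus_commute norm_triangle_ineq)
      also have "\<dots> \<le> norm (y - x) * (K + r y)"
        using K[of "y - x"] rr by (simp add: distrib_left)
      finally show ?thesis unfolding rr by (intro add_mono mult_right_mono mult_left_mono) auto
    qed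
    also have "\<dots> = norm (y - x) * (norm (V y - V x) * (K + r y) * norm (V x) + norm (V x) * r y * norm (V x))"
      by (simp add: algebra_simps)
    finally show "norm (V y - V x - - (V x o\<^sub>L A' (y - x) o\<^sub>L V x)) / norm (y - x) \<le>
        norm (V y - V x) * (K + r y) * norm (V x) + norm (V x) * r y * norm (V x)"
      using y by (simp add: divide_le_eq mult.commute)
  qed simp
qed

section \<open>Cartan's uniqueness theorem\<close>

lemma cinner_blinfun_le: "cmod (cinner (blinfun_apply X a) b) \<le> norm X * (norm a * norm b)"
proof -
  have "cmod (cinner (blinfun_apply X a) b) \<le> norm (blinfun_apply X a) * norm b"
    by (rule cinner_Cauchy_Schwarz)
  also have "\<dots> \<le> norm X * norm a * norm b" by (intro mult_right_mono norm_blinfun) simp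
  finally show ?thesis by (simp add: mult.assoc)
qed

lemma norm_blinfun_le_cinner:
  assumes "\<And>a b. cmod (cinner (blinfun_apply X a) b) \<le> M * (norm a * norm b)" "0 \<le> M"
  shows "norm X \<le> M"
proof (rule norm_blinfun_bound[OF assms(2)])
  fix a
  let ?y = "blinfun_apply X a"
  have "norm ?y * norm ?y \<le> (M * norm a) * norm ?y"
    using assms(1)[of a ?y] by (simp add: cinner_self power2_eq_square norm_mult mult.assoc)
  then show "norm ?y \<le> M * norm a"
    using assms(2) by (cases "norm ?y = 0") (auto simp: mult_le_cancel_right)
qed

text \<open>Every operator ball that is needed is the unit ball of a norm dual to a family of
  matrix coefficients \<open>T \<mapsto> \<langle>T a, b\<rangle>\<close>, so that the scalar Schwarz lemma applies.\<close>

definition wball :: "('k::cinner_space \<Rightarrow> 'h::cinner_space \<Rightarrow> real) \<Rightarrow> ('k \<Rightarrow>\<^sub>L 'h) set" where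
  "wball w = {T \<in> Lc. \<exists>\<rho>. 0 \<le> \<rho> \<and> \<rho> < 1 \<and>
     (\<forall>a b. cmod (cinner (blinfun_apply T a) b) \<le> \<rho> * w a b)}"

lemma wball_Lc: "T \<in> wball w \<Longrightarrow> T \<in> Lc"
  by (simp add: wball_def)

text \<open>The bound \<rho> < 1 is uniform in \<open>a\<close> and \<open>b\<close>, so a disc
  larger than the unit disc fits: R = 2 / (1 + \<rho>) exceeds 1 and still satisfies R \<rho> <
  1.\<close>

lemma wball_opscale:
  assumes "T \<in> wball w" and w: "\<And>a b. 0 \<le> w a b"
  shows "\<exists>R>1. \<forall>z. cmod z < R \<longrightarrow> opscale z T \<in> wball w"
proof -
  obtain \<rho> where r: "0 \<le> \<rho>" "\<rho> < 1" "\<And>a b. cmod (cinner (blinfun_apply T a) b) \<le> \<rho> * w a b"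
    and T: "T \<in> Lc"
    using assms(1) unfolding wball_def by blast
  show ?thesis
  proof (intro exI conjI allI impI)
    show "1 < 2 / (1 + \<rho>)" using r by simp
    fix z assume z: "cmod z < 2 / (1 + \<rho>)"
    have "cmod z * \<rho> \<le> 2 / (1 + \<rho>) * \<rho>" using z r by (intro mult_right_mono) auto
    also have "\<dots> < 1" using r by (simp add: divide_less_eq)
    finally have "cmod z * \<rho> < 1" .
    moreover have "cmod (cinner (blinfun_apply (opscale z T) a) b) \<le> cmod z * \<rho> * w a b" for a b
      using r(3)[of a b] by (simp add: cinner_cscale_left norm_mult mult.assoc mult_left_mono)
    ultimately show "opscale z T \<in> wball w"
      unfolding wball_def using T r(1) by (auto intro!: exI[of _ "cmod z * \<rho>"])
  qed
qed

text \<open>Each matrix coefficient of the curve is a scalar function bounded by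
  \<open>w a b\<close> and vanishing at 0, so the scalar Schwarz lemma yields an operator estimate
  in the norm of the ball, without loss of a constant.\<close>

lemma
  assumes c: "ccurve c (ball 0 R)" and R: "0 < R" and cw: "\<And>z. cmod z < R \<Longrightarrow> c z \<in> wball w"
    and c0: "c 0 = 0" and w: "\<And>a b. 0 \<le> w a b"
  shows wball_Schwarz: "cmod z < R \<Longrightarrow> cmod (cinner (blinfun_apply (c z) a) b) \<le> (cmod z / R) * w a b"
    and wball_Schwarz_deriv: "(c has_derivative (\<lambda>s. opscale s V)) (at 0) \<Longrightarrow>
      cmod (cinner (blinfun_apply V a) b) \<le> (1 / R) * w a b"
proof -
  let ?f = "\<lambda>z. cinner (blinfun_apply (c z) a) b"
  have hol: "?f holomorphic_on ball 0 R" using c by (rule holomorphic_cinner_curve) simp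
  have f0: "?f 0 = 0" by (simp add: c0)
  have bd: "cmod (?f z) \<le> w a b" if z: "cmod z < R" for z
  proof -
    obtain \<rho> where "0 \<le> \<rho>" "\<rho> < 1" "cmod (?f z) \<le> \<rho> * w a b"
      using cw[OF z] unfolding wball_def by blast
    then show ?thesis using mult_right_mono[of \<rho> 1 "w a b"] w[of a b] by simp
  qed
  show "cmod z < R \<Longrightarrow> cmod (?f z) \<le> (cmod z / R) * w a b"
    using Schwarz_scaled(1)[OF hol f0 bd R, of z] by (simp add: mult.commute)
  assume V: "(c has_derivative (\<lambda>s. opscale s V)) (at 0)"
  have "(?f has_field_derivative cinner (blinfun_apply V a) b) (at 0)"
    using has_field_derivative_cinner_curve[OF V] by simp
  then have "deriv ?f 0 = cinner (blinfun_apply V a) b" by (rule DERIV_imp_deriv)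
  then show "cmod (cinner (blinfun_apply V a) b) \<le> (1 / R) * w a b"
    using Schwarz_scaled(2)[OF hol f0 bd R] by simp
qed

text \<open>The Schwarz lemma used twice: f(z) = z h(z), where \<open>h\<close> is bounded by
  \<open>M / R\<close> and vanishes at 0 because the derivative of \<open>f\<close> does.\<close>

lemma Schwarz_second_order:
  fixes f :: "complex \<Rightarrow> complex"
  assumes hol: "f holomorphic_on ball 0 R" and f0: "f 0 = 0" and d0: "deriv f 0 = 0"
    and bound: "\<And>z. cmod z < R \<Longrightarrow> cmod (f z) \<le> M" and R: "0 < R" and z: "cmod z < R"
  shows "cmod (f z) \<le> M * (cmod z / R)\<^sup>2"
proof -
  have M0: "0 \<le> M" using bound[of 0] R f0 by simp
  obtain h where h: "h holomorphic_on ball 0 R" "\<And>z. cmod z < R \<Longrightarrow> f z = z * h z" "deriv f 0 = h 0"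
    using Schwarz3[OF hol f0] by blast
  have bh: "cmod (h z) \<le> M / R" if z: "cmod z < R" for z
  proof (cases "z = 0")
    case True
    then show ?thesis using h(3) d0 M0 R by simp
  next
    case False
    have "cmod z * cmod (h z) \<le> cmod z * (M / R)"
      using Schwarz_scaled(1)[OF hol f0 bound R z] h(2)[OF z] by (simp add: norm_mult mult.commute)
    moreover have "0 < cmod z" using False by simp
    ultimately show ?thesis by (rule mult_left_le_imp_le)
  qed
  have "cmod (h z) \<le> M / R * (cmod z / R)"
    using Schwarz_scaled(1)[OF h(1) _ bh R z] h(3) d0 by simp
  then have "cmod z * cmod (h z) \<le> cmod z * (M / R * (cmod z / R))"
    by (rule mult_left_mono) simp
  then show ?thesis using h(2)[OF z] by (simp add: norm_mult power2_eq_square mult_ac)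
qed

text \<open>\<alpha> and \<beta> compare the ball with operator norm balls from inside and from
  outside; these two radii determine the constants of all the estimates.\<close>

locale operator_ball =
  fixes w :: "'k::cinner_space \<Rightarrow> 'h::cinner_space \<Rightarrow> real" and \<alpha> \<beta> :: real
  assumes w: "\<And>a b. 0 \<le> w a b" and a0: "0 < \<alpha>" and b0: "0 < \<beta>"
    and inner: "\<And>T. T \<in> Lc \<Longrightarrow> norm T < \<alpha> \<Longrightarrow> T \<in> wball w"
    and outer: "\<And>T. T \<in> wball w \<Longrightarrow> norm T \<le> \<beta>"
begin

abbreviation "U \<equiv> wball w"

lemma zero_U: "0 \<in> U" using inner a0 by simp

text \<open>A bounded remainder that vanishes to second order is quadratically small, hence has a
  small Lipschitz constant near 0. The constant depends on \<alpha>, \<beta> and \<open>r\<close>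
  only, so the lemma is uniform over the averages to which it is applied; the condition on 36
  \<beta> r is what brings 18 \<beta> r / \<alpha>^2 below 1/2.\<close>

lemma Lipschitz_near_0:
  fixes R :: "('k \<Rightarrow>\<^sub>L 'h) \<Rightarrow> ('k \<Rightarrow>\<^sub>L 'h)"
  assumes curve: "\<And>c r a b. ccurve c (ball 0 r) \<Longrightarrow> c ` ball 0 r \<subseteq> U \<Longrightarrow>
      (\<lambda>z. cinner (blinfun_apply (R (c z)) a) b) holomorphic_on ball 0 r"
    and deriv: "\<And>X a b. X \<in> Lc \<Longrightarrow> deriv (\<lambda>z. cinner (blinfun_apply (R (opscale z X)) a) b) 0 = 0"
    and R0: "R 0 = 0" and bd: "\<And>X. X \<in> U \<Longrightarrow> norm (R X) \<le> 2 * \<beta>"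
    and r: "0 < r" "3 * r \<le> \<alpha>" "36 * \<beta> * r \<le> \<alpha>\<^sup>2"
    and X: "X \<in> Lc" "norm X < r" and X': "X' \<in> Lc" "norm X' < r"
  shows "norm (R X' - R X) \<le> norm (X' - X) / 2"
proof (cases "X' = X")
  case False
  have quad: "norm (R Z) \<le> 2 * \<beta> * (norm Z / \<alpha>)\<^sup>2" if Z: "Z \<in> Lc" "norm Z < \<alpha>" for Z
  proof (cases "Z = 0")
    case False
    define s where "s = \<alpha> / norm Z"
    have s: "1 < s" using Z(2) False by (simp add: s_def)
    have sub: "(\<lambda>z. opscale z Z) ` ball 0 s \<subseteq> U"
      using False Z(1) by (auto intro!: inner simp: norm_opscale s_def pos_less_divide_eq)
    have "cmod (cinner (blinfun_apply (R (opscale 1 Z)) a) b)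
        \<le> 2 * \<beta> * (norm a * norm b) * (cmod 1 / s)\<^sup>2" for a b
    proof (rule Schwarz_second_order)
      show "(\<lambda>z. cinner (blinfun_apply (R (opscale z Z)) a) b) holomorphic_on ball 0 s"
        using curve[OF ccurve_linear[OF Z(1)] sub] by simp
      show "cmod (cinner (blinfun_apply (R (opscale z Z)) a) b) \<le> 2 * \<beta> * (norm a * norm b)"
        if "cmod z < s" for z
      proof -
        have "norm (R (opscale z Z)) \<le> 2 * \<beta>" using sub that by (intro bd) auto
        then show ?thesis
          using cinner_blinfun_le[of "R (opscale z Z)" a b]
          by (meson mult_right_mono mult_nonneg_nonneg norm_ge_zero order_trans)
      qed
    qed (use s deriv[OF Z(1)] R0 in auto)
    then have "cmod (cinner (blinfun_apply (R Z) a) b) \<le> 2 * \<beta> * (norm Z / \<alpha>)\<^sup>2 * (norm a * norm b)" for a b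
      by (simp add: s_def power_divide mult_ac)
    then show ?thesis using b0 by (intro norm_blinfun_le_cinner) auto
  qed (simp add: R0)
  define W where "W = X' - X"
  have W: "W \<in> Lc" "0 < norm W" using X X' False by (auto simp: W_def)
  have W2: "norm W < 2 * r"
    using norm_triangle_ineq4[of X' X] X X' by (simp add: W_def)
  \<comment> \<open>For |z| < s the point \<open>X + opscale z W\<close> has norm below r + 2 r,
    hence stays inside the ball of radius \<alpha>.\<close>
  define s where "s = 2 * r / norm W"
  have s: "1 < s" using W W2 by (simp add: s_def)
  have arg: "X + opscale z W \<in> Lc" "norm (X + opscale z W) < 3 * r" if "cmod z < s" for z
  proof -
    show "X + opscale z W \<in> Lc" using X W by auto
    have "cmod z * norm W < 2 * r" using that W by (simp add: s_def pos_less_divide_eq)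
    then show "norm (X + opscale z W) < 3 * r"
      using norm_triangle_ineq[of X "opscale z W"] X by (simp add: norm_opscale)
  qed
  have sub: "(\<lambda>z. X + opscale z W) ` ball 0 s \<subseteq> U"
  proof clarsimp
    fix z assume "cmod z < s"
    then show "X + opscale z W \<in> U" using arg[of z] r(2) by (intro inner) linarith+
  qed
  have bound9: "norm (R (X + opscale z W)) \<le> 2 * \<beta> * (3 * r / \<alpha>)\<^sup>2" if "cmod z < s" for z
  proof -
    have "norm (R (X + opscale z W)) \<le> 2 * \<beta> * (norm (X + opscale z W) / \<alpha>)\<^sup>2"
      using arg[OF that] r(2) by (intro quad) auto
    also have "\<dots> \<le> 2 * \<beta> * (3 * r / \<alpha>)\<^sup>2"
      using arg[OF that] a0 b0 by (intro mult_left_mono power_mono divide_right_mono) auto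
    finally show ?thesis .
  qed
  \<comment> \<open>Twice the quadratic bound at radius 3 r, since a difference of two values is
    estimated.\<close>
  define M where "M = 4 * \<beta> * (3 * r / \<alpha>)\<^sup>2"
  have M0: "0 \<le> M" using b0 by (simp add: M_def)
  have "cmod (cinner (blinfun_apply (R (X + opscale 1 W)) a) b - cinner (blinfun_apply (R X) a) b)
      \<le> M * (norm a * norm b) * (cmod 1 / s)" for a b
  proof (rule Schwarz_scaled(1))
    show "(\<lambda>z. cinner (blinfun_apply (R (X + opscale z W)) a) b - cinner (blinfun_apply (R X) a) b) holomorphic_on ball 0 s"
      using curve[OF ccurve_affine[OF W(1)] sub] by (intro holomorphic_intros) auto
    show "cmod (cinner (blinfun_apply (R (X + opscale z W)) a) b - cinner (blinfun_apply (R X) a) b) \<le> M * (norm a * norm b)"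
      if "cmod z < s" for z
    proof -
      have "norm (R (X + opscale z W) - R X) \<le> M"
        using norm_triangle_ineq4[of "R (X + opscale z W)" "R X"] bound9[OF that] bound9[of 0] s
        by (simp add: M_def)
      then have "norm (R (X + opscale z W) - R X) * (norm a * norm b) \<le> M * (norm a * norm b)"
        by (intro mult_right_mono) auto
      then show ?thesis
        using cinner_blinfun_le[of "R (X + opscale z W) - R X" a b]
        by (simp add: blinfun.diff_left cinner_diff_left)
    qed
  qed (use s in auto)
  then have "cmod (cinner (blinfun_apply (R X' - R X) a) b) \<le> M / s * (norm a * norm b)" for a b
    by (simp add: W_def blinfun.diff_left cinner_diff_left mult_ac)
  then have "norm (R X' - R X) \<le> M / s"
    using M0 s by (intro norm_blinfun_le_cinner) auto
  also have "M / s = (18 * \<beta> * r / \<alpha>\<^sup>2) * norm W"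
    using r(1) by (simp add: M_def s_def power2_eq_square field_simps)
  also have "\<dots> \<le> (1/2) * norm W"
    using r(3) a0 by (intro mult_right_mono) (auto simp: divide_le_eq)
  finally show ?thesis by (simp add: W_def)
qed simp

text \<open>The averages of the iterates of \<open>f\<close> are uniformly bi-Lipschitz near 0 and almost
  \<open>f\<close>-invariant, hence \<open>f\<close> is the identity near 0.\<close>

lemma Cartan_uniqueness:
  fixes f :: "('k \<Rightarrow>\<^sub>L 'h) \<Rightarrow> ('k \<Rightarrow>\<^sub>L 'h)"
  assumes f: "hol f U" and fU: "f ` U \<subseteq> U" and f0: "f 0 = 0"
    and D0: "(f has_derivative D0) (at 0 within U)" and D0id: "\<And>Z. Z \<in> Lc \<Longrightarrow> D0 Z = Z"
    and X: "X \<in> U"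
  shows "f X = X"
proof -
  have iter: "hol (f ^^ n) U \<and> (f ^^ n) ` U \<subseteq> U \<and> (f ^^ n) 0 = 0 \<and>
      (\<exists>Dn. ((f ^^ n) has_derivative Dn) (at 0 within U) \<and> (\<forall>Z\<in>Lc. Dn Z = Z))" for n
  proof (induction n)
    case 0
    have "hol (\<lambda>x. x) U" unfolding hol_def by (auto intro!: exI[of _ "\<lambda>x. x"])
    then show ?case by (auto simp: id_def intro!: exI[of _ "\<lambda>x. x"])
  next
    case (Suc n)
    then obtain Dn where Dn: "((f ^^ n) has_derivative Dn) (at 0 within U)" "\<forall>Z\<in>Lc. Dn Z = Z" by blast
    have "((\<lambda>x. f ((f ^^ n) x)) has_derivative (\<lambda>h. D0 (Dn h))) (at 0 within U)"
      using Suc by (intro has_derivative_compose_within[OF Dn(1), of f D0 U]) (auto simp: D0)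
    moreover have "hol (\<lambda>x. f ((f ^^ n) x)) U" using Suc by (intro hol_compose[OF _ f]) auto
    moreover have "(\<lambda>x. f ((f ^^ n) x)) ` U \<subseteq> U" using Suc fU by fast
    ultimately show ?case using Suc Dn(2) f0 D0id by (auto simp: o_def intro!: exI[of _ "\<lambda>h. D0 (Dn h)"])
  qed
  \<comment> \<open>The average of the first \<open>n\<close> iterates minus the identity. All
    iterates are tangent to the identity at 0, so \<open>R n\<close> vanishes to second order there,
    with the bound 2 \<beta> for every positive \<open>n\<close>.\<close>
  define R where "R n X = (1 / real n) *\<^sub>R (\<Sum>k<n. (f ^^ k) X) - X" for n :: nat and X
  have cR: "cinner (blinfun_apply (R n Y) a) b =
      of_real (1 / real n) * (\<Sum>k<n. cinner (blinfun_apply ((f ^^ k) Y) a) b) - cinner (blinfun_apply Y a) b" for n Y a b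
    by (simp add: R_def blinfun.diff_left blinfun.scaleR_left blinfun.sum_left cinner_diff_left
        scaleR_cscale cinner_cscale_left cinner_sum_left)
  define r where "r = min (\<alpha> / 3) (\<alpha>\<^sup>2 / (36 * \<beta>))"
  have r: "0 < r" "3 * r \<le> \<alpha>" "36 * \<beta> * r \<le> \<alpha>\<^sup>2"
    using a0 b0 by (auto simp: r_def min_def field_simps)
  have Lip: "norm (R n Z' - R n Z) \<le> norm (Z' - Z) / 2"
    if n: "0 < n" and Z: "Z \<in> Lc" "norm Z < r" "Z' \<in> Lc" "norm Z' < r" for n Z Z'
  proof (rule Lipschitz_near_0[OF _ _ _ _ r Z(1,2,3,4)])
    show "(\<lambda>z. cinner (blinfun_apply (R n (c z)) a) b) holomorphic_on ball 0 s"
      if c: "ccurve c (ball 0 s)" "c ` ball 0 s \<subseteq> U" for c s a b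
    proof -
      have "(\<lambda>z. cinner (blinfun_apply ((f ^^ k) (c z)) a) b) holomorphic_on ball 0 s" for k a b
        using iter c by (intro holomorphic_cinner_curve hol_ccurve[OF c(1)]) auto
      moreover have "(\<lambda>z. cinner (blinfun_apply (c z) a) b) holomorphic_on ball 0 s" for a b
        using c by (intro holomorphic_cinner_curve) auto
      ultimately show ?thesis by (auto simp: cR intro!: holomorphic_intros)
    qed
    show "R n 0 = 0" using iter by (simp add: R_def)
    show "norm (R n Y) \<le> 2 * \<beta>" if Y: "Y \<in> U" for Y
    proof -
      have "norm ((1 / real n) *\<^sub>R (\<Sum>k<n. (f ^^ k) Y)) \<le> (1 / real n) * (\<Sum>k<n. \<beta>)"
        unfolding norm_scaleR using iter Y outer by (intro mult_mono sum_norm_le) auto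
      then have "norm ((1 / real n) *\<^sub>R (\<Sum>k<n. (f ^^ k) Y)) \<le> \<beta>" using n by simp
      then show ?thesis
        using norm_triangle_ineq4[of "(1 / real n) *\<^sub>R (\<Sum>k<n. (f ^^ k) Y)" Y] outer[OF Y]
        by (simp add: R_def)
    qed
    show "deriv (\<lambda>z. cinner (blinfun_apply (R n (opscale z Y)) a) b) 0 = 0" if Y: "Y \<in> Lc" for Y a b
    proof (rule DERIV_imp_deriv)
      define s where "s = \<alpha> / (norm Y + 1)"
      have s: "0 < s" using a0 by (simp add: s_def add_nonneg_pos)
      have sub: "(\<lambda>z. opscale z Y) ` ball 0 s \<subseteq> U"
      proof clarsimp
        fix z assume "cmod z < s"
        then have "cmod z * (norm Y + 1) < \<alpha>" by (simp add: s_def pos_less_divide_eq add_nonneg_pos)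
        moreover have "cmod z * norm Y \<le> cmod z * (norm Y + 1)" by (intro mult_left_mono) auto
        ultimately show "opscale z Y \<in> U" using Y by (intro inner) (auto simp: norm_opscale)
      qed
      have lin: "((\<lambda>z. opscale z Y) has_derivative (\<lambda>c. opscale c Y)) (at 0 within ball 0 s)"
        by (intro bounded_linear_imp_has_derivative bounded_linear_opscale_left)
      have k: "((\<lambda>z. cinner (blinfun_apply ((f ^^ k) (opscale z Y)) a) b) has_field_derivative cinner (blinfun_apply Y a) b) (at 0)" for k
      proof -
        obtain Dk where Dk: "((f ^^ k) has_derivative Dk) (at 0 within U)" "\<forall>Z\<in>Lc. Dk Z = Z"
          using iter by blast
        have "((\<lambda>z. (f ^^ k) (opscale z Y)) has_derivative (\<lambda>c. Dk (opscale c Y))) (at 0 within ball 0 s)"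
          using Dk(1) by (intro has_derivative_compose_within[OF lin _ sub]) simp
        then have "((\<lambda>z. (f ^^ k) (opscale z Y)) has_derivative (\<lambda>c. opscale c Y)) (at 0 within ball 0 s)"
          using Dk(2) Y by (simp add: Lc_opscale)
        then have "((\<lambda>z. cinner (blinfun_apply ((f ^^ k) (opscale z Y)) a) b) has_field_derivative cinner (blinfun_apply Y a) b) (at 0 within ball 0 s)"
          by (rule has_field_derivative_cinner_curve)
        then show ?thesis using s by (simp add: at_within_open[of 0 "ball 0 s"])
      qed
      have "((\<lambda>z. cinner (blinfun_apply (R n (opscale z Y)) a) b) has_field_derivative
         of_real (1 / real n) * (\<Sum>k<n. cinner (blinfun_apply Y a) b) - cinner (blinfun_apply Y a) b) (at 0)"
        unfolding cR using k[of 0] k by (intro DERIV_diff DERIV_cmult DERIV_sum) auto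
      then show "((\<lambda>z. cinner (blinfun_apply (R n (opscale z Y)) a) b) has_field_derivative 0) (at 0)"
        using n by simp
    qed
  qed
  \<comment> \<open>By the Schwarz lemma norm (f Z) <= \<beta> norm Z / \<alpha>, so for norm Z < r'
    both \<open>Z\<close> and \<open>f Z\<close> lie where \<open>R n\<close> has Lipschitz constant
    1/2.\<close>
  define r' where "r' = min r (r * \<alpha> / \<beta>)"
  have r': "0 < r'" using r a0 b0 by (simp add: r'_def)
  have local: "f Z = Z" if Z: "Z \<in> Lc" "norm Z < r'" for Z
  proof -
    have ZU: "Z \<in> U" using Z r(1,2) by (intro inner) (auto simp: r'_def)
    have fZ: "f Z \<in> U" using fU ZU by blast
    have "norm (f Z) < r"
    proof (cases "Z = 0")
      case False
      define s where "s = \<alpha> / norm Z"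
      have s: "1 < s" using Z r False by (simp add: s_def r'_def)
      have sub: "(\<lambda>z. opscale z Z) ` ball 0 s \<subseteq> U"
        using False Z(1) by (auto intro!: inner simp: norm_opscale s_def pos_less_divide_eq)
      have "cmod (cinner (blinfun_apply (f (opscale 1 Z)) a) b) \<le> \<beta> * (norm a * norm b) * (cmod 1 / s)" for a b
      proof (rule Schwarz_scaled(1))
        show "(\<lambda>z. cinner (blinfun_apply (f (opscale z Z)) a) b) holomorphic_on ball 0 s"
          using sub by (intro holomorphic_cinner_curve hol_ccurve[OF ccurve_linear[OF Z(1)] f]) auto
        show "cmod (cinner (blinfun_apply (f (opscale z Z)) a) b) \<le> \<beta> * (norm a * norm b)" if "cmod z < s" for z
        proof -
          have "opscale z Z \<in> U" using sub that by auto
          then have "norm (f (opscale z Z)) \<le> \<beta>" using fU by (intro outer) auto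
          then have "norm (f (opscale z Z)) * (norm a * norm b) \<le> \<beta> * (norm a * norm b)"
            by (intro mult_right_mono) auto
          then show ?thesis using cinner_blinfun_le[of "f (opscale z Z)" a b] by simp
        qed
      qed (use s f0 in auto)
      then have "norm (f Z) \<le> \<beta> / s"
        using s b0 by (intro norm_blinfun_le_cinner) (auto simp: mult_ac)
      also have "\<beta> / s = \<beta> * norm Z / \<alpha>" by (simp add: s_def)
      also have "\<dots> < r"
        using Z(2) a0 b0 by (simp add: r'_def field_simps)
      finally show ?thesis .
    qed (use f0 r in simp)
    \<comment> \<open>Averages taken at \<open>f Z\<close> and at \<open>Z\<close> telescope to ((f
      ^^ n) Z - Z) / n, of norm at most 2 \<beta> / n. As the average is the identity plus
      \<open>R n\<close>, half of norm (f Z - Z) survives on the left.\<close>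
    have key: "norm (f Z - Z) \<le> 4 * \<beta> / real (Suc n)" for n
    proof -
      let ?n = "Suc n"
      have "(\<Sum>k<?n. (f ^^ k) (f Z)) - (\<Sum>k<?n. (f ^^ k) Z) = (f ^^ ?n) Z - Z"
        unfolding sum_subtractf[symmetric]
        using sum_lessThan_telescope[of "\<lambda>k. (f ^^ k) Z" ?n] by (simp add: funpow_swap1)
      then have "(1 / real ?n) *\<^sub>R (\<Sum>k<?n. (f ^^ k) (f Z)) - (1 / real ?n) *\<^sub>R (\<Sum>k<?n. (f ^^ k) Z)
          = (1 / real ?n) *\<^sub>R ((f ^^ ?n) Z - Z)"
        by (metis scaleR_diff_right)
      then have "f Z - Z = (1 / real ?n) *\<^sub>R ((f ^^ ?n) Z - Z) - (R ?n (f Z) - R ?n Z)"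
        unfolding R_def by (simp add: algebra_simps)
      then have "norm (f Z - Z) \<le> norm ((1 / real ?n) *\<^sub>R ((f ^^ ?n) Z - Z)) + norm (R ?n (f Z) - R ?n Z)"
        by (metis norm_triangle_ineq4)
      also have "norm (R ?n (f Z) - R ?n Z) \<le> norm (f Z - Z) / 2"
        using Z fZ \<open>norm (f Z) < r\<close> by (intro Lip) (auto simp: r'_def wball_Lc)
      also have "norm ((1 / real ?n) *\<^sub>R ((f ^^ ?n) Z - Z)) \<le> (1 / real ?n) * (2 * \<beta>)"
      proof -
        have "(f ^^ ?n) Z \<in> U" using iter[of ?n] ZU by blast
        then have "norm ((f ^^ ?n) Z - Z) \<le> 2 * \<beta>"
          using norm_triangle_ineq4[of "(f ^^ ?n) Z" Z] outer[of "(f ^^ ?n) Z"] outer[OF ZU] by linarith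
        then show ?thesis unfolding norm_scaleR by (intro mult_mono) auto
      qed
      finally show ?thesis by simp
    qed
    have "(\<lambda>n. 4 * \<beta> / real (Suc n)) \<longlonglongrightarrow> 0"
      using LIMSEQ_Suc[OF lim_const_over_n[of "4 * \<beta>"]] by simp
    then have "norm (f Z - Z) \<le> 0"
      using key by (intro LIMSEQ_le_const) auto
    then show ?thesis by simp
  qed
  \<comment> \<open>From a neighbourhood of 0 to all of \<open>U\<close>: the identity theorem on
    the disc of multiples of \<open>X\<close>, whose radius exceeds 1.\<close>
  obtain s where s: "1 < s" "\<And>z. cmod z < s \<Longrightarrow> opscale z X \<in> U"
    using wball_opscale[OF X w] by blast
  have sub: "(\<lambda>z. opscale z X) ` ball 0 s \<subseteq> U" using s by auto
  have XL: "X \<in> Lc" using X by (rule wball_Lc)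
  show ?thesis
  proof (rule blinfun_eqI, rule cinner_ext)
    fix a b
    define t where "t = min s (r' / (norm X + 1))"
    have t: "0 < t" using s r' by (simp add: t_def add_nonneg_pos)
    let ?g = "\<lambda>z. cinner (blinfun_apply (f (opscale z X)) a) b - cinner (blinfun_apply (opscale z X) a) b"
    have "?g 1 = 0"
    proof (rule analytic_continuation[of ?g "ball 0 s" "ball 0 t" 0])
      show "?g holomorphic_on ball 0 s"
        using sub by (intro holomorphic_intros holomorphic_cinner_curve hol_ccurve[OF ccurve_linear[OF XL] f]
           ccurve_linear[OF XL]) auto
      show "0 islimpt ball (0::complex) t" using t by (simp add: islimpt_ball)
      fix z assume "z \<in> ball (0::complex) t"
      then have "cmod z < r' / (norm X + 1)" by (simp add: t_def)
      then have "cmod z * (norm X + 1) < r'" by (simp add: pos_less_divide_eq add_nonneg_pos)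
      moreover have "cmod z * norm X \<le> cmod z * (norm X + 1)" by (intro mult_left_mono) auto
      ultimately have "f (opscale z X) = opscale z X"
        using XL by (intro local) (auto simp: norm_opscale)
      then show "?g z = 0" by simp
    qed (use s t in \<open>auto simp: t_def\<close>)
    then show "cinner (blinfun_apply (f X) a) b = cinner (blinfun_apply X a) b" by simp
  qed
qed

text \<open>Such an \<open>h\<close> is the restriction of its derivative at 0: composing
  \<open>h'\<close> with that derivative gives a self-map of \<open>U\<close> tangent to the
  identity, which Cartan's theorem identifies with the identity. A linear map of \<open>U\<close>
  into itself has norm controlled by \<beta> / \<alpha>.\<close>

lemma automorphism_Lipschitz:
  fixes h h' :: "('k \<Rightarrow>\<^sub>L 'h) \<Rightarrow> ('k \<Rightarrow>\<^sub>L 'h)"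
  assumes h: "hol h U" "h ` U \<subseteq> U" "h 0 = 0" and h': "hol h' U" "h' ` U \<subseteq> U"
    and inv: "\<And>X. X \<in> U \<Longrightarrow> h' (h X) = X" "\<And>X. X \<in> U \<Longrightarrow> h (h' X) = X"
    and X: "X \<in> U" "X' \<in> U"
  shows "norm (h X - h X') \<le> 2 * \<beta> / \<alpha> * norm (X - X')"
proof -
  have half: "\<exists>M. (g' has_derivative M) (at 0 within U) \<and> (\<forall>X\<in>U. M (g X) = X) "
    if g: "hol g U" "g ` U \<subseteq> U" "g 0 = 0" and g': "hol g' U" "g' ` U \<subseteq> U" "g' 0 = 0"
      and gi: "\<And>X. X \<in> U \<Longrightarrow> g' (g X) = X" for g g' :: "('k \<Rightarrow>\<^sub>L 'h) \<Rightarrow> ('k \<Rightarrow>\<^sub>L 'h)"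
  proof -
    obtain L where L: "(g has_derivative L) (at 0 within U)" "\<forall>Y\<in>Lc. L Y \<in> Lc"
        "\<forall>c. \<forall>Y\<in>Lc. L (opscale c Y) = opscale c (L Y)"
      using g(1) zero_U unfolding hol_def by blast
    obtain M where M: "(g' has_derivative M) (at 0 within U)" "\<forall>Y\<in>Lc. M Y \<in> Lc"
        "\<forall>c. \<forall>Y\<in>Lc. M (opscale c Y) = opscale c (M Y)"
      using g'(1) zero_U unfolding hol_def by blast
    have blM: "bounded_linear M" using M(1) by (rule has_derivative_bounded_linear)
    have lin: "((\<lambda>z. opscale z Y) has_derivative (\<lambda>c. opscale c Y)) (at 0 within S)" for Y :: "'k \<Rightarrow>\<^sub>L 'h" and S
      by (intro bounded_linear_imp_has_derivative bounded_linear_opscale_left)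
    have comp_id: "M (L Z) = Z" if Z: "Z \<in> Lc" for Z
    proof -
      define s where "s = \<alpha> / (norm Z + 1)"
      have s: "0 < s" using a0 by (simp add: s_def add_nonneg_pos)
      have sub: "(\<lambda>z. opscale z Z) ` ball 0 s \<subseteq> U"
      proof clarsimp
        fix z assume "cmod z < s"
        then have "cmod z * (norm Z + 1) < \<alpha>" by (simp add: s_def pos_less_divide_eq add_nonneg_pos)
        moreover have "cmod z * norm Z \<le> cmod z * (norm Z + 1)" by (intro mult_left_mono) auto
        ultimately show "opscale z Z \<in> U" using Z by (intro inner) (auto simp: norm_opscale)
      qed
      have 1: "((\<lambda>z. g (opscale z Z)) has_derivative (\<lambda>c. L (opscale c Z))) (at 0 within ball 0 s)"
        using L(1) by (intro has_derivative_compose_within[OF lin _ sub]) simp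
      have 2: "((\<lambda>z. g' (g (opscale z Z))) has_derivative (\<lambda>c. M (L (opscale c Z)))) (at 0 within ball 0 s)"
        using M(1) g(2,3) sub by (intro has_derivative_compose_within[OF 1, of g' M U]) auto
      have "((\<lambda>z. opscale z Z) has_derivative (\<lambda>c. M (L (opscale c Z)))) (at 0 within ball 0 s)"
      proof (rule has_derivative_transform[OF _ _ 2])
        show "opscale z Z = g' (g (opscale z Z))" if "z \<in> ball 0 s" for z
          using gi sub that by (metis image_subset_iff)
      qed (use s in simp)
      then have "((\<lambda>z. opscale z Z) has_derivative (\<lambda>c. M (L (opscale c Z)))) (at 0)"
        using s by (simp add: at_within_open[of 0 "ball 0 s"])
      then have "(\<lambda>c. M (L (opscale c Z))) = (\<lambda>c. opscale c Z)"
        by (rule has_derivative_unique) (rule lin)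
      from fun_cong[OF this, of 1] show ?thesis by simp
    qed
    \<comment> \<open>The derivative of a self-map fixing 0 is itself a self-map of
      \<open>U\<close>: the Schwarz estimate for the derivative on a disc of radius s > 1 gives the
      bound 1 / s.\<close>
    have MU: "M Z \<in> U" if Z: "Z \<in> U" for Z
    proof -
      obtain s where s: "1 < s" "\<And>z. cmod z < s \<Longrightarrow> opscale z Z \<in> U"
        using wball_opscale[OF Z w] by blast
      have ZL: "Z \<in> Lc" using Z by (rule wball_Lc)
      have sub: "(\<lambda>z. opscale z Z) ` ball 0 s \<subseteq> U" using s by auto
      have c: "ccurve (\<lambda>z. g' (opscale z Z)) (ball 0 s)"
        using sub by (intro hol_ccurve[OF ccurve_linear[OF ZL] g'(1)])
      have "((\<lambda>z. g' (opscale z Z)) has_derivative (\<lambda>c. M (opscale c Z))) (at 0 within ball 0 s)"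
        using M(1) by (intro has_derivative_compose_within[OF lin _ sub]) simp
      then have d: "((\<lambda>z. g' (opscale z Z)) has_derivative (\<lambda>c. opscale c (M Z))) (at 0)"
        using s M(3) ZL by (simp add: at_within_open[of 0 "ball 0 s"])
      have "cmod (cinner (blinfun_apply (M Z) a) b) \<le> (1 / s) * w a b" for a b
        by (rule wball_Schwarz_deriv[OF c _ _ _ w d]) (use s g' in auto)
      then show ?thesis unfolding wball_def using s(1) M(2) ZL by (auto intro!: exI[of _ "1 / s"])
    qed
    have "M (g X) = X" if "X \<in> U" for X
    proof (rule Cartan_uniqueness[of "\<lambda>X. M (g X)" "\<lambda>X. M (L X)", OF _ _ _ _ _ that])
      have "hol M U" unfolding hol_def
        using M(2,3) bounded_linear_imp_has_derivative[OF blM] by (auto intro!: exI[of _ M])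
      then show "hol (\<lambda>X. M (g X)) U"
        using g(2) by (rule hol_compose[OF g(1)])
      show "(\<lambda>X. M (g X)) ` U \<subseteq> U" using MU g(2) by auto
      show "M (g 0) = 0" using g(3) blM by (simp add: linear_0 bounded_linear.linear)
      show "((\<lambda>X. M (g X)) has_derivative (\<lambda>X. M (L X))) (at 0 within U)"
        by (rule bounded_linear.has_derivative[OF blM L(1)])
    qed (rule comp_id)
    then show ?thesis using M(1) by blast
  qed
  have h'0: "h' 0 = 0" using inv(1)[OF zero_U] h(3) by simp
  \<comment> \<open>\<open>half\<close> is used with the roles exchanged: its \<open>g\<close> is
    \<open>h'\<close> and its \<open>g'\<close> is \<open>h\<close>, so that the derivative obtained
    is that of \<open>h\<close>.\<close>
  obtain L where L: "(h has_derivative L) (at 0 within U)" "\<forall>X\<in>U. L (h' X) = X"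
    using half[OF h'(1,2) h'0 h inv(2)] by blast
  have blL: "bounded_linear L" using L(1) by (rule has_derivative_bounded_linear)
  have hL: "h X = L X" if "X \<in> U" for X
    using L(2) inv(1)[OF that] h(2) that by (metis image_subset_iff)
  have bound: "norm (L Z) \<le> 2 * \<beta> / \<alpha> * norm Z" if Z: "Z \<in> Lc" for Z
  proof (cases "Z = 0")
    case False
    \<comment> \<open>Scales \<open>Z\<close> to norm \<alpha> / 2, strictly inside the inner ball;
      this is the source of the factor 2.\<close>
    define t where "t = \<alpha> / (2 * norm Z)"
    have t: "0 < t" using a0 False by (simp add: t_def)
    have tU: "t *\<^sub>R Z \<in> U"
      using Z t a0 False by (intro inner) (auto simp: t_def)
    have "t * norm (L Z) = norm (L (t *\<^sub>R Z))"
      using t by (simp add: linear_scale[OF bounded_linear.linear[OF blL]])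
    also have "\<dots> \<le> \<beta>" using hL[OF tU] outer[of "h (t *\<^sub>R Z)"] h(2) tU by auto
    finally have "norm (L Z) \<le> \<beta> / t" using t by (simp add: field_simps)
    then show ?thesis using False a0 by (simp add: t_def field_simps)
  qed (simp add: linear_0[OF bounded_linear.linear[OF blL]])
  have "h X - h X' = L (X - X')" using hL X by (simp add: linear_diff[OF bounded_linear.linear[OF blL]])
  then show ?thesis using bound[of "X - X'"] X wball_Lc by auto
qed

end

section \<open>Moebius transformations of the operator ball\<close>

lemma Bop_Lc: "X \<in> Bop \<Longrightarrow> X \<in> Lc" and Bop_norm: "X \<in> Bop \<Longrightarrow> norm X < 1"
  by (simp_all add: Bop_def)

lemma zero_Bop [simp]: "0 \<in> Bop" by (simp add: Bop_def)

context fin_dim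
begin

text \<open>One shape that covers both the transformation centred at a point and its inverse, so
  that differentiability and Lipschitz bounds are proved once.\<close>

definition moebius :: "('k \<Rightarrow>\<^sub>L 'h::cinner_space) \<Rightarrow> ('k \<Rightarrow>\<^sub>L 'h) \<Rightarrow> ('h \<Rightarrow>\<^sub>L 'k) \<Rightarrow> ('k \<Rightarrow>\<^sub>L 'k) \<Rightarrow>
    ('k \<Rightarrow>\<^sub>L 'h) \<Rightarrow> ('k \<Rightarrow>\<^sub>L 'h)" where
  "moebius A B C D X = B + (((X + A) o\<^sub>L binv (id_blinfun + (C o\<^sub>L X))) o\<^sub>L D)"

context
  fixes A B :: "'k \<Rightarrow>\<^sub>L 'h::cinner_space" and C :: "'h \<Rightarrow>\<^sub>L 'k" and D :: "'k \<Rightarrow>\<^sub>L 'k" and U :: "('k \<Rightarrow>\<^sub>L 'h) set"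
  assumes Lc: "A \<in> Lc" "B \<in> Lc" "C \<in> Lc" "D \<in> Lc" "U \<subseteq> Lc"
    and inj: "\<And>X k. X \<in> U \<Longrightarrow> k + blinfun_apply C (blinfun_apply X k) = 0 \<Longrightarrow> k = 0"
begin

lemma denominator:
  assumes "X \<in> U"
  shows "id_blinfun + (C o\<^sub>L X) \<in> Lc" "blinfun_apply (id_blinfun + (C o\<^sub>L X)) k = 0 \<Longrightarrow> k = 0"
proof -
  show "id_blinfun + (C o\<^sub>L X) \<in> Lc"
    by (intro Lc_add Lc_id Lc_compose Lc subsetD[OF Lc(5) assms])
  show "blinfun_apply (id_blinfun + (C o\<^sub>L X)) k = 0 \<Longrightarrow> k = 0"
    using inj[OF assms, of k] by (simp add: blinfun.add_left)
qed

lemma hol_moebius: "hol (moebius A B C D) U"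
  unfolding hol_def
proof
  fix X assume X: "X \<in> U"
  define V where "V Z = binv (id_blinfun + (C o\<^sub>L Z))" for Z :: "'k \<Rightarrow>\<^sub>L 'h"
  have VL: "V X \<in> Lc" unfolding V_def using denominator[OF X] by (rule binv_Lc)
  have 1: "((\<lambda>Z. id_blinfun + (C o\<^sub>L Z)) has_derivative (\<lambda>H. C o\<^sub>L H)) (at X within U)"
    by (auto intro!: derivative_eq_intros bounded_linear_imp_has_derivative
        bounded_bilinear.bounded_linear_right[OF bounded_bilinear_blinfun_compose])
  have 2: "(V has_derivative (\<lambda>H. - ((V X o\<^sub>L (C o\<^sub>L H)) o\<^sub>L V X))) (at X within U)"
    unfolding V_def
    by (rule has_derivative_operator_inverse[OF 1 X])
       (rule binv_comp_left binv_comp_right, erule denominator, erule denominator, assumption)+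
  have 3: "((\<lambda>Z. Z + A) has_derivative (\<lambda>H. H)) (at X within U)"
    by (auto intro!: derivative_eq_intros)
  have 4: "((\<lambda>Z. (Z + A) o\<^sub>L V Z) has_derivative
      (\<lambda>H. ((X + A) o\<^sub>L (- ((V X o\<^sub>L (C o\<^sub>L H)) o\<^sub>L V X))) + (H o\<^sub>L V X))) (at X within U)"
    by (rule bounded_bilinear.FDERIV[OF bounded_bilinear_blinfun_compose 3 2])
  have 5: "((\<lambda>Z. ((Z + A) o\<^sub>L V Z) o\<^sub>L D) has_derivative
      (\<lambda>H. (((X + A) o\<^sub>L (- ((V X o\<^sub>L (C o\<^sub>L H)) o\<^sub>L V X))) + (H o\<^sub>L V X)) o\<^sub>L D)) (at X within U)"
    by (rule bounded_linear.has_derivative[OF bounded_bilinear.bounded_linear_left[OF bounded_bilinear_blinfun_compose] 4])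
  have "(moebius A B C D has_derivative
      (\<lambda>H. (((X + A) o\<^sub>L (- ((V X o\<^sub>L (C o\<^sub>L H)) o\<^sub>L V X))) + (H o\<^sub>L V X)) o\<^sub>L D)) (at X within U)"
    unfolding moebius_def[abs_def] V_def[symmetric]
    using has_derivative_add[OF has_derivative_const 5] by simp
  moreover have XL: "X \<in> Lc" using X Lc by auto
  moreover have "(((X + A) o\<^sub>L (- ((V X o\<^sub>L (C o\<^sub>L H)) o\<^sub>L V X))) + (H o\<^sub>L V X)) o\<^sub>L D \<in> Lc" if "H \<in> Lc" for H
    by (intro Lc_compose Lc_add Lc_minus VL Lc XL that)
  moreover have "(((X + A) o\<^sub>L (- ((V X o\<^sub>L (C o\<^sub>L opscale c H)) o\<^sub>L V X))) + (opscale c H o\<^sub>L V X)) o\<^sub>L D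
      = opscale c ((((X + A) o\<^sub>L (- ((V X o\<^sub>L (C o\<^sub>L H)) o\<^sub>L V X))) + (H o\<^sub>L V X)) o\<^sub>L D)" for c H
    by (rule blinfun_eqI)
       (simp add: blinfun.add_left blinfun.minus_left blinfun.minus_right LcD[OF VL] LcD[OF XL]
         LcD[OF Lc(1)] LcD[OF Lc(3)] cscale_add_right cscale_minus_right cscale_diff_right)
  ultimately show "\<exists>D'. (moebius A B C D has_derivative D') (at X within U) \<and>
      (\<forall>Y\<in>Lc. D' Y \<in> Lc) \<and> (\<forall>c. \<forall>Y\<in>Lc. D' (opscale c Y) = opscale c (D' Y))"
    by blast
qed

text \<open>The resolvent identity V - V' = V C (X' - X) V' reduces a Lipschitz constant on all of
  \<open>U\<close> to uniform bounds for the points and for the inverted denominators.\<close>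

lemma Lipschitz_moebius:
  assumes m: "\<And>X. X \<in> U \<Longrightarrow> norm (binv (id_blinfun + (C o\<^sub>L X))) \<le> m"
    and M: "\<And>X. X \<in> U \<Longrightarrow> norm X \<le> M"
  shows "\<exists>K>0. \<forall>X\<in>U. \<forall>X'\<in>U. norm (moebius A B C D X - moebius A B C D X') \<le> K * norm (X - X')"
proof (intro exI conjI ballI)
  define K where "K = (m + (M + norm A) * (m * norm C * m)) * norm D"
  show "0 < max K 1" by simp
  fix X X' assume X: "X \<in> U" "X' \<in> U"
  define V where "V = binv (id_blinfun + (C o\<^sub>L X))"
  define V' where "V' = binv (id_blinfun + (C o\<^sub>L X'))"
  have m0: "0 \<le> m" using m[OF X(1)] norm_ge_zero order_trans by blast
  have M0: "0 \<le> M" using M[OF X(1)] norm_ge_zero order_trans by blast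
  have VV: "V - V' = (V o\<^sub>L (C o\<^sub>L (X' - X))) o\<^sub>L V'"
  proof (rule blinfun_eqI)
    fix i
    let ?j = "blinfun_apply V' i"
    have "i = ?j + blinfun_apply C (blinfun_apply X' ?j)"
      using binv_right[OF denominator[OF X(2)], of i] by (simp add: V'_def blinfun.add_left)
    from arg_cong[OF this, of "blinfun_apply V"]
    have 1: "blinfun_apply V i = blinfun_apply V ?j + blinfun_apply V (blinfun_apply C (blinfun_apply X' ?j))"
      by (simp only: blinfun.add_right)
    have 2: "blinfun_apply V ?j + blinfun_apply V (blinfun_apply C (blinfun_apply X ?j)) = ?j"
      using binv_left[OF denominator[OF X(1)], of ?j] by (simp add: V_def blinfun.add_left blinfun.add_right)
    have "blinfun_apply V i - ?j = blinfun_apply V (blinfun_apply C (blinfun_apply X' ?j)) - blinfun_apply V (blinfun_apply C (blinfun_apply X ?j))"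
      unfolding 1 by (subst (3) 2 [symmetric]) simp
    then show "blinfun_apply (V - V') i = blinfun_apply ((V o\<^sub>L (C o\<^sub>L (X' - X))) o\<^sub>L V') i"
      by (simp add: blinfun.diff_left blinfun.diff_right)
  qed
  have nV: "norm V \<le> m" "norm V' \<le> m" using m X by (auto simp: V_def V'_def)
  have comp: "norm (F o\<^sub>L G) \<le> f * g" if "norm F \<le> f" "norm G \<le> g" "0 \<le> f"
    for F :: "'b::real_normed_vector \<Rightarrow>\<^sub>L 'c::real_normed_vector" and G :: "'a::real_normed_vector \<Rightarrow>\<^sub>L 'b" and f g
    using norm_blinfun_compose[of F G] mult_mono[OF that(1,2,3) norm_ge_zero] by linarith
  have "norm (V - V') \<le> m * (norm C * norm (X' - X)) * m"
    unfolding VV using m0 by (intro comp nV) auto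
  moreover have "norm (X' + A) \<le> M + norm A"
    using norm_triangle_ineq[of X' A] M[OF X(2)] by simp
  ultimately have 1: "norm ((X' + A) o\<^sub>L (V - V')) \<le> (M + norm A) * (m * (norm C * norm (X' - X)) * m)"
    using M0 by (intro comp) auto
  have 2: "norm ((X - X') o\<^sub>L V) \<le> norm (X - X') * m" by (intro comp nV) auto
  have "moebius A B C D X - moebius A B C D X'
      = (((X - X') o\<^sub>L V) + ((X' + A) o\<^sub>L (V - V'))) o\<^sub>L D"
    unfolding moebius_def V_def[symmetric] V'_def[symmetric]
    by (rule blinfun_eqI) (simp add: blinfun.diff_left blinfun.add_left blinfun.diff_right)
  then have "norm (moebius A B C D X - moebius A B C D X')
      \<le> (norm (X - X') * m + (M + norm A) * (m * (norm C * norm (X' - X)) * m)) * norm D"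
    using m0 M0 comp[OF norm_triangle_mono[OF 2 1] order_refl, of D] by simp
  also have "\<dots> = K * norm (X - X')"
    by (simp add: K_def norm_minus_commute algebra_simps)
  also have "\<dots> \<le> max K 1 * norm (X - X')" by (intro mult_right_mono) auto
  finally show "norm (moebius A B C D X - moebius A B C D X') \<le> max K 1 * norm (X - X')" .
qed

end

definition defect :: "('k \<Rightarrow>\<^sub>L 'h::cinner_space) \<Rightarrow> ('k \<Rightarrow>\<^sub>L 'k)" where
  "defect Y = id_blinfun - (adj Y o\<^sub>L Y)"

text \<open>\<open>P Y\<close>, \<open>Q Y\<close> and \<open>Pd Y\<close> are the quadratic forms of \<open>(1 - Y\<^sup>*Y)\<^sup>-\<^sup>1\<close>, \<open>(1 - Y Y\<^sup>*)\<^sup>-\<^sup>1\<close>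
  and \<open>1 - Y Y\<^sup>*\<close>; working with forms avoids the square roots in the usual formula for
  the transitive Moebius transformations.\<close>

definition P :: "('k \<Rightarrow>\<^sub>L 'h::cinner_space) \<Rightarrow> 'k \<Rightarrow> real" where
  "P Y u = Re (cinner (blinfun_apply (binv (defect Y)) u) u)"

definition Q :: "('k \<Rightarrow>\<^sub>L 'h::cinner_space) \<Rightarrow> 'h \<Rightarrow> real" where
  "Q Y h = (norm h)\<^sup>2 + P Y (blinfun_apply (adj Y) h)"

definition Pd :: "('k \<Rightarrow>\<^sub>L 'h::cinner_space) \<Rightarrow> 'h \<Rightarrow> real" where
  "Pd Y b = (norm b)\<^sup>2 - (norm (blinfun_apply (adj Y) b))\<^sup>2"

text \<open>The pseudo-hyperbolic ball of radius \<rho> about \<open>Y\<close>. By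
  \<open>Q_diff\<close> it is the inequality Q(Xk - Yk) <= \<rho>^2 P(k - adj Y X k), rearranged so
  that, for \<rho> <= 1, the left side is a convex function of \<open>X\<close> and the right side
  does not involve \<open>X\<close>; this is why midpoints stay in the ball.\<close>

definition rel :: "real \<Rightarrow> ('k \<Rightarrow>\<^sub>L 'h::cinner_space) \<Rightarrow> ('k \<Rightarrow>\<^sub>L 'h) \<Rightarrow> bool" where
  "rel \<rho> X Y \<longleftrightarrow> (\<forall>k. (norm (blinfun_apply X k))\<^sup>2 +
     (1 - \<rho>\<^sup>2) * P Y (k - blinfun_apply (adj Y) (blinfun_apply X k)) \<le> (norm k)\<^sup>2)"

lemma norm_adj_comp_le:
  assumes "Y \<in> Lc"
  shows "norm (blinfun_apply (adj Y) (blinfun_apply X k)) \<le> norm Y * norm X * norm k"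
proof -
  have "norm (blinfun_apply (adj Y) (blinfun_apply X k)) \<le> norm Y * norm (blinfun_apply X k)"
    by (rule norm_adj_apply[OF assms])
  also have "\<dots> \<le> norm Y * (norm X * norm k)" by (intro mult_left_mono norm_blinfun) simp
  finally show ?thesis by (simp add: mult.assoc)
qed

lemma norm_denominator_ge:
  assumes "Y \<in> Lc"
  shows "(1 - norm Y * norm X) * norm k \<le> norm (k - blinfun_apply (adj Y) (blinfun_apply X k))"
  using norm_adj_comp_le[OF assms, of X k]
    norm_triangle_ineq2[of k "blinfun_apply (adj Y) (blinfun_apply X k)"]
  by (simp add: algebra_simps)

lemma denominator_inj:
  assumes "Y \<in> Lc" "norm Y * norm X < 1" "k - blinfun_apply (adj Y) (blinfun_apply X k) = 0"
  shows "k = 0"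
proof (rule ccontr)
  assume "k \<noteq> 0"
  then have "0 < (1 - norm Y * norm X) * norm k" using assms(2) by simp
  then show False using norm_denominator_ge[OF assms(1), of X k] assms(3) by simp
qed

context
  fixes Y :: "'k \<Rightarrow>\<^sub>L 'h::cinner_space"
  assumes Y: "Y \<in> Bop"
begin

section \<open>The forms \<open>P\<close>, \<open>Q\<close> and \<open>Pd\<close> at a centre in the
  ball\<close>

lemma YL: "Y \<in> Lc" and Y1: "norm Y < 1" and Y2: "(norm Y)\<^sup>2 < 1" and YY: "norm Y * norm Y < 1"
  using Y by (auto simp: Bop_def abs_square_less_1 power2_eq_square[symmetric])

abbreviation "J \<equiv> blinfun_apply (binv (defect Y))"
abbreviation "Ya \<equiv> blinfun_apply (adj Y)"
abbreviation "Yf \<equiv> blinfun_apply Y"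

lemma defect_apply: "blinfun_apply (defect Y) v = v - Ya (Yf v)"
  by (simp add: defect_def blinfun.diff_left)

lemma defect_Lc: "defect Y \<in> Lc"
  unfolding defect_def by (intro Lc_diff Lc_id Lc_compose adj_Lc YL)

lemma defect_inj: "blinfun_apply (defect Y) v = 0 \<Longrightarrow> v = 0"
  unfolding defect_apply by (rule denominator_inj[OF YL YY])

lemma J_Lc: "binv (defect Y) \<in> Lc"
  and J_right: "J u - Ya (Yf (J u)) = u"
  and J_left: "J (v - Ya (Yf v)) = v"
  using binv_Lc[OF defect_Lc defect_inj] binv_right[OF defect_Lc defect_inj, of u]
    binv_left[OF defect_Lc defect_inj, of v] by (simp_all add: defect_apply)

lemma cinner_J: "cinner (J u) u' = cinner (J u) (J u') - cinner (Yf (J u)) (Yf (J u'))"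
proof -
  have "cinner (J u) u' = cinner (J u) (J u' - Ya (Yf (J u')))" by (simp only: J_right)
  then show ?thesis by (simp add: cinner_diff_right adj_right[OF YL])
qed

lemma cinner_J_herm: "cinner (J u) u' = cnj (cinner (J u') u)"
  by (simp add: cinner_J[of u u'] cinner_J[of u' u]) (metis cinner_cnj)

lemma P_eq: "P Y u = (norm (J u))\<^sup>2 - (norm (Yf (J u)))\<^sup>2"
  unfolding P_def by (subst cinner_J) (simp add: Re_cinner_self)

text \<open>With v = J u, the squared norm of u = v - adj Y Y v is |v|^2 - 2 |Y v|^2 + |adj Y Y
  v|^2, where the last term is at most |Y v|^2.\<close>

lemma P_ge: "(norm u)\<^sup>2 \<le> P Y u"
proof -
  have "norm (Ya (Yf (J u))) \<le> norm (Yf (J u))"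
    using norm_adj_apply[OF YL, of "Yf (J u)"] mult_right_mono[of "norm Y" 1 "norm (Yf (J u))"] Y1 by simp
  then have a: "(norm (Ya (Yf (J u))))\<^sup>2 \<le> (norm (Yf (J u)))\<^sup>2" by (intro power_mono) auto
  have "(norm u)\<^sup>2 = (norm (J u - Ya (Yf (J u))))\<^sup>2" by (simp only: J_right)
  also have "\<dots> = (norm (J u))\<^sup>2 - 2 * (norm (Yf (J u)))\<^sup>2 + (norm (Ya (Yf (J u))))\<^sup>2"
    by (simp add: norm_diff_sq adj_right[OF YL] Re_cinner_self)
  finally show ?thesis using a by (simp add: P_eq)
qed

lemma P_nonneg: "0 \<le> P Y u"
  using P_ge[of u] zero_le_power2 order_trans by blast

lemma P_le: "P Y u \<le> (norm u)\<^sup>2 / (1 - (norm Y)\<^sup>2)"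
proof -
  have "(1 - (norm Y)\<^sup>2) * norm (J u) \<le> norm (J u - Ya (Yf (J u)))"
    using norm_denominator_ge[OF YL, of Y "J u"] by (simp add: power2_eq_square)
  then have "(1 - (norm Y)\<^sup>2) * norm (J u) \<le> norm u" by (simp only: J_right)
  then have 1: "norm (J u) \<le> norm u / (1 - (norm Y)\<^sup>2)"
    using Y2 by (simp add: field_simps)
  have "P Y u \<le> norm (J u) * norm u"
    unfolding P_def using cinner_Cauchy_Schwarz complex_Re_le_cmod order_trans by blast
  also have "\<dots> \<le> norm u / (1 - (norm Y)\<^sup>2) * norm u" by (intro mult_right_mono 1) simp
  finally show ?thesis by (simp add: power2_eq_square)
qed

lemma P_add: "P Y (u + v) = P Y u + 2 * Re (cinner (J u) v) + P Y v"
  using cinner_J_herm[of v u]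
  by (simp add: P_def blinfun.add_right cinner_add_left cinner_add_right)

lemma P_cscale: "P Y (cscale c u) = (cmod c)\<^sup>2 * P Y u"
proof -
  have "cinner (J (cscale c u)) (cscale c u) = of_real ((cmod c)\<^sup>2) * cinner (J u) u"
    unfolding complex_norm_square by (simp add: LcD[OF J_Lc] cinner_cscale_left cinner_cscale_right mult_ac)
  then show ?thesis by (simp add: P_def)
qed

lemma P_scaleR: "P Y (r *\<^sub>R u) = r\<^sup>2 * P Y u"
  using P_cscale[of "of_real r" u] by (simp add: scaleR_cscale)

lemma P_minus: "P Y (- u) = P Y u"
  using P_scaleR[of "-1" u] by simp

text \<open>The identity behind the invariance of the ball under Moebius transformations.\<close>

lemma Q_diff:
  "Q Y (blinfun_apply X k - Yf k) = P Y (k - Ya (blinfun_apply X k)) - (norm k)\<^sup>2 + (norm (blinfun_apply X k))\<^sup>2"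
proof -
  let ?x = "blinfun_apply X k"
  define u where "u = k - Ya ?x"
  \<comment> \<open>After this splitting \<open>J\<close> meets \<open>k - Ya (Yf k)\<close>, on
    which it is the inverse of the defect, and disappears from the mixed and the last term.\<close>
  have "Ya (?x - Yf k) = - u + (k - Ya (Yf k))" by (simp add: u_def blinfun.diff_right)
  then have "P Y (Ya (?x - Yf k)) = P Y u - 2 * Re (cinner (J u) (k - Ya (Yf k))) + P Y (k - Ya (Yf k))"
    using P_add[of "- u" "k - Ya (Yf k)"] by (simp add: P_minus blinfun.minus_right cinner_minus_left)
  moreover have "cinner (J u) (k - Ya (Yf k)) = cinner u k"
    using cinner_J_herm[of u "k - Ya (Yf k)"] by (simp only: J_left) (metis cinner_cnj)
  moreover have "Re (cinner u k) = (norm k)\<^sup>2 - Re (cinner ?x (Yf k))"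
    by (simp add: u_def cinner_diff_left adj_left[OF YL] Re_cinner_self)
  moreover have "P Y (k - Ya (Yf k)) = (norm k)\<^sup>2 - (norm (Yf k))\<^sup>2"
    by (simp only: P_eq J_left)
  ultimately show ?thesis by (simp add: Q_def norm_diff_sq u_def[symmetric])
qed

lemma rel_iff_Q:
  "rel \<rho> X Y \<longleftrightarrow> (\<forall>k. Q Y (blinfun_apply X k - Yf k) \<le> \<rho>\<^sup>2 * P Y (k - Ya (blinfun_apply X k)))"
  unfolding rel_def Q_diff by (simp add: algebra_simps)

lemma Q_ge: "(norm h)\<^sup>2 \<le> Q Y h"
  using P_nonneg by (simp add: Q_def)

lemma Q_nonneg: "0 \<le> Q Y h"
  using Q_ge[of h] zero_le_power2 order_trans by blast

lemma Q_le: "Q Y h \<le> (norm h)\<^sup>2 / (1 - (norm Y)\<^sup>2)"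
proof -
  have "(norm (Ya h))\<^sup>2 \<le> (norm Y * norm h)\<^sup>2"
    by (intro power_mono norm_adj_apply YL) auto
  then have "P Y (Ya h) \<le> (norm Y * norm h)\<^sup>2 / (1 - (norm Y)\<^sup>2)"
    using P_le[of "Ya h"] Y2 by (meson diff_gt_0_iff_gt divide_right_mono less_imp_le order_trans)
  moreover have "(norm h)\<^sup>2 + (norm Y * norm h)\<^sup>2 / (1 - (norm Y)\<^sup>2) = (norm h)\<^sup>2 / (1 - (norm Y)\<^sup>2)"
    using Y2 by (simp add: field_simps power_mult_distrib)
  ultimately show ?thesis by (simp add: Q_def)
qed

lemma Q_cscale: "Q Y (cscale c h) = (cmod c)\<^sup>2 * Q Y h"
  by (simp add: Q_def LcD[OF adj_Lc[OF YL]] P_cscale norm_cscale power_mult_distrib distrib_left)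

text \<open>\<open>q\<close> is the sesquilinear form of 1 + Y (1 - adj Y Y)^-1 adj Y, the inverse
  of 1 - Y adj Y expressed through an inverse on the domain. The fact \<open>qb\<close> verifies
  this inverse relation, and Cauchy-Schwarz for \<open>q\<close> gives the second claim.\<close>

lemma Pd_eq_Q: "Pd Y b = Q Y (b - Yf (Ya b))"
  and cinner_sq_le: "(cmod (cinner x b))\<^sup>2 \<le> Q Y x * Pd Y b"
proof -
  define q where "q h h' = cinner h h' + cinner (J (Ya h)) (Ya h')" for h h' :: 'h
  have qQ: "Re (q h h) = Q Y h" for h by (simp add: q_def Q_def P_def Re_cinner_self)
  have qb: "q x (b - Yf (Ya b)) = cinner x b" for x b
  proof -
    have "cinner (J (Ya x)) (Ya (b - Yf (Ya b))) = cinner (J (Ya x)) (Ya b - Ya (Yf (Ya b)))"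
      by (simp add: blinfun.diff_right)
    also have "\<dots> = cinner (Ya x) (Ya b)"
      using cinner_J_herm[of "Ya x" "Ya b - Ya (Yf (Ya b))"] by (simp only: J_left) (metis cinner_cnj)
    also have "\<dots> = cinner x (Yf (Ya b))" by (simp add: adj_left[OF YL])
    finally show ?thesis by (simp add: q_def cinner_diff_right)
  qed
  show eq: "Pd Y b = Q Y (b - Yf (Ya b))"
    unfolding qQ[symmetric] qb
    by (simp add: Pd_def cinner_diff_left adj_right[OF YL, symmetric] Re_cinner_self)
  have "(cmod (q x (b - Yf (Ya b))))\<^sup>2 \<le> Re (q x x) * Re (q (b - Yf (Ya b)) (b - Yf (Ya b)))"
  proof (rule semi_inner_Cauchy_Schwarz)
    show "q (x + y) z = q x z + q y z" for x y z
      by (simp add: q_def blinfun.add_right cinner_add_left)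
    show "q (cscale c x) y = c * q x y" for c x y
      by (simp add: q_def LcD[OF adj_Lc[OF YL]] LcD[OF J_Lc] cinner_cscale_left distrib_left)
    show "q x y = cnj (q y x)" for x y
      using cinner_J_herm[of "Ya x" "Ya y"] cinner_cnj[of x y] by (simp add: q_def)
    show "0 \<le> Re (q x x)" for x by (simp add: qQ Q_nonneg)
  qed
  then show "(cmod (cinner x b))\<^sup>2 \<le> Q Y x * Pd Y b"
    unfolding qQ unfolding qb eq[symmetric] .
qed

lemma Pd_nonneg: "0 \<le> Pd Y b"
  by (simp add: Pd_eq_Q Q_nonneg)

text \<open>The square roots of \<open>Q Y\<close> and \<open>Pd Y\<close> are dual norms; this
  brings the quadratic condition into the matrix coefficient form of \<open>wball\<close>.\<close>

lemma Q_le_iff: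
  assumes "0 \<le> c"
  shows "Q Y x \<le> c\<^sup>2 \<longleftrightarrow> (\<forall>b. cmod (cinner x b) \<le> c * sqrt (Pd Y b))"
proof
  assume *: "Q Y x \<le> c\<^sup>2"
  show "\<forall>b. cmod (cinner x b) \<le> c * sqrt (Pd Y b)"
  proof
    fix b
    have "(cmod (cinner x b))\<^sup>2 \<le> c\<^sup>2 * Pd Y b"
      using cinner_sq_le[of x b] mult_right_mono[OF * Pd_nonneg] order_trans by blast
    then have "(cmod (cinner x b))\<^sup>2 \<le> (c * sqrt (Pd Y b))\<^sup>2"
      using Pd_nonneg by (simp add: power_mult_distrib)
    then show "cmod (cinner x b) \<le> c * sqrt (Pd Y b)"
      by (rule power2_le_imp_le) (simp add: assms Pd_nonneg)
  qed
next
  assume *: "\<forall>b. cmod (cinner x b) \<le> c * sqrt (Pd Y b)"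
  \<comment> \<open>\<open>b\<close> is the inverse of 1 - Y adj Y applied to \<open>x\<close>, the
    vector at which the dual norm is attained.\<close>
  define b where "b = x + Yf (J (Ya x))"
  have "Ya x + Ya (Yf (J (Ya x))) = J (Ya x)"
    using J_right[of "Ya x"] by (metis add.commute diff_eq_eq)
  then have "Ya b = J (Ya x)" by (simp add: b_def blinfun.add_right)
  then have Pd: "Pd Y b = Q Y x" by (simp add: Pd_eq_Q b_def)
  have "cinner (Ya x) (J (Ya x)) = cnj (cinner (J (Ya x)) (Ya x))" by (rule cinner_cnj)
  then have "Re (cinner x b) = Q Y x"
    by (simp add: b_def cinner_add_right adj_left[OF YL, symmetric] Q_def P_def Re_cinner_self)
  then have "Q Y x \<le> c * sqrt (Q Y x)"
    using *[rule_format, of b] complex_Re_le_cmod[of "cinner x b"] Pd by simp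
  then have "sqrt (Q Y x) * sqrt (Q Y x) \<le> c * sqrt (Q Y x)" using Q_nonneg[of x] by simp
  then have "sqrt (Q Y x) \<le> c"
  proof (cases "Q Y x = 0")
    case False
    then have "0 < sqrt (Q Y x)" using Q_nonneg[of x] by simp
    with \<open>sqrt (Q Y x) * sqrt (Q Y x) \<le> c * sqrt (Q Y x)\<close> show ?thesis
      by (rule mult_right_le_imp_le)
  qed (use assms in simp)
  then have "(sqrt (Q Y x))\<^sup>2 \<le> c\<^sup>2" using Q_nonneg[of x] by (intro power_mono) auto
  then show "Q Y x \<le> c\<^sup>2" using Q_nonneg[of x] by simp
qed

text \<open>With this weight, \<open>wball wt\<close> is the open unit ball of operators from the
  domain normed by \<open>P Y\<close> to the target normed by \<open>Q Y\<close>, the image of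
  \<open>Bop\<close> under \<open>Tm\<close>.\<close>

definition wt :: "'k \<Rightarrow> 'h \<Rightarrow> real" where
  "wt a b = sqrt (P Y a) * sqrt (Pd Y b)"

lemma wt_nonneg: "0 \<le> wt a b"
  by (simp add: wt_def P_nonneg Pd_nonneg)

lemma wt_iff:
  assumes "0 \<le> \<rho>"
  shows "(\<forall>b. cmod (cinner x b) \<le> \<rho> * wt a b) \<longleftrightarrow> Q Y x \<le> \<rho>\<^sup>2 * P Y a"
  using Q_le_iff[of "\<rho> * sqrt (P Y a)" x] assms P_nonneg[of a]
  by (simp add: wt_def power_mult_distrib mult.assoc)

lemma wball_iff:
  "T \<in> wball wt \<longleftrightarrow> T \<in> Lc \<and> (\<exists>\<rho>. 0 \<le> \<rho> \<and> \<rho> < 1 \<and> (\<forall>u. Q Y (blinfun_apply T u) \<le> \<rho>\<^sup>2 * P Y u))"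
proof -
  have "(\<forall>a b. cmod (cinner (blinfun_apply T a) b) \<le> \<rho> * wt a b) \<longleftrightarrow>
      (\<forall>u. Q Y (blinfun_apply T u) \<le> \<rho>\<^sup>2 * P Y u)" if "0 \<le> \<rho>" for \<rho>
    using wt_iff[OF that] by blast
  then show ?thesis unfolding wball_def by blast
qed

text \<open>Both \<open>P Y\<close> and \<open>Q Y\<close> lie between the squared norm and the
  squared norm divided by 1 - (norm Y)^2, which gives the two radii.\<close>

lemma operator_ball_wt: "operator_ball wt (sqrt (1 - (norm Y)\<^sup>2)) (1 / sqrt (1 - (norm Y)\<^sup>2))"
proof
  let ?d = "1 - (norm Y)\<^sup>2"
  have d: "0 < ?d" using Y2 by simp
  show "0 \<le> wt a b" for a b by (rule wt_nonneg)
  show "0 < sqrt ?d" "0 < 1 / sqrt ?d" using d by auto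
  fix T :: "'k \<Rightarrow>\<^sub>L 'h"
  show "T \<in> wball wt" if T: "T \<in> Lc" "norm T < sqrt ?d"
  proof -
    have "Q Y (blinfun_apply T u) \<le> (norm T / sqrt ?d)\<^sup>2 * P Y u" for u
    proof -
      have "Q Y (blinfun_apply T u) \<le> (norm (blinfun_apply T u))\<^sup>2 / ?d" by (rule Q_le)
      also have "\<dots> \<le> (norm T * norm u)\<^sup>2 / ?d"
        using d by (intro divide_right_mono power_mono norm_blinfun) auto
      also have "\<dots> = (norm T / sqrt ?d)\<^sup>2 * (norm u)\<^sup>2"
        using d by (simp add: power_mult_distrib power_divide)
      also have "\<dots> \<le> (norm T / sqrt ?d)\<^sup>2 * P Y u" by (intro mult_left_mono P_ge) simp
      finally show ?thesis .
    qed
    then show ?thesis unfolding wball_iff using T d by (auto intro!: exI[of _ "norm T / sqrt ?d"])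
  qed
  show "norm T \<le> 1 / sqrt ?d" if T: "T \<in> wball wt"
  proof (rule norm_blinfun_bound)
    fix u
    obtain \<rho> where r: "0 \<le> \<rho>" "\<rho> < 1" "Q Y (blinfun_apply T u) \<le> \<rho>\<^sup>2 * P Y u"
      using T unfolding wball_iff by blast
    have "(norm (blinfun_apply T u))\<^sup>2 \<le> \<rho>\<^sup>2 * P Y u" using Q_ge r(3) order_trans by blast
    also have "\<dots> \<le> 1 * P Y u"
      using r by (intro mult_right_mono P_nonneg) (simp add: abs_square_le_1)
    also have "\<dots> \<le> (norm u)\<^sup>2 / ?d" using P_le by simp
    also have "\<dots> = (1 / sqrt ?d * norm u)\<^sup>2" using d by (simp add: power_mult_distrib power_divide)
    finally show "norm (blinfun_apply T u) \<le> 1 / sqrt ?d * norm u"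
      by (rule power2_le_imp_le) (use d in simp)
  qed (use d in simp)
qed

definition Tm :: "('k \<Rightarrow>\<^sub>L 'h) \<Rightarrow> ('k \<Rightarrow>\<^sub>L 'h)" where
  "Tm = moebius (- Y) 0 (- adj Y) id_blinfun"

text \<open>The inverse of \<open>Tm\<close>, usually written (1 + T adj Y)^-1 (T + Y). The
  rearrangement moves the inverse from the target space to the finite-dimensional domain.\<close>

definition Sm :: "('k \<Rightarrow>\<^sub>L 'h) \<Rightarrow> ('k \<Rightarrow>\<^sub>L 'h)" where
  "Sm = moebius 0 Y (adj Y) (defect Y)"

lemma norm_YX:
  assumes "X \<in> Bop"
  shows "norm Y * norm X < 1"
  using mult_mono[of "norm Y" "norm Y" "norm X" 1] Bop_norm[OF assms] Y1 by auto

lemma Tm_inj: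
  assumes "X \<in> Bop" "k + blinfun_apply (- adj Y) (blinfun_apply X k) = 0"
  shows "k = 0"
  using denominator_inj[OF YL norm_YX[OF assms(1)]] assms(2) by (simp add: blinfun.minus_left)

lemma Tm_denominator:
  assumes "X \<in> Bop"
  shows "id_blinfun + (- adj Y o\<^sub>L X) \<in> Lc"
    and "blinfun_apply (id_blinfun + (- adj Y o\<^sub>L X)) k = 0 \<Longrightarrow> k = 0"
proof -
  show "id_blinfun + (- adj Y o\<^sub>L X) \<in> Lc"
    by (intro Lc_add Lc_id Lc_compose Lc_minus adj_Lc YL Bop_Lc assms)
  show "blinfun_apply (id_blinfun + (- adj Y o\<^sub>L X)) k = 0 \<Longrightarrow> k = 0"
    using Tm_inj[OF assms, of k] by (simp add: blinfun.add_left)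
qed

text \<open>A kernel vector satisfies P k = P (adj Y T k) <= Q (T k) <= \<rho>^2 P k with \<rho> <
  1, and \<open>P\<close> is definite.\<close>

lemma Sm_inj:
  assumes "T \<in> wball wt" "k + Ya (blinfun_apply T k) = 0"
  shows "k = 0"
proof -
  obtain \<rho> where r: "0 \<le> \<rho>" "\<rho> < 1" "Q Y (blinfun_apply T k) \<le> \<rho>\<^sup>2 * P Y k"
    using assms(1) unfolding wball_iff by blast
  have "k = - Ya (blinfun_apply T k)" using assms(2) by (rule eq_neg_iff_add_eq_0[THEN iffD2])
  then have "P Y k = P Y (Ya (blinfun_apply T k))" by (metis P_minus)
  also have "\<dots> \<le> Q Y (blinfun_apply T k)" by (simp add: Q_def)
  finally have "P Y k \<le> \<rho>\<^sup>2 * P Y k" using r by simp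
  have "\<rho>\<^sup>2 < 1" using r by (simp add: abs_square_less_1)
  then have "0 < 1 - \<rho>\<^sup>2" by simp
  moreover have "(1 - \<rho>\<^sup>2) * P Y k \<le> 0" using \<open>P Y k \<le> \<rho>\<^sup>2 * P Y k\<close> by (simp add: left_diff_distrib)
  ultimately have "P Y k \<le> 0" by (simp add: mult_le_0_iff)
  with P_ge[of k] have "(norm k)\<^sup>2 \<le> 0" by (rule order_trans)
  then show ?thesis by simp
qed

lemma hol_Tm: "hol Tm Bop"
  unfolding Tm_def
proof (rule hol_moebius)
  show "k = 0" if "X \<in> Bop" "k + blinfun_apply (- adj Y) (blinfun_apply X k) = 0" for X :: "'k \<Rightarrow>\<^sub>L 'h" and k
    using that by (rule Tm_inj)
qed (auto intro: Bop_Lc simp: YL)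

lemma hol_Sm: "hol Sm (wball wt)"
  unfolding Sm_def
proof (rule hol_moebius)
  show "k = 0" if "T \<in> wball wt" "k + Ya (blinfun_apply T k) = 0" for T k
    using that by (rule Sm_inj)
qed (auto intro: wball_Lc simp: YL defect_Lc)

text \<open>Vectors of this form exhaust the domain by \<open>surj_denominator\<close>, so
  identities for \<open>Tm\<close> can be checked on them without ever handling the inverse.\<close>

lemma Tm_apply:
  assumes X: "X \<in> Bop"
  shows "blinfun_apply (Tm X) (k - Ya (blinfun_apply X k)) = blinfun_apply X k - Yf k"
proof -
  have "blinfun_apply (binv (id_blinfun + (- adj Y o\<^sub>L X))) (blinfun_apply (id_blinfun + (- adj Y o\<^sub>L X)) k) = k"
    by (rule binv_left[OF Tm_denominator[OF X]])
  then show ?thesis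
    by (simp add: Tm_def moebius_def blinfun.add_left blinfun.minus_left blinfun.diff_left)
qed

lemma surj_denominator:
  assumes X: "X \<in> Bop"
  shows "\<exists>k. u = k - Ya (blinfun_apply X k)"
proof -
  have "blinfun_apply (id_blinfun + (- adj Y o\<^sub>L X)) (blinfun_apply (binv (id_blinfun + (- adj Y o\<^sub>L X))) u) = u"
    by (rule binv_right[OF Tm_denominator[OF X]])
  then show ?thesis
    by (intro exI[of _ "blinfun_apply (binv (id_blinfun + (- adj Y o\<^sub>L X))) u"])
       (simp add: blinfun.add_left blinfun.minus_left)
qed

lemma rel_iff_Tm:
  assumes X: "X \<in> Bop"
  shows "rel \<rho> X Y \<longleftrightarrow> (\<forall>u. Q Y (blinfun_apply (Tm X) u) \<le> \<rho>\<^sup>2 * P Y u)"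
  unfolding rel_iff_Q using Tm_apply[OF X] surj_denominator[OF X] by metis

lemma Tm_Lc:
  assumes X: "X \<in> Bop"
  shows "Tm X \<in> Lc"
  unfolding Tm_def moebius_def
  by (intro Lc_add Lc_compose Lc_minus Lc_0 Lc_id binv_Lc[OF Tm_denominator[OF X]] Bop_Lc[OF X] YL)

lemma Tm_Y: "Tm Y = 0"
  by (rule blinfun_eqI) (simp add: Tm_def moebius_def)

lemma binv_Sm:
  assumes T: "T \<in> wball wt"
  shows "blinfun_apply (binv (id_blinfun + (adj Y o\<^sub>L T))) (u + Ya (blinfun_apply T u)) = u"
    and "(let m = blinfun_apply (binv (id_blinfun + (adj Y o\<^sub>L T))) v in m + Ya (blinfun_apply T m)) = v"
    and "binv (id_blinfun + (adj Y o\<^sub>L T)) \<in> Lc"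
proof -
  have *: "id_blinfun + (adj Y o\<^sub>L T) \<in> Lc" "\<And>k. blinfun_apply (id_blinfun + (adj Y o\<^sub>L T)) k = 0 \<Longrightarrow> k = 0"
  proof -
    show "id_blinfun + (adj Y o\<^sub>L T) \<in> Lc"
      by (intro Lc_add Lc_id Lc_compose adj_Lc YL wball_Lc[OF T])
    show "blinfun_apply (id_blinfun + (adj Y o\<^sub>L T)) k = 0 \<Longrightarrow> k = 0" for k
      using Sm_inj[OF T, of k] by (simp add: blinfun.add_left)
  qed
  show "blinfun_apply (binv (id_blinfun + (adj Y o\<^sub>L T))) (u + Ya (blinfun_apply T u)) = u"
    using binv_left[OF *, of u] by (simp add: blinfun.add_left)
  show "(let m = blinfun_apply (binv (id_blinfun + (adj Y o\<^sub>L T))) v in m + Ya (blinfun_apply T m)) = v"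
    using binv_right[OF *, of v] by (simp add: blinfun.add_left Let_def)
  show "binv (id_blinfun + (adj Y o\<^sub>L T)) \<in> Lc" by (rule binv_Lc[OF *])
qed

lemma Sm_apply:
  "blinfun_apply (Sm T) k = Yf k + blinfun_apply T (blinfun_apply (binv (id_blinfun + (adj Y o\<^sub>L T))) (k - Ya (Yf k)))"
  by (simp add: Sm_def moebius_def blinfun.add_left defect_apply)

text \<open>With m = k - adj Y (Sm T) k, the identity \<open>Q_diff\<close> bounds the squared norm
  of (Sm T) k by |k|^2 - (1 - \<rho>^2) P m. For norm (Sm T) < 1 a loss proportional to |k|^2 is
  needed.\<close>

lemma Sm_Bop:
  assumes T: "T \<in> wball wt"
  shows "Sm T \<in> Bop"
proof -
  have TL: "T \<in> Lc" using T by (rule wball_Lc)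
  define V where "V = binv (id_blinfun + (adj Y o\<^sub>L T))"
  have VL: "V \<in> Lc" using binv_Sm(3)[OF T] by (simp add: V_def)
  have L: "Sm T \<in> Lc"
    unfolding Sm_def moebius_def V_def[symmetric]
    using YL TL VL defect_Lc by auto
  obtain \<rho> where r: "0 \<le> \<rho>" "\<rho> < 1" "\<And>u. Q Y (blinfun_apply T u) \<le> \<rho>\<^sup>2 * P Y u"
    using T unfolding wball_iff by blast
  have rr: "\<rho>\<^sup>2 < 1" using r by (simp add: abs_square_less_1)
  \<comment> \<open>\<open>F\<close> recovers \<open>k\<close> from \<open>m\<close>, hence |k| <= K
    |m|. The summand 1 in \<open>K\<close> ensures K >= 1, so that \<open>c\<close> below is
    nonnegative.\<close>
  define F where "F = binv (defect Y) o\<^sub>L (id_blinfun + (adj Y o\<^sub>L T))"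
  define K where "K = norm F + 1"
  have K: "1 \<le> K" by (simp add: K_def)
  have main: "(norm (blinfun_apply (Sm T) k))\<^sup>2 \<le> (1 - (1 - \<rho>\<^sup>2) / K\<^sup>2) * (norm k)\<^sup>2" for k
  proof -
    define m where "m = blinfun_apply V (k - Ya (Yf k))"
    have Em: "m + Ya (blinfun_apply T m) = k - Ya (Yf k)"
      using binv_Sm(2)[OF T, of "k - Ya (Yf k)"] by (simp add: m_def V_def Let_def)
    have Sk: "blinfun_apply (Sm T) k = Yf k + blinfun_apply T m"
      by (simp add: Sm_apply m_def V_def)
    have um: "k - Ya (blinfun_apply (Sm T) k) = m"
      using Em by (simp add: Sk blinfun.add_right algebra_simps)
    have "Q Y (blinfun_apply T m) = P Y m - (norm k)\<^sup>2 + (norm (blinfun_apply (Sm T) k))\<^sup>2"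
      using Q_diff[of "Sm T" k] um Sk by simp
    then have "(norm (blinfun_apply (Sm T) k))\<^sup>2 \<le> (norm k)\<^sup>2 - (1 - \<rho>\<^sup>2) * P Y m"
      using r(3)[of m] by (simp add: algebra_simps)
    moreover have "(1 - \<rho>\<^sup>2) * ((norm k)\<^sup>2 / K\<^sup>2) \<le> (1 - \<rho>\<^sup>2) * P Y m"
    proof (rule mult_left_mono)
      have "k = blinfun_apply F m"
        using Em J_left[of k] by (simp add: F_def blinfun.add_left)
      then have "norm k \<le> norm F * norm m" using norm_blinfun by metis
      also have "\<dots> \<le> K * norm m" by (simp add: K_def mult_right_mono)
      finally have "norm k / K \<le> norm m" using K by (simp add: divide_le_eq mult.commute)
      then have "(norm k / K)\<^sup>2 \<le> (norm m)\<^sup>2" using K by (intro power_mono) auto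
      then show "(norm k)\<^sup>2 / K\<^sup>2 \<le> P Y m" using P_ge[of m] by (simp add: power_divide)
    qed (use rr in simp)
    ultimately show ?thesis by (simp add: algebra_simps)
  qed
  define c where "c = 1 - (1 - \<rho>\<^sup>2) / K\<^sup>2"
  have "(1 - \<rho>\<^sup>2) / K\<^sup>2 \<le> 1"
  proof -
    have "1 - \<rho>\<^sup>2 \<le> 1" by simp
    also have "1 \<le> K\<^sup>2" using K by (rule one_le_power)
    finally have "1 - \<rho>\<^sup>2 \<le> K\<^sup>2" .
    then show ?thesis using K by (simp add: divide_le_eq_1)
  qed
  moreover have "0 < (1 - \<rho>\<^sup>2) / K\<^sup>2" using K rr by simp
  ultimately have c: "0 \<le> c" "c < 1" by (auto simp: c_def)
  have "norm (Sm T) \<le> sqrt c"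
  proof (rule norm_blinfun_bound)
    fix k
    have "(norm (blinfun_apply (Sm T) k))\<^sup>2 \<le> (sqrt c * norm k)\<^sup>2"
      using main[of k] c by (simp add: c_def power_mult_distrib)
    then show "norm (blinfun_apply (Sm T) k) \<le> sqrt c * norm k"
      by (rule power2_le_imp_le) (use c in simp)
  qed (use c in simp)
  also have "sqrt c < 1" using c by simp
  finally show ?thesis using L by (simp add: Bop_def)
qed

lemma Tm_Sm:
  assumes T: "T \<in> wball wt"
  shows "Tm (Sm T) = T"
proof (rule blinfun_eqI)
  fix u
  obtain k where k: "u = k - Ya (blinfun_apply (Sm T) k)" using surj_denominator[OF Sm_Bop[OF T]] by blast
  define m where "m = blinfun_apply (binv (id_blinfun + (adj Y o\<^sub>L T))) (k - Ya (Yf k))"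
  have Em: "m + Ya (blinfun_apply T m) = k - Ya (Yf k)"
    using binv_Sm(2)[OF T, of "k - Ya (Yf k)"] by (simp add: m_def Let_def)
  have Sk: "blinfun_apply (Sm T) k = Yf k + blinfun_apply T m" by (simp add: Sm_apply m_def)
  have "u = m" using Em by (simp add: k Sk blinfun.add_right algebra_simps)
  then show "blinfun_apply (Tm (Sm T)) u = blinfun_apply T u"
    using Tm_apply[OF Sm_Bop[OF T], of k] k Sk by simp
qed

text \<open>Here |Xk|^2 <= s^2 |k|^2, and \<open>P\<close> of the denominator is at most 4 |k|^2 /
  (1 - s^2); the radius is the one for which the two bounds add up to |k|^2. It depends on
  \<open>s\<close> alone, as required for whole orbits.\<close>

lemma rel_uniform:
  fixes X :: "'k \<Rightarrow>\<^sub>L 'h"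
  assumes s: "s < 1" "norm X \<le> s" "norm Y \<le> s"
  shows "rel (sqrt (1 - (1 - s\<^sup>2)\<^sup>2 / 4)) X Y"
  unfolding rel_def
proof
  fix k
  let ?u = "k - Ya (blinfun_apply X k)"
  have s0: "0 \<le> s" using s norm_ge_zero order_trans by blast
  have s2: "s\<^sup>2 < 1" using s s0 by (simp add: abs_square_less_1)
  have "norm ?u \<le> norm k + norm Y * norm X * norm k"
    using norm_triangle_ineq4[of k "Ya (blinfun_apply X k)"] norm_adj_comp_le[OF YL, of X k] by linarith
  also have "norm Y * norm X * norm k \<le> 1 * 1 * norm k"
    using s s0 by (intro mult_right_mono mult_mono) auto
  finally have "norm ?u \<le> 2 * norm k" by simp
  then have "(norm ?u)\<^sup>2 \<le> (2 * norm k)\<^sup>2" by (intro power_mono) auto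
  moreover have "1 - s\<^sup>2 \<le> 1 - (norm Y)\<^sup>2" using s by (simp add: power_mono)
  ultimately have "(norm ?u)\<^sup>2 / (1 - (norm Y)\<^sup>2) \<le> (2 * norm k)\<^sup>2 / (1 - s\<^sup>2)"
    using s2 by (intro frac_le) auto
  then have Pb: "P Y ?u \<le> 4 * (norm k)\<^sup>2 / (1 - s\<^sup>2)" using P_le[of ?u] by (simp add: power_mult_distrib)
  have d: "(1 - s\<^sup>2)\<^sup>2 / 4 \<le> 1"
    using s2 power_mono[of "1 - s\<^sup>2" 1 2] by simp
  have "(norm (blinfun_apply X k))\<^sup>2 \<le> (s * norm k)\<^sup>2"
    using norm_blinfun[of X k] mult_right_mono[OF s(2), of "norm k"] by (intro power_mono) auto
  moreover have "(1 - (sqrt (1 - (1 - s\<^sup>2)\<^sup>2 / 4))\<^sup>2) * P Y ?u \<le> (1 - s\<^sup>2) * (norm k)\<^sup>2"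
  proof -
    have "(1 - (sqrt (1 - (1 - s\<^sup>2)\<^sup>2 / 4))\<^sup>2) * P Y ?u = (1 - s\<^sup>2)\<^sup>2 / 4 * P Y ?u"
      using d by simp
    also have "\<dots> \<le> (1 - s\<^sup>2)\<^sup>2 / 4 * (4 * (norm k)\<^sup>2 / (1 - s\<^sup>2))"
      by (intro mult_left_mono Pb) simp
    also have "\<dots> = (1 - s\<^sup>2) * (norm k)\<^sup>2" using s2 by (simp add: power2_eq_square)
    finally show ?thesis .
  qed
  ultimately show "(norm (blinfun_apply X k))\<^sup>2 +
      (1 - (sqrt (1 - (1 - s\<^sup>2)\<^sup>2 / 4))\<^sup>2) * P Y ?u \<le> (norm k)\<^sup>2"
    by (simp add: power_mult_distrib algebra_simps)
qed

lemma rel_exists: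
  fixes X :: "'k \<Rightarrow>\<^sub>L 'h"
  assumes "s < 1" "norm X \<le> s" "norm Y \<le> s"
  shows "\<exists>t. 0 < t \<and> t < 1 \<and> rel t X Y"
proof (intro exI conjI)
  have "0 \<le> s" using assms norm_ge_zero order_trans by blast
  then have "0 < (1 - s\<^sup>2)\<^sup>2" "(1 - s\<^sup>2)\<^sup>2 \<le> 1"
    using assms(1) power_mono[of "1 - s\<^sup>2" 1 2] by (auto simp: abs_square_less_1 abs_square_eq_1 abs_square_le_1)
  then show "0 < sqrt (1 - (1 - s\<^sup>2)\<^sup>2 / 4)" "sqrt (1 - (1 - s\<^sup>2)\<^sup>2 / 4) < 1" by auto
qed (rule rel_uniform[OF assms])

lemma Tm_wball:
  assumes X: "X \<in> Bop"
  shows "Tm X \<in> wball wt"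
proof -
  obtain t where "0 < t" "t < 1" "rel t X Y"
    using rel_exists[of "max (norm X) (norm Y)" X] Bop_norm[OF X] Y1 by auto
  then show ?thesis
    using rel_iff_Tm[OF X, of t] Tm_Lc[OF X] unfolding wball_iff by (auto intro!: exI[of _ t])
qed

lemma Sm_Tm:
  assumes X: "X \<in> Bop"
  shows "Sm (Tm X) = X"
proof (rule blinfun_eqI)
  fix k
  let ?u = "k - Ya (blinfun_apply X k)"
  have "?u + Ya (blinfun_apply (Tm X) ?u) = k - Ya (Yf k)"
    unfolding Tm_apply[OF X] by (simp add: blinfun.diff_right)
  then have "blinfun_apply (binv (id_blinfun + (adj Y o\<^sub>L Tm X))) (k - Ya (Yf k)) = ?u"
    using binv_Sm(1)[OF Tm_wball[OF X], of ?u] by (simp only:)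
  then show "blinfun_apply (Sm (Tm X)) k = blinfun_apply X k"
    by (simp add: Sm_apply Tm_apply[OF X])
qed

lemma Sm_0: "Sm 0 = Y"
  using Sm_Tm[OF Y] Tm_Y by simp

lemma Tm_Lipschitz: "\<exists>K>0. \<forall>X\<in>Bop. \<forall>X'\<in>Bop. norm (Tm X - Tm X') \<le> K * norm (X - X')"
  unfolding Tm_def
proof (rule Lipschitz_moebius)
  show "norm (binv (id_blinfun + (- adj Y o\<^sub>L X))) \<le> 1 / (1 - norm Y)" if X: "X \<in> Bop" for X
  proof (rule norm_blinfun_bound)
    fix u
    let ?V = "binv (id_blinfun + (- adj Y o\<^sub>L X))"
    obtain k where k: "u = k - Ya (blinfun_apply X k)" using surj_denominator[OF X] by blast
    have "blinfun_apply ?V (blinfun_apply (id_blinfun + (- adj Y o\<^sub>L X)) k) = k"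
      by (rule binv_left[OF Tm_denominator[OF X]])
    then have "blinfun_apply ?V u = k" by (simp add: k blinfun.add_left blinfun.minus_left)
    moreover have "(1 - norm Y) * norm k \<le> (1 - norm Y * norm X) * norm k"
      using mult_left_mono[of "norm X" 1 "norm Y"] Bop_norm[OF X] by (intro mult_right_mono) auto
    then have "(1 - norm Y) * norm k \<le> norm u"
      using norm_denominator_ge[OF YL, of X k] k by simp
    ultimately show "norm (blinfun_apply ?V u) \<le> 1 / (1 - norm Y) * norm u"
      using Y1 by (simp add: field_simps)
  qed (use Y1 in simp)
  show "norm X \<le> 1" if "X \<in> Bop" for X :: "'k \<Rightarrow>\<^sub>L 'h" using Bop_norm[OF that] by simp
  show "k = 0" if "X \<in> Bop" "k + blinfun_apply (- adj Y) (blinfun_apply X k) = 0" for X :: "'k \<Rightarrow>\<^sub>L 'h" and k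
    using that by (rule Tm_inj)
qed (auto intro: Bop_Lc simp: YL)

text \<open>For X = Sm T the operator (1 + adj Y T)^-1 (1 - adj Y Y) equals 1 - adj Y X, whose norm
  is at most 2; this bounds the inverted denominator.\<close>

lemma Sm_Lipschitz: "\<exists>K>0. \<forall>T\<in>wball wt. \<forall>T'\<in>wball wt. norm (Sm T - Sm T') \<le> K * norm (T - T')"
  unfolding Sm_def
proof (rule Lipschitz_moebius)
  interpret operator_ball wt "sqrt (1 - (norm Y)\<^sup>2)" "1 / sqrt (1 - (norm Y)\<^sup>2)"
    by (rule operator_ball_wt)
  show "norm T \<le> 1 / sqrt (1 - (norm Y)\<^sup>2)" if "T \<in> wball wt" for T using outer[OF that] .
  show "norm (binv (id_blinfun + (adj Y o\<^sub>L T))) \<le> 2 * norm (binv (defect Y))" if T: "T \<in> wball wt" for T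
  proof (rule norm_blinfun_bound)
    fix v
    let ?V = "binv (id_blinfun + (adj Y o\<^sub>L T))" and ?X = "Sm T" and ?k = "J v"
    have X: "?X \<in> Bop" by (rule Sm_Bop[OF T])
    have "(?k - Ya (blinfun_apply ?X ?k)) + Ya (blinfun_apply T (?k - Ya (blinfun_apply ?X ?k))) = v"
      using Tm_apply[OF X, of ?k] J_right[of v] by (simp add: Tm_Sm[OF T] blinfun.diff_right)
    then have "blinfun_apply ?V v = ?k - Ya (blinfun_apply ?X ?k)"
      using binv_Sm(1)[OF T, of "?k - Ya (blinfun_apply ?X ?k)"] by simp
    then have "norm (blinfun_apply ?V v) = norm (?k - Ya (blinfun_apply ?X ?k))" by (rule arg_cong)
    then have "norm (blinfun_apply ?V v) \<le> norm ?k + norm Y * norm ?X * norm ?k"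
      using norm_triangle_ineq4[of ?k "Ya (blinfun_apply ?X ?k)"] norm_adj_comp_le[OF YL, of ?X ?k] by linarith
    also have "\<dots> \<le> norm ?k + 1 * norm ?k"
      using norm_YX[OF X] by (intro add_left_mono mult_right_mono) auto
    also have "\<dots> \<le> 2 * (norm (binv (defect Y)) * norm v)" using norm_blinfun[of "binv (defect Y)" v] by simp
    finally show "norm (blinfun_apply ?V v) \<le> 2 * norm (binv (defect Y)) * norm v" by simp
  qed simp
  show "k = 0" if "T \<in> wball wt" "k + Ya (blinfun_apply T k) = 0" for T k
    using that by (rule Sm_inj)
qed (auto intro: wball_Lc simp: YL defect_Lc)

end

text \<open>In centred coordinates \<open>X\<close> becomes an operator \<open>T\<close> of weighted
  norm at most \<rho>, so the curve z T stays in the ball for |z| < 1 / \<rho>. Its image, centred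
  at \<open>g Y\<close>, vanishes at 0, and the Schwarz lemma at z = 1 returns the factor
  \<rho>.\<close>

theorem Schwarz_Pick:
  fixes g :: "('k \<Rightarrow>\<^sub>L 'h::cinner_space) \<Rightarrow> ('k \<Rightarrow>\<^sub>L 'h)"
  assumes g: "hol g Bop" "g ` Bop \<subseteq> Bop" and X: "X \<in> Bop" and Y: "Y \<in> Bop"
    and \<rho>: "0 < \<rho>" "\<rho> < 1" and rel: "rel \<rho> X Y"
  shows "rel \<rho> (g X) (g Y)"
proof -
  have gX: "g X \<in> Bop" and gY: "g Y \<in> Bop" using g X Y by auto
  define T where "T = Tm Y X"
  have TL: "T \<in> Lc" unfolding T_def by (rule Tm_Lc[OF Y X])
  have TQ: "Q Y (blinfun_apply T u) \<le> \<rho>\<^sup>2 * P Y u" for u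
    using rel rel_iff_Tm[OF Y X] by (simp add: T_def)
  have zT: "opscale z T \<in> wball (wt Y)" if z: "cmod z < 1 / \<rho>" for z
  proof -
    have "Q Y (blinfun_apply (opscale z T) u) \<le> (cmod z * \<rho>)\<^sup>2 * P Y u" for u
      using mult_left_mono[OF TQ[of u], of "(cmod z)\<^sup>2"]
      by (simp add: Q_cscale[OF Y] power_mult_distrib mult.assoc)
    moreover have "cmod z * \<rho> < 1" using z \<rho> by (simp add: pos_less_divide_eq)
    ultimately show ?thesis
      unfolding wball_iff[OF Y] using TL \<rho> by (auto intro!: exI[of _ "cmod z * \<rho>"])
  qed
  define c where "c z = Tm (g Y) (g (Sm Y (opscale z T)))" for z
  have 1: "ccurve (\<lambda>z. Sm Y (opscale z T)) (ball 0 (1 / \<rho>))"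
    by (rule hol_ccurve[OF ccurve_linear[OF TL] hol_Sm[OF Y]]) (use zT in auto)
  have 2: "ccurve (\<lambda>z. g (Sm Y (opscale z T))) (ball 0 (1 / \<rho>))"
    by (rule hol_ccurve[OF 1 g(1)]) (use zT Sm_Bop[OF Y] in auto)
  have in_B: "g (Sm Y (opscale z T)) \<in> Bop" if "cmod z < 1 / \<rho>" for z
    using zT[OF that] Sm_Bop[OF Y] g(2) by blast
  have 3: "ccurve c (ball 0 (1 / \<rho>))"
    unfolding c_def by (rule hol_ccurve[OF 2 hol_Tm[OF gY]]) (use in_B in auto)
  have c0: "c 0 = 0" by (simp add: c_def Sm_0[OF Y] Tm_Y[OF gY])
  have c1: "c 1 = Tm (g Y) (g X)" by (simp add: c_def T_def Sm_Tm[OF Y X])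
  have "cmod (cinner (blinfun_apply (c 1) a) b) \<le> (cmod 1 / (1 / \<rho>)) * wt (g Y) a b" for a b
    by (rule wball_Schwarz[OF 3 _ _ c0 wt_nonneg[OF gY]])
       (use \<rho> in_B Tm_wball[OF gY] in \<open>auto simp: c_def\<close>)
  then have "\<forall>b. cmod (cinner (blinfun_apply (c 1) a) b) \<le> \<rho> * wt (g Y) a b" for a
    by simp
  then have "Q (g Y) (blinfun_apply (c 1) a) \<le> \<rho>\<^sup>2 * P (g Y) a" for a
    using wt_iff[OF gY, of \<rho> "blinfun_apply (c 1) a" a] \<rho> by simp
  then show ?thesis unfolding rel_iff_Tm[OF gY gX] c1[symmetric] by blast
qed

end

section \<open>Uniform normal structure\<close>

lemma bounded_bilinear_cinner: "bounded_bilinear (cinner :: 'a::cinner_space \<Rightarrow> 'a \<Rightarrow> complex)"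
proof
  show "\<exists>K. \<forall>a b. norm (cinner (a::'a) b) \<le> norm a * norm b * K"
    using cinner_Cauchy_Schwarz by (intro exI[of _ 1]) auto
qed (simp_all add: cinner_add_left cinner_add_right scaleR_cscale cinner_cscale_left
    cinner_cscale_right scaleR_conv_of_real)

lemma midpoint_sq:
  "(norm ((1/2) *\<^sub>R (a + b)))\<^sup>2 = (norm a)\<^sup>2 / 2 + (norm b)\<^sup>2 / 2 - (norm (a - b :: 'a::cinner_space))\<^sup>2 / 4"
  unfolding norm_scaleR power_mult_distrib norm_add_sq norm_diff_sq by (simp add: power_divide field_simps)

context fin_dim
begin

text \<open>The left side of \<open>rel\<close> at a single vector \<open>k\<close>, isolated
  because normal structure needs its quantitative convexity in \<open>X\<close>.\<close>

definition FY :: "('k \<Rightarrow>\<^sub>L 'h::cinner_space) \<Rightarrow> real \<Rightarrow> 'k \<Rightarrow> ('k \<Rightarrow>\<^sub>L 'h) \<Rightarrow> real" where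
  "FY Y \<rho> k X = (norm (blinfun_apply X k))\<^sup>2 +
     (1 - \<rho>\<^sup>2) * P Y (k - blinfun_apply (adj Y) (blinfun_apply X k))"

lemma rel_iff_FY: "rel \<rho> X Y \<longleftrightarrow> (\<forall>k. FY Y \<rho> k X \<le> (norm k)\<^sup>2)"
  by (simp add: rel_def FY_def)

context
  fixes Y :: "'k \<Rightarrow>\<^sub>L 'h::cinner_space"
  assumes Y: "Y \<in> Bop"
begin

section \<open>Convexity and closedness of pseudo-hyperbolic balls\<close>

lemma P_midpoint: "P Y ((1/2) *\<^sub>R (u + v)) \<le> P Y u / 2 + P Y v / 2"
proof -
  have "P Y ((1/2) *\<^sub>R (u + v)) = P Y (u + v) / 4"
    by (simp add: P_scaleR[OF Y] power_divide)
  moreover have "P Y (u + v) + P Y (u - v) = 2 * P Y u + 2 * P Y v"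
    using P_add[OF Y, of u v] P_add[OF Y, of u "- v"] cinner_cscale_right[of _ "-1" v]
    by (simp add: P_minus[OF Y] cinner_diff_right[of _ 0 v, simplified])
  ultimately show ?thesis using P_nonneg[OF Y, of "u - v"] by simp
qed

text \<open>The gain comes from the parallelogram law for the term with \<open>X k\<close>; of the
  \<open>P\<close> term only convexity is used.\<close>

lemma FY_midpoint:
  assumes "0 \<le> \<rho>" "\<rho> \<le> 1"
  shows "FY Y \<rho> k ((1/2) *\<^sub>R (X + X')) \<le> FY Y \<rho> k X / 2 + FY Y \<rho> k X' / 2
    - (norm (blinfun_apply (X - X') k))\<^sup>2 / 4"
proof -
  let ?u = "\<lambda>X. k - blinfun_apply (adj Y) (blinfun_apply X k)"
  have u: "?u ((1/2) *\<^sub>R (X + X')) = (1/2) *\<^sub>R (?u X + ?u X')"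
  proof -
    have "(1/2) *\<^sub>R k + (1/2) *\<^sub>R k = k" by (simp flip: scaleR_add_left)
    then show ?thesis
      by (simp add: blinfun.scaleR_left blinfun.scaleR_right blinfun.add_left blinfun.add_right
          scaleR_add_right scaleR_diff_right algebra_simps)
  qed
  have "\<rho>\<^sup>2 \<le> 1" using assms by (simp add: abs_square_le_1)
  then have "(1 - \<rho>\<^sup>2) * P Y (?u ((1/2) *\<^sub>R (X + X'))) \<le> (1 - \<rho>\<^sup>2) * (P Y (?u X) / 2 + P Y (?u X') / 2)"
    unfolding u by (intro mult_left_mono P_midpoint) simp
  moreover have "(norm (blinfun_apply ((1/2) *\<^sub>R (X + X')) k))\<^sup>2 =
      (norm (blinfun_apply X k))\<^sup>2 / 2 + (norm (blinfun_apply X' k))\<^sup>2 / 2 - (norm (blinfun_apply (X - X') k))\<^sup>2 / 4"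
    using midpoint_sq[of "blinfun_apply X k" "blinfun_apply X' k"]
    by (simp add: blinfun.scaleR_left blinfun.add_left blinfun.diff_left)
  ultimately show ?thesis by (simp add: FY_def distrib_left add_divide_distrib)
qed

lemma rel_midpoint:
  assumes "0 \<le> \<rho>" "\<rho> \<le> 1" "rel \<rho> X Y" "rel \<rho> X' Y"
  shows "rel \<rho> ((1/2) *\<^sub>R (X + X')) Y"
  unfolding rel_iff_FY
proof
  fix k
  have "FY Y \<rho> k X \<le> (norm k)\<^sup>2" "FY Y \<rho> k X' \<le> (norm k)\<^sup>2"
    using assms(3,4) by (auto simp: rel_iff_FY)
  then show "FY Y \<rho> k ((1/2) *\<^sub>R (X + X')) \<le> (norm k)\<^sup>2"
    using FY_midpoint[OF assms(1,2), of k X X'] zero_le_power2[of "norm (blinfun_apply (X - X') k)"]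
    by linarith
qed

lemma rel_limit:
  assumes X: "X \<longlonglongrightarrow> L" and rel: "\<And>n. rel \<rho> (X n) Y"
  shows "rel \<rho> L Y"
  unfolding rel_iff_FY
proof
  fix k
  have a: "(\<lambda>n. blinfun_apply (X n) k) \<longlonglongrightarrow> blinfun_apply L k"
    by (rule bounded_linear.tendsto[OF blinfun.bounded_linear_left X])
  have u: "(\<lambda>n. k - blinfun_apply (adj Y) (blinfun_apply (X n) k)) \<longlonglongrightarrow> k - blinfun_apply (adj Y) (blinfun_apply L k)"
    by (intro tendsto_intros bounded_linear.tendsto[OF blinfun.bounded_linear_right] a)
  have "(\<lambda>n. FY Y \<rho> k (X n)) \<longlonglongrightarrow> FY Y \<rho> k L"
    unfolding FY_def P_def
    by (intro tendsto_intros bounded_bilinear.tendsto[OF bounded_bilinear_cinner]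
        bounded_linear.tendsto[OF blinfun.bounded_linear_right] a u)
  then show "FY Y \<rho> k L \<le> (norm k)\<^sup>2"
    by (rule LIMSEQ_le_const2) (use rel in \<open>auto simp: rel_iff_FY\<close>)
qed

section \<open>Comparison of the pseudo-hyperbolic relation with the operator norm\<close>

lemma norm_denominator_le:
  assumes "norm X \<le> 1"
  shows "norm (k - blinfun_apply (adj Y) (blinfun_apply X k)) \<le> 2 * norm k"
proof -
  have "norm Y * norm X * norm k \<le> 1 * 1 * norm k"
    using assms Bop_norm[OF Y] by (intro mult_right_mono mult_mono) auto
  then show ?thesis
    using norm_triangle_ineq4[of k "blinfun_apply (adj Y) (blinfun_apply X k)"]
      norm_adj_comp_le[OF Bop_Lc[OF Y], of X k] by simp
qed

lemma P_denominator_le: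
  assumes "norm X \<le> 1" "norm Y \<le> r" "r < 1"
  shows "P Y (k - blinfun_apply (adj Y) (blinfun_apply X k)) \<le> 4 / (1 - r\<^sup>2) * (norm k)\<^sup>2"
proof -
  let ?u = "k - blinfun_apply (adj Y) (blinfun_apply X k)"
  have r0: "0 \<le> r" using assms(2) norm_ge_zero order_trans by blast
  have r2: "r\<^sup>2 < 1" using r0 assms by (simp add: abs_square_less_1)
  have "(norm ?u)\<^sup>2 \<le> (2 * norm k)\<^sup>2" by (intro power_mono norm_denominator_le assms) simp
  moreover have "(norm Y)\<^sup>2 \<le> r\<^sup>2" using assms by (intro power_mono) auto
  ultimately have "(norm ?u)\<^sup>2 / (1 - (norm Y)\<^sup>2) \<le> (2 * norm k)\<^sup>2 / (1 - r\<^sup>2)"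
    using r2 by (intro frac_le) auto
  then show ?thesis using P_le[OF Y, of ?u] by (simp add: power_mult_distrib)
qed

lemma rel_dist:
  assumes "rel \<rho> X Y" "0 \<le> \<rho>" "norm X \<le> 1" "norm Y \<le> r" "r < 1"
  shows "norm (X - Y) \<le> 2 / (1 - r\<^sup>2) * \<rho>"
proof (rule norm_blinfun_bound)
  have r0: "0 \<le> r" using assms(4) norm_ge_zero order_trans by blast
  then have r2: "0 < 1 - r\<^sup>2" "1 - r\<^sup>2 \<le> 1" using assms by (auto simp: abs_square_less_1)
  show "0 \<le> 2 / (1 - r\<^sup>2) * \<rho>" using r2 assms by simp
  fix k
  let ?u = "k - blinfun_apply (adj Y) (blinfun_apply X k)"
  have "(norm (blinfun_apply (X - Y) k))\<^sup>2 \<le> Q Y (blinfun_apply X k - blinfun_apply Y k)"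
    using Q_ge[OF Y] by (simp add: blinfun.diff_left)
  also have "\<dots> \<le> \<rho>\<^sup>2 * P Y ?u" using assms(1) rel_iff_Q[OF Y] by blast
  also have "\<dots> \<le> \<rho>\<^sup>2 * (4 / (1 - r\<^sup>2) * (norm k)\<^sup>2)"
    by (intro mult_left_mono P_denominator_le assms) simp
  \<comment> \<open>Weakened to make the constant a perfect square.\<close>
  also have "\<dots> \<le> \<rho>\<^sup>2 * (4 / (1 - r\<^sup>2)\<^sup>2 * (norm k)\<^sup>2)"
  proof -
    have "(1 - r\<^sup>2)\<^sup>2 \<le> (1 - r\<^sup>2) ^ 1" using r2 by (intro power_decreasing) auto
    then have "(1 - r\<^sup>2)\<^sup>2 \<le> 1 - r\<^sup>2" by (simp only: power_one_right)
    then show ?thesis using r2 by (intro mult_left_mono mult_right_mono divide_left_mono) auto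
  qed
  also have "\<dots> = (2 / (1 - r\<^sup>2) * \<rho> * norm k)\<^sup>2"
    by (simp add: power_mult_distrib power_divide)
  finally show "norm (blinfun_apply (X - Y) k) \<le> 2 / (1 - r\<^sup>2) * \<rho> * norm k"
    by (rule power2_le_imp_le) (use r2 assms in simp)
qed

text \<open>The relation takes (1 - \<rho>^2) P u away from |k|^2, and P u >= |u|^2 >= (1 - s)^2
  |k|^2. So a pseudo-hyperbolic ball of radius below 1 keeps a distance from the boundary that
  depends only on its radius and on the norm of its centre.\<close>

lemma rel_norm:
  assumes "rel \<rho> X Y" "0 \<le> \<rho>" "\<rho> \<le> 1" "norm X \<le> 1" "norm Y \<le> s" "s < 1"
  shows "(norm X)\<^sup>2 \<le> 1 - (1 - \<rho>\<^sup>2) * (1 - s)\<^sup>2"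
proof -
  define c where "c = 1 - (1 - \<rho>\<^sup>2) * (1 - s)\<^sup>2"
  have s0: "0 \<le> s" using assms(5) norm_ge_zero order_trans by blast
  have rr: "0 \<le> 1 - \<rho>\<^sup>2" "1 - \<rho>\<^sup>2 \<le> 1" using assms by (auto simp: abs_square_le_1)
  have "(1 - \<rho>\<^sup>2) * (1 - s)\<^sup>2 \<le> 1 * 1"
    using rr s0 assms by (intro mult_mono power_le_one) auto
  then have c: "0 \<le> c" by (simp add: c_def)
  have "norm X \<le> sqrt c"
  proof (rule norm_blinfun_bound)
    fix k
    let ?u = "k - blinfun_apply (adj Y) (blinfun_apply X k)"
    have "norm Y * norm X \<le> s * 1" using assms s0 by (intro mult_mono) auto
    then have "(1 - s) * norm k \<le> (1 - norm Y * norm X) * norm k" by (intro mult_right_mono) auto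
    also have "\<dots> \<le> norm ?u" by (rule norm_denominator_ge[OF Bop_Lc[OF Y]])
    finally have "((1 - s) * norm k)\<^sup>2 \<le> (norm ?u)\<^sup>2" using assms by (intro power_mono) auto
    then have "((1 - s) * norm k)\<^sup>2 \<le> P Y ?u" using P_ge[OF Y, of ?u] by simp
    then have "(1 - \<rho>\<^sup>2) * ((1 - s) * norm k)\<^sup>2 \<le> (1 - \<rho>\<^sup>2) * P Y ?u" using rr by (intro mult_left_mono)
    then have "(norm (blinfun_apply X k))\<^sup>2 \<le> c * (norm k)\<^sup>2"
    proof -
      have "(norm (blinfun_apply X k))\<^sup>2 + (1 - \<rho>\<^sup>2) * P Y ?u \<le> (norm k)\<^sup>2"
        using assms(1) unfolding rel_def by blast
      moreover have "c * (norm k)\<^sup>2 = (norm k)\<^sup>2 - (1 - \<rho>\<^sup>2) * ((1 - s) * norm k)\<^sup>2"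
        unfolding c_def power_mult_distrib by (simp add: left_diff_distrib)
      ultimately show ?thesis
        using \<open>(1 - \<rho>\<^sup>2) * ((1 - s) * norm k)\<^sup>2 \<le> (1 - \<rho>\<^sup>2) * P Y ?u\<close> by linarith
    qed
    then have "(norm (blinfun_apply X k))\<^sup>2 \<le> (sqrt c * norm k)\<^sup>2" using c by (simp add: power_mult_distrib)
    then show "norm (blinfun_apply X k) \<le> sqrt c * norm k" by (rule power2_le_imp_le) (use c in simp)
  qed (use c in simp)
  then have "(norm X)\<^sup>2 \<le> (sqrt c)\<^sup>2" by (intro power_mono) auto
  then show ?thesis using c by (simp add: c_def)
qed

lemma not_rel_unit_vector:
  assumes "\<not> rel \<rho> X Y"
  shows "\<exists>k. norm k = 1 \<and> 1 < FY Y \<rho> k X"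
proof -
  obtain k where k: "(norm k)\<^sup>2 < FY Y \<rho> k X" using assms by (auto simp: rel_iff_FY not_le)
  have scale: "FY Y \<rho> (t *\<^sub>R k) X = t\<^sup>2 * FY Y \<rho> k X" for t
  proof -
    have "P Y (t *\<^sub>R k - blinfun_apply (adj Y) (blinfun_apply X (t *\<^sub>R k)))
        = t\<^sup>2 * P Y (k - blinfun_apply (adj Y) (blinfun_apply X k))"
      unfolding P_scaleR[OF Y, symmetric] by (simp add: blinfun.scaleR_right scaleR_diff_right)
    then show ?thesis by (simp add: FY_def blinfun.scaleR_right power_mult_distrib algebra_simps)
  qed
  have k0: "k \<noteq> 0" using k scale[of 0] by auto
  have "norm ((1 / norm k) *\<^sub>R k) = 1" using k0 by simp
  moreover have "1 < FY Y \<rho> ((1 / norm k) *\<^sub>R k) X"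
    unfolding scale using k k0 by (simp add: power_divide less_divide_eq)
  ultimately show ?thesis by blast
qed

text \<open>A vector violating \<open>rel\<close> has Q ((X - Y) k) >= \<rho>^2 P u by
  \<open>Q_diff\<close>, hence is visibly moved by X - Y. The estimate gives the power 3/2 of 1 -
  r^2, rounded up to 2.\<close>

lemma FY_witness_large:
  assumes "norm X \<le> r" "norm Y \<le> r" "r < 1" "norm k = 1" "1 < FY Y \<rho> k X" "0 \<le> \<rho>"
  shows "(1 - r\<^sup>2)\<^sup>2 * \<rho> \<le> norm (blinfun_apply (X - Y) k)"
proof -
  let ?d = "1 - r\<^sup>2"
  let ?u = "k - blinfun_apply (adj Y) (blinfun_apply X k)"
  have r0: "0 \<le> r" using assms(2) norm_ge_zero order_trans by blast
  then have d: "0 < ?d" "?d \<le> 1" using assms by (auto simp: abs_square_less_1)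
  have "norm Y * norm X \<le> r * r" using assms r0 by (intro mult_mono) auto
  then have "?d \<le> norm ?u"
    using norm_denominator_ge[OF Bop_Lc[OF Y], of X k] assms(4) by (simp add: power2_eq_square)
  then have "?d\<^sup>2 \<le> (norm ?u)\<^sup>2" using d by (intro power_mono) auto
  then have "?d\<^sup>2 \<le> P Y ?u" using P_ge[OF Y, of ?u] by simp
  then have "\<rho>\<^sup>2 * ?d\<^sup>2 \<le> \<rho>\<^sup>2 * P Y ?u" by (intro mult_left_mono) auto
  also have "\<dots> \<le> Q Y (blinfun_apply X k - blinfun_apply Y k)"
    using assms(4,5) unfolding Q_diff[OF Y] FY_def by (simp add: algebra_simps)
  also have "\<dots> \<le> (norm (blinfun_apply (X - Y) k))\<^sup>2 / (1 - (norm Y)\<^sup>2)"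
    using Q_le[OF Y] by (simp add: blinfun.diff_left)
  also have "\<dots> \<le> (norm (blinfun_apply (X - Y) k))\<^sup>2 / ?d"
    using d assms r0 by (intro divide_left_mono) (auto intro!: power_mono mult_pos_pos simp: abs_square_less_1)
  finally have "?d * (\<rho>\<^sup>2 * ?d\<^sup>2) \<le> (norm (blinfun_apply (X - Y) k))\<^sup>2"
    using d by (simp add: field_simps)
  moreover have "?d * (?d * (\<rho>\<^sup>2 * ?d\<^sup>2)) \<le> 1 * (?d * (\<rho>\<^sup>2 * ?d\<^sup>2))"
    using d by (intro mult_right_mono) auto
  moreover have "?d * (?d * (\<rho>\<^sup>2 * ?d\<^sup>2)) = (?d\<^sup>2 * \<rho>)\<^sup>2"
    by (simp add: power2_eq_square mult_ac)
  ultimately have "(?d\<^sup>2 * \<rho>)\<^sup>2 \<le> (norm (blinfun_apply (X - Y) k))\<^sup>2" by linarith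
  then show ?thesis by (rule power2_le_imp_le) simp
qed

end

text \<open>Read backwards from \<open>n\<close>: a positive last value forces the value
  \<open>i\<close> steps earlier to be at least -(2^i - 1) \<eta>, because each step halves. Since
  all values are at most \<eta>, little room is left for any loss \<open>s j\<close>.\<close>

lemma midpoint_descent:
  fixes \<Gamma> s :: "nat \<Rightarrow> real"
  assumes n: "0 < \<Gamma> n" and le: "\<And>j. \<Gamma> j \<le> \<eta>" and s: "\<And>j. 0 \<le> s j" and \<eta>: "0 \<le> \<eta>"
    and step: "\<And>j. \<Gamma> (Suc j) \<le> \<Gamma> j / 2 + \<eta> / 2 - s j / 4" and j: "j < n"
  shows "s j \<le> 2 ^ (n + 3) * \<eta>"
proof -
  have low: "- ((2 ^ i - 1) * \<eta>) \<le> \<Gamma> (n - i)" if "i \<le> n" for i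
    using that
  proof (induction i)
    case 0
    then show ?case using n by simp
  next
    case (Suc i)
    have "Suc (n - Suc i) = n - i" using Suc.prems by simp
    then have "2 * \<Gamma> (n - i) \<le> \<Gamma> (n - Suc i) + \<eta>"
      using step[of "n - Suc i"] s[of "n - Suc i"] by simp
    then show ?case using Suc by (simp add: algebra_simps)
  qed
  have "- ((2 ^ (n - Suc j) - 1) * \<eta>) \<le> \<Gamma> (Suc j)"
    using low[of "n - Suc j"] j by (simp add: Suc_diff_Suc)
  moreover have "(2::real) ^ (n - Suc j) - 1 \<le> 2 ^ n"
    using power_increasing[of "n - Suc j" n "2::real"] by linarith
  then have "(2 ^ (n - Suc j) - 1) * \<eta> \<le> 2 ^ n * \<eta>" using \<eta> by (rule mult_right_mono)
  ultimately have "s j \<le> 4 * \<eta> + 4 * (2 ^ n * \<eta>)" using step[of j] le[of j] by linarith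
  also have "4 * \<eta> \<le> 4 * (2 ^ n * \<eta>)" using mult_right_mono[of 1 "2 ^ n" \<eta>] \<eta> by simp
  finally show ?thesis by (simp add: power_add mult_ac)
qed

text \<open>If every point of \<open>C\<close> were almost diametral, iterated midpoints \<open>Z (n+1)\<close> of \<open>Z n\<close> with
  a far away point of \<open>C\<close> would produce unit vectors \<open>k n\<close> of the finite-dimensional domain
  that are uniformly separated from each other.\<close>

lemma uniform_normal_structure:
  assumes r: "0 \<le> r" "r < 1"
  shows "\<exists>\<epsilon>. 0 < \<epsilon> \<and> \<epsilon> < 1 \<and> (\<forall>C::('k \<Rightarrow>\<^sub>L 'h::cinner_space) set. \<forall>\<delta>.
    C \<noteq> {} \<longrightarrow> C \<subseteq> Bop \<longrightarrow> (\<forall>X\<in>C. norm X \<le> r) \<longrightarrow> (\<forall>X\<in>C. \<forall>X'\<in>C. (1/2) *\<^sub>R (X + X') \<in> C) \<longrightarrow>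
    0 < \<delta> \<longrightarrow> \<delta> \<le> 1 \<longrightarrow> (\<forall>X\<in>C. \<forall>X'\<in>C. rel \<delta> X X') \<longrightarrow> (\<exists>Z\<in>C. \<forall>X\<in>C. rel ((1 - \<epsilon>) * \<delta>) Z X))"
proof -
  define d where "d = 1 - r\<^sup>2"
  have d: "0 < d" "d \<le> 1" using r by (auto simp: d_def abs_square_less_1)
  \<comment> \<open>Half of the constant of \<open>FY_witness_large\<close>: since \<rho> >=
    \<delta> / 2 below, a witness moves by at least c \<delta>.\<close>
  define c where "c = d\<^sup>2 / 2"
  have c: "0 < c" "c \<le> 1/2" using d by (auto simp: c_def abs_square_le_1)
  \<comment> \<open>The threshold is tuned to norm (Z m - x (Z m)) <= 2 \<delta> / d: replacing
    \<open>k m\<close> by \<open>k n\<close> changes the displacement by less than c \<delta> /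
    2.\<close>
  obtain N :: nat where N: "\<And>k :: nat \<Rightarrow> 'k. (\<And>i. norm (k i) \<le> 1) \<Longrightarrow>
      \<exists>m n. m < n \<and> n \<le> N \<and> norm (k m - k n) < c * d / 4"
    using packing[of "c * d / 4"] c d by auto
  \<comment> \<open>Solves 2^(N+3) (8 \<epsilon> \<delta>^2 / d) = (c \<delta> / 2)^2, so that the
    loss at stage \<open>m\<close> measured along \<open>k n\<close> is at most c \<delta> /
    2.\<close>
  define \<epsilon> where "\<epsilon> = c\<^sup>2 * d / 2 ^ (N + 8)"
  have e0: "0 < \<epsilon>" using c d by (simp add: \<epsilon>_def)
  have e1: "\<epsilon> \<le> 1/2"
  proof -
    have "c\<^sup>2 * d \<le> 1 * 1" using c d by (intro mult_mono) (auto simp: abs_square_le_1)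
    moreover have "(2::real) ^ 1 \<le> 2 ^ (N + 8)" by (intro power_increasing) auto
    ultimately have "c\<^sup>2 * d / 2 ^ (N + 8) \<le> 1 / 2" by (intro frac_le) auto
    then show ?thesis by (simp add: \<epsilon>_def)
  qed
  have "\<exists>Z\<in>C. \<forall>X\<in>C. rel ((1 - \<epsilon>) * \<delta>) Z X"
    if C: "C \<noteq> {}" "C \<subseteq> Bop" "\<forall>X\<in>C. norm X \<le> r" "\<forall>X\<in>C. \<forall>X'\<in>C. (1/2) *\<^sub>R (X + X') \<in> C"
      and \<delta>: "0 < \<delta>" "\<delta> \<le> 1" and rel: "\<forall>X\<in>C. \<forall>X'\<in>C. rel \<delta> X X'"
    for C :: "('k \<Rightarrow>\<^sub>L 'h) set" and \<delta>
  proof (rule ccontr)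
    assume neg: "\<not> ?thesis"
    define \<rho> where "\<rho> = (1 - \<epsilon>) * \<delta>"
    have rho: "0 \<le> \<rho>" "\<rho> \<le> 1" "\<rho> \<le> \<delta>" "\<delta> / 2 \<le> \<rho>"
    proof -
      show "0 \<le> \<rho>" using e1 \<delta> by (simp add: \<rho>_def)
      show "\<rho> \<le> \<delta>" using e0 \<delta> by (simp add: \<rho>_def)
      then show "\<rho> \<le> 1" using \<delta> by simp
      show "\<delta> / 2 \<le> \<rho>" using mult_right_mono[of "1/2" "1 - \<epsilon>" \<delta>] e1 \<delta> by (simp add: \<rho>_def)
    qed
    have "\<forall>Z\<in>C. \<exists>X\<in>C. \<exists>k. norm k = 1 \<and> 1 < FY X \<rho> k Z"
      using neg not_rel_unit_vector C(2) unfolding \<rho>_def by blast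
    then obtain x \<kappa> where x: "\<And>Z. Z \<in> C \<Longrightarrow> x Z \<in> C" "\<And>Z. Z \<in> C \<Longrightarrow> norm (\<kappa> Z) = 1"
        "\<And>Z. Z \<in> C \<Longrightarrow> 1 < FY (x Z) \<rho> (\<kappa> Z) Z" by metis
    obtain Z0 where Z0: "Z0 \<in> C" using C(1) by blast
    define Z where "Z n = ((\<lambda>Z. (1/2) *\<^sub>R (Z + x Z)) ^^ n) Z0" for n
    have ZS: "Z (Suc n) = (1/2) *\<^sub>R (Z n + x (Z n))" for n by (simp add: Z_def)
    have ZC: "Z n \<in> C" for n
      by (induction n) (use Z0 C(4) x(1) ZS in \<open>auto simp: Z_def\<close>)
    define k where "k n = \<kappa> (Z n)" for n
    have k1: "norm (k n) = 1" for n using x(2) ZC by (simp add: k_def)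
    obtain m n where mn: "m < n" "n \<le> N" "norm (k m - k n) < c * d / 4"
      using N[of k] k1 by auto
    define Y where "Y = x (Z n)"
    have YC: "Y \<in> C" and YB: "Y \<in> Bop" using x(1) ZC C(2) by (auto simp: Y_def)
    \<comment> \<open>Bounds the excess of \<open>FY Y \<rho>\<close> over
      \<open>FY Y \<delta>\<close> at a unit vector: the difference of the coefficients times the
      bound 4 / d for \<open>P\<close>.\<close>
    define \<eta> where "\<eta> = (\<delta>\<^sup>2 - \<rho>\<^sup>2) * (4 / d)"
    have "\<rho>\<^sup>2 \<le> \<delta>\<^sup>2" using rho by (intro power_mono) auto
    then have eta0: "0 \<le> \<eta>" using d by (simp add: \<eta>_def)
    have FYle: "FY Y \<rho> (k n) X \<le> 1 + \<eta>" if "X \<in> C" for X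
    proof -
      let ?p = "P Y (k n - blinfun_apply (adj Y) (blinfun_apply X (k n)))"
      have "FY Y \<rho> (k n) X = FY Y \<delta> (k n) X + (\<delta>\<^sup>2 - \<rho>\<^sup>2) * ?p" by (simp add: FY_def algebra_simps)
      moreover have "FY Y \<delta> (k n) X \<le> (norm (k n))\<^sup>2" using rel that YC unfolding rel_iff_FY by blast
      then have "FY Y \<delta> (k n) X \<le> 1" using k1[of n] by simp
      moreover have "?p \<le> 4 / (1 - r\<^sup>2) * (norm (k n))\<^sup>2"
        using that YC C(2,3) r Bop_norm by (intro P_denominator_le[OF YB]) (auto intro: less_imp_le)
      then have "(\<delta>\<^sup>2 - \<rho>\<^sup>2) * ?p \<le> \<eta>"
        unfolding \<eta>_def d_def using \<open>\<rho>\<^sup>2 \<le> \<delta>\<^sup>2\<close> k1[of n] by (intro mult_left_mono) auto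
      ultimately show ?thesis by simp
    qed
    define s where "s j = (norm (blinfun_apply (Z j - x (Z j)) (k n)))\<^sup>2" for j
    \<comment> \<open>The descent is measured with the last pair \<open>Y\<close>,
      \<open>k n\<close> fixed. Along \<open>k n\<close> the early displacement Z m - x (Z m) must
      be small, while along its own witness \<open>k m\<close> it is large, although the two vectors
      are close.\<close>
    have "s m \<le> 2 ^ (n + 3) * \<eta>"
    proof (rule midpoint_descent[of "\<lambda>j. FY Y \<rho> (k n) (Z j) - 1"])
      show "0 < FY Y \<rho> (k n) (Z n) - 1" using x(3)[OF ZC, of n] by (simp add: Y_def k_def)
      show "FY Y \<rho> (k n) (Z j) - 1 \<le> \<eta>" for j using FYle[OF ZC, of j] by simp
      show "FY Y \<rho> (k n) (Z (Suc j)) - 1 \<le> (FY Y \<rho> (k n) (Z j) - 1) / 2 + \<eta> / 2 - s j / 4" for j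
        using FY_midpoint[OF YB rho(1,2), of "k n" "Z j" "x (Z j)"] FYle[OF x(1)[OF ZC], of j]
        unfolding ZS s_def by (simp add: diff_divide_distrib)
    qed (use eta0 mn in \<open>auto simp: s_def\<close>)
    also have "\<dots> \<le> 2 ^ (N + 3) * (8 * \<epsilon> * \<delta>\<^sup>2 / d)"
    proof (rule mult_mono)
      have "\<delta>\<^sup>2 - \<rho>\<^sup>2 = (2 * \<epsilon> - \<epsilon>\<^sup>2) * \<delta>\<^sup>2" by (simp add: \<rho>_def power2_eq_square algebra_simps)
      also have "\<dots> \<le> 2 * \<epsilon> * \<delta>\<^sup>2" by (intro mult_right_mono) auto
      finally have "\<eta> \<le> 2 * \<epsilon> * \<delta>\<^sup>2 * (4 / d)" unfolding \<eta>_def using d by (intro mult_right_mono) auto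
      then show "\<eta> \<le> 8 * \<epsilon> * \<delta>\<^sup>2 / d" by simp
    qed (use mn eta0 in auto)
    also have "\<dots> = (c * \<delta> / 2)\<^sup>2"
      using d by (simp add: \<epsilon>_def power_add power2_eq_square field_simps)
    finally have sm: "norm (blinfun_apply (Z m - x (Z m)) (k n)) \<le> c * \<delta> / 2"
      unfolding s_def by (rule power2_le_imp_le) (use c \<delta> in simp)
    have xm: "x (Z m) \<in> C" "x (Z m) \<in> Bop" using x(1)[OF ZC] C(2) by auto
    have "d\<^sup>2 * \<rho> \<le> norm (blinfun_apply (Z m - x (Z m)) (k m))"
      unfolding d_def
      by (rule FY_witness_large[OF xm(2)]) (use C(3) ZC xm r k1 x(3)[OF ZC, of m] rho in \<open>auto simp: k_def\<close>)
    moreover have "c * \<delta> \<le> d\<^sup>2 * \<rho>"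
      using mult_left_mono[OF rho(4), of "d\<^sup>2"] by (simp add: c_def)
    ultimately have big: "c * \<delta> \<le> norm (blinfun_apply (Z m - x (Z m)) (k m))" by simp
    have "norm (Z m - x (Z m)) \<le> 2 / (1 - r\<^sup>2) * \<delta>"
    proof (rule rel_dist[OF xm(2)])
      show "norm (Z m) \<le> 1" using Bop_norm ZC C(2) less_imp_le by blast
    qed (use rel ZC xm C(3) \<delta> r in auto)
    then have lip: "norm (Z m - x (Z m)) \<le> 2 / d * \<delta>" by (simp add: d_def)
    have "norm (blinfun_apply (Z m - x (Z m)) (k m - k n)) \<le> norm (Z m - x (Z m)) * norm (k m - k n)"
      by (rule norm_blinfun)
    also have "\<dots> \<le> (2 / d * \<delta>) * norm (k m - k n)" by (intro mult_right_mono lip) simp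
    also have "\<dots> < (2 / d * \<delta>) * (c * d / 4)" using mn(3) d \<delta> by (intro mult_strict_left_mono) auto
    also have "\<dots> = c * \<delta> / 2" using d by simp
    finally have "norm (blinfun_apply (Z m - x (Z m)) (k m) - blinfun_apply (Z m - x (Z m)) (k n)) < c * \<delta> / 2"
      by (simp add: blinfun.diff_right)
    then show False
      using norm_triangle_ineq2[of "blinfun_apply (Z m - x (Z m)) (k m)" "blinfun_apply (Z m - x (Z m)) (k n)"]
        big sm by linarith
  qed
  then show ?thesis using e0 e1 by (intro exI[of _ \<epsilon>]) auto
qed

lemma rel_0_iff:
  fixes X :: "'k \<Rightarrow>\<^sub>L 'h::cinner_space"
  assumes "0 \<le> \<rho>"
  shows "rel \<rho> X 0 \<longleftrightarrow> norm X \<le> \<rho>"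
proof -
  have z: "(0 :: 'k \<Rightarrow>\<^sub>L 'h) \<in> Bop" by simp
  have "P (0 :: 'k \<Rightarrow>\<^sub>L 'h) u = (norm u)\<^sup>2" for u
    using P_ge[OF z, of u] P_le[OF z, of u] by simp
  moreover have "blinfun_apply (adj (0 :: 'k \<Rightarrow>\<^sub>L 'h)) h = 0" for h
    using norm_adj_apply[of "0 :: 'k \<Rightarrow>\<^sub>L 'h" h] by simp
  ultimately have "rel \<rho> X 0 \<longleftrightarrow> (\<forall>k. (norm (blinfun_apply X k))\<^sup>2 \<le> (\<rho> * norm k)\<^sup>2)"
    by (simp add: rel_def algebra_simps)
  also have "\<dots> \<longleftrightarrow> (\<forall>k. norm (blinfun_apply X k) \<le> \<rho> * norm k)"
    using assms by (auto intro: power2_le_imp_le power_mono)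
  also have "\<dots> \<longleftrightarrow> norm X \<le> \<rho>"
    using assms norm_blinfun_bound[of \<rho> X] norm_blinfun[of X] mult_right_mono[of "norm X" \<rho>]
    by (meson norm_ge_zero order_trans)
  finally show ?thesis .
qed

end

section \<open>Groups of automorphisms\<close>

locale ball_group = fin_dim E for E :: "'k::cinner_space set" +
  fixes G :: "(('k \<Rightarrow>\<^sub>L 'h::cinner_space) \<Rightarrow> ('k \<Rightarrow>\<^sub>L 'h)) set"
  assumes G: "aut_group G"
begin

section \<open>Group laws on the ball and orbits\<close>

lemma G_nonempty: "G \<noteq> {}" using G by (simp add: aut_group_def)

lemma G_hol: "g \<in> G \<Longrightarrow> hol g Bop"
  using G holo_on_imp_hol[of g Bop] Bop_Lc unfolding aut_group_def is_aut_def by blast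

lemma G_Bop: "g \<in> G \<Longrightarrow> X \<in> Bop \<Longrightarrow> g X \<in> Bop"
  using G unfolding aut_group_def is_aut_def bij_betw_def by blast

lemma G_inverse:
  assumes g: "g \<in> G"
  obtains k where "k \<in> G" "\<And>X. X \<in> Bop \<Longrightarrow> k (g X) = X" "\<And>X. X \<in> Bop \<Longrightarrow> g (k X) = X"
proof -
  have "\<forall>g\<in>G. \<exists>k\<in>G. \<forall>X\<in>Bop. k (g X) = X" using G unfolding aut_group_def by simp
  then obtain k where k: "k \<in> G" "\<forall>X\<in>Bop. k (g X) = X" by (rule bexE[OF bspec[OF _ g]])
  have bij: "bij_betw g Bop Bop" using G g unfolding aut_group_def is_aut_def by simp
  show ?thesis
  proof (rule that[OF k(1)])
    show "k (g X) = X" if "X \<in> Bop" for X using k(2) that by (rule bspec)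
    show "g (k X) = X" if X: "X \<in> Bop" for X
    proof -
      obtain X' where X': "X' \<in> Bop" "X = g X'"
        using X bij_betw_imp_surj_on[OF bij] by (metis imageE)
      show ?thesis unfolding X'(2) bspec[OF k(2) X'(1)] ..
    qed
  qed
qed

lemma G_compose:
  assumes "g \<in> G" "h \<in> G"
  obtains k where "k \<in> G" "\<And>X. X \<in> Bop \<Longrightarrow> k X = g (h X)"
proof -
  have "\<forall>g\<in>G. \<forall>h\<in>G. \<exists>k\<in>G. \<forall>X\<in>Bop. k X = g (h X)" using G unfolding aut_group_def by simp
  then obtain k where "k \<in> G" "\<forall>X\<in>Bop. k X = g (h X)"
    by (rule bexE[OF bspec[OF bspec[OF _ assms(1)] assms(2)]])
  then show ?thesis by (intro that[of k]) simp_all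
qed

lemma G_identity:
  obtains e where "e \<in> G" "\<And>X. X \<in> Bop \<Longrightarrow> e X = X"
proof -
  obtain g where g: "g \<in> G" using G_nonempty by blast
  obtain k where k: "k \<in> G" "\<And>X. X \<in> Bop \<Longrightarrow> k (g X) = X" "\<And>X. X \<in> Bop \<Longrightarrow> g (k X) = X" using G_inverse[OF g] by blast
  obtain e where e: "e \<in> G" "\<And>X. X \<in> Bop \<Longrightarrow> e X = k (g X)" using G_compose[OF k(1) g] by blast
  show ?thesis
  proof (rule that[OF e(1)])
    show "e X = X" if "X \<in> Bop" for X unfolding e(2)[OF that] k(2)[OF that] ..
  qed
qed

lemma G_rel:
  assumes "g \<in> G" "X \<in> Bop" "Y \<in> Bop" "0 < \<rho>" "\<rho> < 1" "rel \<rho> X Y"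
  shows "rel \<rho> (g X) (g Y)"
proof (rule Schwarz_Pick[OF G_hol[OF assms(1)] _ assms(2-6)])
  show "g ` Bop \<subseteq> Bop" using G_Bop[OF assms(1)] by blast
qed

lemma separated_orbitI:
  assumes X: "X \<in> Bop" and c: "c < 1" and b: "\<And>g. g \<in> G \<Longrightarrow> norm (g X) \<le> c"
  shows "separated ((\<lambda>g. g X) ` G)"
proof -
  obtain g where "g \<in> G" using G_nonempty by blast
  then have "0 \<le> c" using b norm_ge_zero order_trans by blast
  moreover have "norm (g X) < (1 + c) / 2" if "g \<in> G" for g
    using b[OF that] c by simp
  ultimately have "0 \<le> (1 + c) / 2 \<and> (1 + c) / 2 < 1 \<and> (\<lambda>g. g X) ` G \<subseteq> {Z. norm Z < (1 + c) / 2}"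
    using c by auto
  then show ?thesis unfolding separated_def using G_Bop X by blast
qed

lemma rel_exists_uniform:
  assumes s: "0 \<le> s" "s < 1"
  shows "\<exists>t. 0 < t \<and> t < 1 \<and> (\<forall>X Y :: 'k \<Rightarrow>\<^sub>L 'h. Y \<in> Bop \<longrightarrow> norm X \<le> s \<longrightarrow> norm Y \<le> s \<longrightarrow> rel t X Y)"
proof (intro exI conjI allI impI)
  let ?d = "(1 - s\<^sup>2)\<^sup>2"
  have "0 < 1 - s\<^sup>2" "1 - s\<^sup>2 \<le> 1" using s by (auto simp: abs_square_less_1)
  then have "0 < ?d" "?d \<le> 1" by (auto intro!: power_le_one)
  then show "0 < sqrt (1 - ?d / 4)" "sqrt (1 - ?d / 4) < 1" by auto
  show "rel (sqrt (1 - ?d / 4)) X Y" if "Y \<in> Bop" "norm X \<le> s" "norm Y \<le> s" for X Y :: "'k \<Rightarrow>\<^sub>L 'h"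
    using rel_uniform[OF that(1) s(2) that(2,3)] .
qed

lemma one_orbit_imp_all:
  assumes X0: "X0 \<in> Bop" and sep: "separated ((\<lambda>g. g X0) ` G)" and X: "X \<in> Bop"
  shows "separated ((\<lambda>g. g X) ` G)"
proof -
  obtain r where r: "0 \<le> r" "r < 1" "\<And>g. g \<in> G \<Longrightarrow> norm (g X0) < r"
    using sep unfolding separated_def by blast
  define s where "s = max (norm X) (norm X0)"
  have s: "0 \<le> s" "s < 1" using Bop_norm[OF X] Bop_norm[OF X0] by (auto simp: s_def le_max_iff_disj)
  obtain t where t: "0 < t" "t < 1" "rel t X X0"
    using rel_exists_uniform[OF s] X0 by (auto simp: s_def)
  have "norm (g X) \<le> sqrt (1 - (1 - t\<^sup>2) * (1 - r)\<^sup>2)" if g: "g \<in> G" for g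
  proof -
    have "(norm (g X))\<^sup>2 \<le> 1 - (1 - t\<^sup>2) * (1 - r)\<^sup>2"
    proof (rule rel_norm[OF G_Bop[OF g X0] G_rel[OF g X X0 t]])
      show "norm (g X) \<le> 1" using Bop_norm[OF G_Bop[OF g X]] by simp
      show "norm (g X0) \<le> r" using r(3)[OF g] by simp
    qed (use t r in auto)
    then show ?thesis by (rule real_le_rsqrt)
  qed
  moreover have "t\<^sup>2 < 1" using t by (simp add: abs_square_less_1)
  then have "0 < (1 - t\<^sup>2) * (1 - r)\<^sup>2" using r by simp
  then have "sqrt (1 - (1 - t\<^sup>2) * (1 - r)\<^sup>2) < 1" by simp
  ultimately show ?thesis by (intro separated_orbitI[OF X]) auto
qed

lemma fixed_point_imp_separated:
  assumes "X \<in> Bop" "\<forall>g\<in>G. g X = X"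
  shows "separated ((\<lambda>g. g X) ` G)"
  by (rule separated_orbitI[OF assms(1) Bop_norm[OF assms(1)]]) (simp add: assms(2))

text \<open>In the coordinates \<open>Tm Y\<close> centred at a common fixed point \<open>Y\<close>, the group acts by
  linear maps that are uniformly bounded.\<close>

lemma fixed_point_imp_Lipschitz:
  assumes Y: "Y \<in> Bop" and fixed: "\<forall>g\<in>G. g Y = Y"
  shows "\<exists>K>0. \<forall>g\<in>G. \<forall>A\<in>Bop. \<forall>B\<in>Bop. norm (g A - g B) \<le> K * norm (A - B)"
proof -
  define \<alpha> where "\<alpha> = sqrt (1 - (norm Y)\<^sup>2)"
  interpret operator_ball "wt Y" \<alpha> "1 / \<alpha>"
    unfolding \<alpha>_def by (rule operator_ball_wt[OF Y])
  obtain KT where KT: "0 < KT" "\<And>X X'. X \<in> Bop \<Longrightarrow> X' \<in> Bop \<Longrightarrow> norm (Tm Y X - Tm Y X') \<le> KT * norm (X - X')"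
    using Tm_Lipschitz[OF Y] by blast
  obtain KS where KS: "0 < KS" "\<And>T T'. T \<in> U \<Longrightarrow> T' \<in> U \<Longrightarrow> norm (Sm Y T - Sm Y T') \<le> KS * norm (T - T')"
    using Sm_Lipschitz[OF Y] by blast
  define c where "c = 2 * (1 / \<alpha>) / \<alpha>"
  have c: "0 < c" using a0 by (simp add: c_def)
  have "norm (g A - g B) \<le> KS * (c * (KT * norm (A - B)))" if g: "g \<in> G" and A: "A \<in> Bop" and B: "B \<in> Bop" for g A B
  proof -
    obtain k where k: "k \<in> G" "\<And>X. X \<in> Bop \<Longrightarrow> k (g X) = X" "\<And>X. X \<in> Bop \<Longrightarrow> g (k X) = X"
      using G_inverse[OF g] by blast
    define conj where "conj f T = Tm Y (f (Sm Y T))" for f T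
    have conj_hol: "hol (conj f) U" and conj_U: "conj f ` U \<subseteq> U" if f: "f \<in> G" for f
    proof -
      have "hol (\<lambda>T. f (Sm Y T)) U"
        by (rule hol_compose[OF hol_Sm[OF Y] G_hol[OF f]]) (use Sm_Bop[OF Y] in blast)
      then show "hol (conj f) U"
        unfolding conj_def[abs_def]
        by (rule hol_compose[OF _ hol_Tm[OF Y]]) (use Sm_Bop[OF Y] G_Bop[OF f] in blast)
      show "conj f ` U \<subseteq> U"
        unfolding conj_def using Tm_wball[OF Y] Sm_Bop[OF Y] G_Bop[OF f] by blast
    qed
    have inv: "conj k (conj g T) = T" "conj g (conj k T) = T" if "T \<in> U" for T
      using Sm_Tm[OF Y G_Bop[OF g Sm_Bop[OF Y that]]] Sm_Tm[OF Y G_Bop[OF k(1) Sm_Bop[OF Y that]]]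
        k(2,3)[OF Sm_Bop[OF Y that]] Tm_Sm[OF Y that]
      by (simp_all add: conj_def)
    have c0: "conj g 0 = 0" by (simp add: conj_def Sm_0[OF Y] bspec[OF fixed g] Tm_Y[OF Y])
    have gS: "g X = Sm Y (conj g (Tm Y X))" if "X \<in> Bop" for X
      using that by (simp add: conj_def Sm_Tm[OF Y] G_Bop[OF g])
    have AU: "Tm Y A \<in> U" "Tm Y B \<in> U" using Tm_wball[OF Y] A B by auto
    then have gU: "conj g (Tm Y A) \<in> U" "conj g (Tm Y B) \<in> U" using conj_U[OF g] by auto
    have "norm (g A - g B) \<le> KS * norm (conj g (Tm Y A) - conj g (Tm Y B))"
      unfolding gS[OF A] gS[OF B] by (rule KS(2)[OF gU])
    also have "\<dots> \<le> KS * (c * norm (Tm Y A - Tm Y B))"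
      unfolding c_def using KS(1)
      by (intro mult_left_mono automorphism_Lipschitz[OF conj_hol[OF g] conj_U[OF g] c0
          conj_hol[OF k(1)] conj_U[OF k(1)] inv AU]) auto
    also have "\<dots> \<le> KS * (c * (KT * norm (A - B)))"
      using KS(1) c by (intro mult_left_mono KT(2)[OF A B]) auto
    finally show ?thesis .
  qed
  then show ?thesis
    using KS(1) KT(1) c by (intro exI[of _ "KS * c * KT"]) (auto simp: mult.assoc)
qed

lemma equicontinuous_imp_separated:
  assumes eq: "\<forall>\<epsilon>>0. \<exists>\<delta>>0. \<forall>A\<in>Bop. \<forall>B\<in>Bop. norm (A - B) < \<delta> \<longrightarrow> (\<forall>g\<in>G. norm (g A - g B) < \<epsilon>)"
  shows "separated ((\<lambda>g. g 0) ` G)"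
proof -
  obtain \<delta>0 where d0: "\<delta>0 > 0" "\<And>A B g. A \<in> Bop \<Longrightarrow> B \<in> Bop \<Longrightarrow> norm (A - B) < \<delta>0 \<Longrightarrow> g \<in> G \<Longrightarrow> norm (g A - g B) < 1/2"
    using eq[rule_format, of "1/2"] by auto
  \<comment> \<open>Capped at 1/2 so that norm (g 0) > 1 - \<delta> excludes g 0 = 0, and a ray
    through \<open>g 0\<close> exists.\<close>
  define \<delta> where "\<delta> = min \<delta>0 (1/2)"
  have d: "0 < \<delta>" "\<delta> < 1" "\<delta> \<le> \<delta>0" using d0(1) by (auto simp: \<delta>_def)
  have "norm (g 0) \<le> 1 - \<delta>" if g: "g \<in> G" for g
  proof (rule ccontr)
    assume n: "\<not> norm (g 0) \<le> 1 - \<delta>"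
    define S where "S = g 0"
    define s where "s = norm S"
    have SB: "S \<in> Bop" using G_Bop[OF g zero_Bop] by (simp add: S_def)
    have s: "0 < s" "s < 1" "1 - s < \<delta>" using n d Bop_norm[OF SB] by (auto simp: s_def S_def)
    obtain k where k: "k \<in> G" "\<And>X. X \<in> Bop \<Longrightarrow> k (g X) = X" "\<And>X. X \<in> Bop \<Longrightarrow> g (k X) = X"
      using G_inverse[OF g] by blast
    have kS: "k S = 0" using k(2)[OF zero_Bop] by (simp add: S_def)
    \<comment> \<open>The bound of \<open>rel_norm\<close> for the pseudo-hyperbolic ball of radius
      1/2 about \<open>S\<close>. A multiple \<open>B\<close> of \<open>S\<close> with norm between
      max m s and 1 lies outside that ball, yet within \<delta> of \<open>S\<close> in norm.\<close>
    define m where "m = sqrt (1 - (1 - (1/2)\<^sup>2) * (1 - s)\<^sup>2)"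
    have "0 < (1 - (1/2::real)\<^sup>2) * (1 - s)\<^sup>2" using s by (simp add: power2_eq_square)
    then have m: "m < 1" by (simp add: m_def)
    obtain x where x: "max m s < x" "x < 1" using dense[of "max m s" 1] m s by auto
    define B where "B = (x / s) *\<^sub>R S"
    have nB: "norm B = x" using x s by (simp add: B_def s_def[symmetric])
    have BB: "B \<in> Bop" using SB nB x unfolding Bop_def by (auto simp: B_def)
    have "B - S = ((x - s) / s) *\<^sub>R S"
      using s by (simp add: B_def diff_divide_distrib scaleR_diff_left)
    then have "norm (B - S) = x - s" using x s by (simp add: s_def[symmetric])
    then have "norm (B - S) < \<delta>0" using x s d by linarith
    then have "norm (k B - k S) < 1/2" by (rule d0(2)[OF BB SB _ k(1)])
    then have "rel (1/2) (k B) 0" by (simp add: kS rel_0_iff)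
    then have "rel (1/2) (g (k B)) (g 0)" by (intro G_rel[OF g G_Bop[OF k(1) BB] zero_Bop]) auto
    then have "rel (1/2) B S" using k(3)[OF BB] by (simp add: S_def)
    then have "(norm B)\<^sup>2 \<le> 1 - (1 - (1/2)\<^sup>2) * (1 - s)\<^sup>2"
      using Bop_norm[OF BB] s by (intro rel_norm[OF SB]) (auto simp: s_def)
    then have "norm B \<le> m" unfolding m_def by (rule real_le_rsqrt)
    then show False using nB x by simp
  qed
  then show ?thesis using d by (intro separated_orbitI[of 0 "1 - \<delta>"]) auto
qed

end

locale complete_ball_group = ball_group E G
  for E :: "'k::cinner_space set" and G :: "(('k \<Rightarrow>\<^sub>L 'h::{cinner_space,complete_space}) \<Rightarrow> ('k \<Rightarrow>\<^sub>L 'h)) set"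
begin

lemma separated_imp_fixed_point:
  assumes X0: "X0 \<in> Bop" and sep: "separated ((\<lambda>g. g X0) ` G)"
  shows "\<exists>X\<in>Bop. \<forall>g\<in>G. g X = X"
proof -
  obtain s where s: "0 \<le> s" "s < 1" "\<And>g. g \<in> G \<Longrightarrow> norm (g X0) < s"
    using sep unfolding separated_def by blast
  obtain e where e: "e \<in> G" "\<And>X. X \<in> Bop \<Longrightarrow> e X = X" using G_identity by blast
  have X0s: "norm X0 \<le> s" using s(3)[OF e(1)] e(2)[OF X0] by simp
  obtain t where t: "0 < t" "t < 1"
      and trel: "\<And>X Y :: 'k \<Rightarrow>\<^sub>L 'h. Y \<in> Bop \<Longrightarrow> norm X \<le> s \<Longrightarrow> norm Y \<le> s \<Longrightarrow> rel t X Y"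
    using rel_exists_uniform[OF s(1,2)] by blast
  define r where "r = sqrt (1 - (1 - t\<^sup>2) * (1 - s)\<^sup>2)"
  have "t\<^sup>2 < 1" using t by (simp add: abs_square_less_1)
  then have "0 < (1 - t\<^sup>2) * (1 - s)\<^sup>2" using s by simp
  moreover have "(1 - t\<^sup>2) * (1 - s)\<^sup>2 \<le> 1 * 1"
    using \<open>t\<^sup>2 < 1\<close> s by (intro mult_mono power_le_one) auto
  ultimately have r: "0 \<le> r" "r < 1" by (auto simp: r_def)
  obtain \<epsilon> where eps: "0 < \<epsilon>" "\<epsilon> < 1" and ns: "\<And>(C::('k \<Rightarrow>\<^sub>L 'h) set) \<delta>.
    C \<noteq> {} \<Longrightarrow> C \<subseteq> Bop \<Longrightarrow> \<forall>X\<in>C. norm X \<le> r \<Longrightarrow> \<forall>X\<in>C. \<forall>X'\<in>C. (1/2) *\<^sub>R (X + X') \<in> C \<Longrightarrow>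
    0 < \<delta> \<Longrightarrow> \<delta> \<le> 1 \<Longrightarrow> \<forall>X\<in>C. \<forall>X'\<in>C. rel \<delta> X X' \<Longrightarrow> \<exists>Z\<in>C. \<forall>X\<in>C. rel ((1 - \<epsilon>) * \<delta>) Z X"
    using uniform_normal_structure[OF r, where 'h = 'h] by blast
  define q where "q = 1 - \<epsilon>"
  have q: "0 < q" "q < 1" using eps by (auto simp: q_def)
  have qn: "0 < q ^ n" "q ^ n \<le> 1" for n using q by (auto intro: power_le_one)
  \<comment> \<open>Invariance under the group needs radii strictly below 1; the exponent starts at
    1 because the zeroth radius equals 1.\<close>
  have qSn: "q ^ Suc n < 1" for n
    unfolding power_Suc using q mult_left_mono[OF qn(2)[of n], of q] by linarith
  \<comment> \<open>The intersection of the balls of radius \<open>t\<close> about the orbit points: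
    the group permutes these balls, and \<open>X0\<close> lies in all of them by the choice of
    \<open>t\<close>.\<close>
  define C0 where "C0 = {X \<in> Bop. \<forall>g\<in>G. rel t X (g X0)}"
  \<comment> \<open>Each set keeps the points of its predecessor that are non-diametral by the
    factor \<open>q\<close>, so the n-th set has diameter at most \<open>q ^ n\<close> in the sense
    of \<open>rel\<close>.\<close>
  define C where "C = rec_nat C0 (\<lambda>n S. {X \<in> S. \<forall>Y\<in>S. rel (q ^ Suc n) X Y})"
  have C_0: "C 0 = C0" and C_Suc: "C (Suc n) = {X \<in> C n. \<forall>Y\<in>C n. rel (q ^ Suc n) X Y}" for n
    by (simp_all add: C_def)
  have C0_r: "norm X \<le> r" if "X \<in> C0" for X
  proof -
    have X: "X \<in> Bop" "rel t X X0" using that e X0 unfolding C0_def by force+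
    have "(norm X)\<^sup>2 \<le> 1 - (1 - t\<^sup>2) * (1 - s)\<^sup>2"
      using X Bop_norm[OF X(1)] t s X0s by (intro rel_norm[OF X0]) auto
    then show ?thesis unfolding r_def by (rule real_le_rsqrt)
  qed
  have mid_Bop: "(1/2) *\<^sub>R (X + X') \<in> Bop" if "X \<in> Bop" "X' \<in> Bop" for X X' :: "'k \<Rightarrow>\<^sub>L 'h"
  proof -
    have "norm (X + X') < 2" using norm_triangle_ineq[of X X'] Bop_norm[OF that(1)] Bop_norm[OF that(2)] by linarith
    then show ?thesis using that Bop_Lc by (auto simp: Bop_def)
  qed
  \<comment> \<open>The closedness clause asks for the limit to be in \<open>Bop\<close>, which is
    not closed; the uniform bound \<open>r\<close> supplies this for the limit used later.\<close>
  have inv: "C n \<noteq> {} \<and> C n \<subseteq> C0 \<and> (\<forall>X\<in>C n. \<forall>X'\<in>C n. (1/2) *\<^sub>R (X + X') \<in> C n) \<and>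
      (\<forall>X\<in>C n. \<forall>Y\<in>C n. rel (q ^ n) X Y) \<and> (\<forall>g\<in>G. \<forall>X\<in>C n. g X \<in> C n) \<and>
      (\<forall>Z L. (\<forall>i. Z i \<in> C n) \<longrightarrow> Z \<longlonglongrightarrow> L \<longrightarrow> L \<in> Bop \<longrightarrow> L \<in> C n)" (is "?I n") for n
  proof (induction n)
    case 0
    have "X0 \<in> C0" unfolding C0_def
    proof (intro CollectI conjI ballI X0)
      show "rel t X0 (g X0)" if g: "g \<in> G" for g
        by (rule trel[OF G_Bop[OF g X0] X0s less_imp_le[OF s(3)[OF g]]])
    qed
    moreover have "(1/2) *\<^sub>R (X + X') \<in> C0" if "X \<in> C0" "X' \<in> C0" for X X'
      unfolding C0_def
    proof (intro CollectI conjI ballI)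
      show "(1/2) *\<^sub>R (X + X') \<in> Bop" using that mid_Bop by (simp add: C0_def)
      show "rel t ((1/2) *\<^sub>R (X + X')) (g X0)" if g: "g \<in> G" for g
        using \<open>X \<in> C0\<close> \<open>X' \<in> C0\<close> g t by (intro rel_midpoint[OF G_Bop[OF g X0]]) (auto simp: C0_def)
    qed
    \<comment> \<open>At radius 1 the \<open>P\<close> term drops out and \<open>rel\<close> only
      says that \<open>X\<close> is a contraction, so the iteration starts without any diameter
      estimate.\<close>
    moreover have "rel 1 X Y" if "X \<in> C0" "Y \<in> C0" for X Y
    proof -
      have "norm (blinfun_apply X k) \<le> norm k" for k
        using norm_blinfun[of X k] mult_right_mono[of "norm X" 1 "norm k"] C0_r[OF that(1)] r by simp
      then show ?thesis by (simp add: rel_def power_mono)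
    qed
    moreover have "g X \<in> C0" if g: "g \<in> G" and X: "X \<in> C0" for g X
    proof -
      have "rel t (g X) (h X0)" if h: "h \<in> G" for h
      proof -
        obtain k where k: "k \<in> G" "\<And>X. X \<in> Bop \<Longrightarrow> k (g X) = X" "\<And>X. X \<in> Bop \<Longrightarrow> g (k X) = X" using G_inverse[OF g] by blast
        obtain f where f: "f \<in> G" "\<And>X. X \<in> Bop \<Longrightarrow> f X = k (h X)" using G_compose[OF k(1) h] by blast
        \<comment> \<open>Every orbit point \<open>h X0\<close> is \<open>g\<close> applied to
          another orbit point, namely \<open>f X0\<close> with \<open>f\<close> acting as the
          inverse of \<open>g\<close> after \<open>h\<close>.\<close>
        have "rel t (g X) (g (f X0))"
          by (rule G_rel[OF g _ G_Bop[OF f(1) X0] t]) (use X f(1) in \<open>auto simp: C0_def\<close>)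
        then show ?thesis using f(2)[OF X0] k(3)[OF G_Bop[OF h X0]] by simp
      qed
      then show ?thesis using G_Bop[OF g, of X] X by (simp add: C0_def)
    qed
    moreover have "L \<in> C0" if "\<And>i. Z i \<in> C0" "Z \<longlonglongrightarrow> L" "L \<in> Bop" for Z L
      unfolding C0_def
    proof (intro CollectI conjI ballI \<open>L \<in> Bop\<close>)
      show "rel t L (g X0)" if g: "g \<in> G" for g
        using \<open>\<And>i. Z i \<in> C0\<close> g by (intro rel_limit[OF G_Bop[OF g X0] \<open>Z \<longlonglongrightarrow> L\<close>]) (simp add: C0_def)
    qed
    ultimately show ?case unfolding C_0 power_0 by blast
  next
    case (Suc n)
    have CB: "C n \<subseteq> Bop" using Suc.IH by (auto simp: C0_def)
    have sub: "C (Suc n) \<subseteq> C n" by (auto simp: C_Suc)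
    have "\<exists>Z\<in>C n. \<forall>X\<in>C n. rel ((1 - \<epsilon>) * q ^ n) Z X"
      using Suc.IH CB C0_r qn[of n] by (intro ns) auto
    then have "C (Suc n) \<noteq> {}" by (auto simp: C_Suc q_def)
    moreover have "(1/2) *\<^sub>R (X + X') \<in> C (Suc n)" if "X \<in> C (Suc n)" "X' \<in> C (Suc n)" for X X'
    proof -
      have "rel (q ^ Suc n) ((1/2) *\<^sub>R (X + X')) Y" if "Y \<in> C n" for Y
        using \<open>X \<in> C (Suc n)\<close> \<open>X' \<in> C (Suc n)\<close> that CB qn[of "Suc n"]
        by (intro rel_midpoint) (auto simp: C_Suc simp del: power_Suc)
      then show ?thesis using that Suc.IH sub unfolding C_Suc by blast
    qed
    moreover have "g X \<in> C (Suc n)" if g: "g \<in> G" and X: "X \<in> C (Suc n)" for g X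
    proof -
      have rel: "rel (q ^ Suc n) (g X) Y" if Y: "Y \<in> C n" for Y
      proof -
        obtain k where k: "k \<in> G" "\<And>X. X \<in> Bop \<Longrightarrow> k (g X) = X" "\<And>X. X \<in> Bop \<Longrightarrow> g (k X) = X" using G_inverse[OF g] by blast
        have kY: "k Y \<in> C n" using Suc.IH k(1) Y by blast
        then have "rel (q ^ Suc n) X (k Y)" using X by (simp add: C_Suc)
        then have "rel (q ^ Suc n) (g X) (g (k Y))"
          using X sub CB kY by (intro G_rel[OF g _ _ qn(1) qSn]) blast+
        then show ?thesis unfolding k(3)[OF subsetD[OF CB Y]] .
      qed
      have "X \<in> C n" using X sub by blast
      moreover have "\<forall>g\<in>G. \<forall>X\<in>C n. g X \<in> C n" using Suc.IH by blast
      ultimately have "g X \<in> C n" using g by simp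
      then show ?thesis unfolding C_Suc using rel by (intro CollectI conjI ballI)
    qed
    moreover have "L \<in> C (Suc n)" if Z: "\<And>i. Z i \<in> C (Suc n)" "Z \<longlonglongrightarrow> L" "L \<in> Bop" for Z L
    proof -
      have "L \<in> C n" using Suc.IH Z sub by blast
      moreover have "rel (q ^ Suc n) L Y" if "Y \<in> C n" for Y
      proof (rule rel_limit[OF _ Z(2)])
        show "Y \<in> Bop" using that CB by blast
        show "rel (q ^ Suc n) (Z i) Y" for i using Z(1)[of i] that unfolding C_Suc by blast
      qed
      ultimately show ?thesis unfolding C_Suc by blast
    qed
    moreover have "rel (q ^ Suc n) X Y" if "X \<in> C (Suc n)" "Y \<in> C (Suc n)" for X Y
      using that unfolding C_Suc by blast
    moreover have "C (Suc n) \<subseteq> C0" using Suc.IH sub by blast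
    ultimately show ?case by blast
  qed
  have mono: "C m \<subseteq> C n" if "n \<le> m" for n m
    using that by (induction rule: dec_induct) (auto simp: C_Suc)
  have CB: "X \<in> Bop" if "X \<in> C n" for X n using inv[of n] that by (auto simp: C0_def)
  define K where "K = 2 / (1 - r\<^sup>2)"
  have "r\<^sup>2 < 1" using r by (simp add: abs_square_less_1)
  then have K: "0 < K" by (simp add: K_def)
  have dist: "norm (X - Y) \<le> K * q ^ n" if XY: "X \<in> C n" "Y \<in> C n" for X Y n
    unfolding K_def
  proof (rule rel_dist[OF CB[OF XY(2)]])
    show "rel (q ^ n) X Y" using inv[of n] XY by blast
    show "norm X \<le> 1" using Bop_norm[OF CB[OF XY(1)]] by simp
    show "norm Y \<le> r" using inv[of n] XY C0_r by blast
  qed (use q r in auto)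
  have Kq: "(\<lambda>n. K * q ^ n) \<longlonglongrightarrow> 0"
    using LIMSEQ_realpow_zero[of q] q by (intro tendsto_mult_right_zero) auto
  have "\<exists>X. X \<in> C n" for n using inv[of n] by blast
  then obtain Z where Z: "\<And>n. Z n \<in> C n" by metis
  have "Cauchy Z"
  proof (rule metric_CauchyI)
    fix a :: real assume "0 < a"
    then obtain n where n: "K * q ^ n < a"
      using order_tendstoD(2)[OF Kq] by (auto simp: eventually_sequentially)
    have "dist (Z i) (Z j) < a" if "n \<le> i" "n \<le> j" for i j
    proof -
      have "Z i \<in> C n" "Z j \<in> C n" using Z mono[OF that(1)] mono[OF that(2)] by auto
      then show ?thesis using dist[of "Z i" n "Z j"] n by (simp add: dist_norm)
    qed
    then show "\<exists>M. \<forall>i\<ge>M. \<forall>j\<ge>M. dist (Z i) (Z j) < a" by blast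
  qed
  then obtain L where L: "L \<in> Lc" "Z \<longlonglongrightarrow> L"
    using Lc_complete[of Z] Z CB Bop_Lc by blast
  have "norm (Z n) \<le> r" for n using inv[of n] Z[of n] C0_r by blast
  then have "norm L \<le> r" using tendsto_norm[OF L(2)] by (intro LIMSEQ_le_const2) auto
  then have LB: "L \<in> Bop" using L r by (simp add: Bop_def)
  have LC: "L \<in> C n" for n
  proof -
    have "(\<lambda>i. Z (i + n)) \<longlonglongrightarrow> L" using L(2) by (rule LIMSEQ_ignore_initial_segment)
    moreover have "Z (i + n) \<in> C n" for i using Z mono[of n "i + n"] by auto
    moreover have "\<forall>Z L. (\<forall>i. Z i \<in> C n) \<longrightarrow> Z \<longlonglongrightarrow> L \<longrightarrow> L \<in> Bop \<longrightarrow> L \<in> C n"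
      using inv[of n] by blast
    from this[rule_format, of "\<lambda>i. Z (i + n)" L] have "(\<And>i. Z (i + n) \<in> C n) \<Longrightarrow> (\<lambda>i. Z (i + n)) \<longlonglongrightarrow> L \<Longrightarrow> L \<in> C n"
      using LB by blast
    ultimately show ?thesis by blast
  qed
  have "g L = L" if g: "g \<in> G" for g
  proof -
    have "norm (g L - L) \<le> K * q ^ n" for n
      using inv[of n] LC[of n] g by (intro dist) blast+
    then have "norm (g L - L) \<le> 0" using Kq by (intro LIMSEQ_le_const) auto
    then show ?thesis by simp
  qed
  then show ?thesis using LB by blast
qed

end

theorem theorem1p1:
  fixes G :: "(('k::{cinner_space,complete_space} \<Rightarrow>\<^sub>L 'h::{cinner_space,complete_space})
               \<Rightarrow> ('k \<Rightarrow>\<^sub>L 'h)) set"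
  assumes K_fin: "cfinite_dim TYPE('k)"
    and H_sep: "separable_space TYPE('h)"
    and G: "aut_group G"
  defines "ell \<equiv> (\<forall>X\<in>Bop. separated ((\<lambda>g. g X) ` G))"
    and "one_orbit \<equiv> (\<exists>X0\<in>Bop. separated ((\<lambda>g. g X0) ` G))"
    and "equicont \<equiv> (\<forall>\<epsilon>>0. \<exists>\<delta>>0. \<forall>A\<in>Bop. \<forall>B\<in>Bop. norm (A - B) < \<delta> \<longrightarrow>
                        (\<forall>g\<in>G. norm (g A - g B) < \<epsilon>))"
    and "fixpt \<equiv> (\<exists>X\<in>Bop. \<forall>g\<in>G. g X = X)"
  shows "(ell \<longleftrightarrow> one_orbit) \<and> (ell \<longleftrightarrow> equicont) \<and> (ell \<longleftrightarrow> fixpt)"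
proof -
  obtain E :: "'k set" where E: "frame E" using frame_exists[OF K_fin] by blast
  interpret complete_ball_group E G by unfold_locales (rule E, rule G)
  have 1: "ell \<Longrightarrow> one_orbit" unfolding ell_def one_orbit_def using zero_Bop by blast
  have 2: "one_orbit \<Longrightarrow> ell" unfolding ell_def one_orbit_def using one_orbit_imp_all by blast
  have 3: "one_orbit \<Longrightarrow> fixpt" unfolding one_orbit_def fixpt_def using separated_imp_fixed_point by blast
  have 4: "fixpt \<Longrightarrow> one_orbit" unfolding one_orbit_def fixpt_def using fixed_point_imp_separated by blast
  have 5: "equicont \<Longrightarrow> one_orbit"
    unfolding one_orbit_def equicont_def using equicontinuous_imp_separated zero_Bop by blast
  have 6: "equicont" if fx: fixpt
  proof -
    obtain Y where Y: "Y \<in> Bop" "\<forall>g\<in>G. g Y = Y" using fx unfolding fixpt_def by blast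
    then obtain K where K: "0 < K" "\<And>g A B. g \<in> G \<Longrightarrow> A \<in> Bop \<Longrightarrow> B \<in> Bop \<Longrightarrow> norm (g A - g B) \<le> K * norm (A - B)"
      using fixed_point_imp_Lipschitz[OF Y] by blast
    show ?thesis
      unfolding equicont_def
    proof (intro allI impI)
      fix \<epsilon> :: real assume e: "0 < \<epsilon>"
      have "norm (g A - g B) < \<epsilon>" if "A \<in> Bop" "B \<in> Bop" "norm (A - B) < \<epsilon> / K" "g \<in> G" for A B g
      proof -
        have "norm (g A - g B) \<le> K * norm (A - B)" using K(2) that by blast
        also have "\<dots> < \<epsilon>" using that(3) K(1) by (simp add: pos_less_divide_eq mult.commute)
        finally show ?thesis .
      qed
      then show "\<exists>\<delta>>0. \<forall>A\<in>Bop. \<forall>B\<in>Bop. norm (A - B) < \<delta> \<longrightarrow> (\<forall>g\<in>G. norm (g A - g B) < \<epsilon>)"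
        using e K(1) by (intro exI[of _ "\<epsilon> / K"]) auto
    qed
  qed
  show ?thesis using 1 2 3 4 5 6 by blast
qed

end
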